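(* Let $(S_t)_{t\in\mathbb R}$ and $(T_t)_{t\in\mathbb R}$ be weakly mixing measure-preserving flows on standard probability spaces. Suppose the product flows $S_t\times S_t$ and $T_t\times T_t$ are isomorphic. Suppose moreover that there exist a sequence $(t_i)$ of reals and a continuous (atomless) Borel probability measure $\nu$ on $\mathbb R$ such that $$T_{t_i}\ \longrightarrow\ \int_{\mathbb R} T_a\, d\nu(a)$$ in the weak operator topology on $L^2$. Then the flows $S_t$ and $T_t$ are isomorphic. *)

theory Defs
  imports "HOL-Probability.Probability"
begin

definition standard_prob_space :: "'a::polish_space measure \<Rightarrow> bool" where
  "standard_prob_space M \<longleftrightarrow> prob_space M \<and> sets M = sets (borel :: 'a measure)"

definition mp_flow :: "'a measure \<Rightarrow> (real \<Rightarrow> 'a \<Rightarrow> 'a) \<Rightarrow> bool" where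
  "mp_flow M S \<longleftrightarrow> prob_space M
     \<and> (\<lambda>(t, x). S t x) \<in> (borel \<Otimes>\<^sub>M M) \<rightarrow>\<^sub>M M
     \<and> (\<forall>t. S t \<in> M \<rightarrow>\<^sub>M M \<and> distr M M (S t) = M)
     \<and> (\<forall>x\<in>space M. S 0 x = x)
     \<and> (\<forall>s t. \<forall>x\<in>space M. S (s + t) x = S s (S t x))"

definition weakly_mixing_flow :: "'a measure \<Rightarrow> (real \<Rightarrow> 'a \<Rightarrow> 'a) \<Rightarrow> bool" where
  "weakly_mixing_flow M S \<longleftrightarrow> mp_flow M S \<and>
     (\<forall>A\<in>sets M. \<forall>B\<in>sets M.
       ((\<lambda>T. (1 / T) * (LBINT t:{0..T}.
           \<bar>measure M (S t -` A \<inter> space M \<inter> B) - measure M A * measure M B\<bar>)) \<longlongrightarrow> 0) at_top)"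

definition flow_iso :: "'a measure \<Rightarrow> (real \<Rightarrow> 'a \<Rightarrow> 'a) \<Rightarrow> 'b measure \<Rightarrow> (real \<Rightarrow> 'b \<Rightarrow> 'b) \<Rightarrow> bool" where
  "flow_iso M S N T \<longleftrightarrow> (\<exists>\<phi> \<psi>. \<phi> \<in> M \<rightarrow>\<^sub>M N \<and> \<psi> \<in> N \<rightarrow>\<^sub>M M \<and> distr M N \<phi> = N
     \<and> (AE x in M. \<psi> (\<phi> x) = x) \<and> (AE y in N. \<phi> (\<psi> y) = y)
     \<and> (\<forall>t. AE x in M. \<phi> (S t x) = T t (\<phi> x)))"

definition prod_flow :: "(real \<Rightarrow> 'a \<Rightarrow> 'a) \<Rightarrow> real \<Rightarrow> 'a \<times> 'a \<Rightarrow> 'a \<times> 'a" where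
  "prod_flow S t p = (S t (fst p), S t (snd p))"

definition L2_fun :: "'a measure \<Rightarrow> ('a \<Rightarrow> real) \<Rightarrow> bool" where
  "L2_fun M f \<longleftrightarrow> f \<in> borel_measurable M \<and> integrable M (\<lambda>x. (f x)\<^sup>2)"

end

theory Submission
  imports Defs
begin

text \<open>Conjugate everything to \<open>N \<otimes> N\<close> and write \<open>X1, X2\<close> for the coordinates of the isomorphism onto \<open>M \<otimes> M\<close>,
  \<open>y1, y2\<close> for those of \<open>N \<otimes> N\<close>. The operators \<open>S\<^bsub>t i\<^esub> \<otimes> S\<^bsub>t i\<^esub>\<close> converge to a tensor product, and on the other hand to the
  average of \<open>T\<^sub>a \<otimes> T\<^sub>b\<close> over \<open>\<nu> \<otimes> \<nu>\<close>. Weak mixing then forces almost every \<open>T\<^sub>a \<times> T\<^sub>b\<close> to be a product map in the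
  coordinates \<open>X1, X2\<close>. As \<open>\<nu>\<close> is atomless, all the maps \<open>T\<^sub>c \<times> id\<close> are product maps, and hence so is their weak limit,
  the projection on functions of \<open>y2\<close>. If this projection kills the nonconstant functions of \<open>X1\<close>, or
  those of \<open>X2\<close>, then \<open>y2\<close> is a function of the other coordinate. Otherwise \<open>T\<close> has two independent nontrivial factors, and the
  correlations of the first are independent under \<open>\<nu>\<close> of those of the second; but they determine the time,
  which would make \<open>\<nu>\<close> a point mass. The same applies to \<open>y1\<close>, so the isomorphism is a product map up to a swap.\<close>

section \<open>Bounded measurable functions\<close>

text \<open>Two devices carry the argument. Being a function of \<open>X1\<close> is not expressed
  through a sigma-algebra but through integrals: up to null sets, \<open>h\<close> is such a
  function exactly when the integral of \<open>f (X1 y) * k (X2 y) * h y\<close> splits off the mean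
  of \<open>k\<close> for all bounded \<open>f\<close>, \<open>k\<close>. This identity is linear in
  \<open>h\<close> and passes to weak limits, which is how product maps survive limits of times.
  Moreover, weak limits are recorded as joint laws of two measure-preserving maps, so that
  convergence on rectangles is enough. The obstacle lies in the last step: the limit along
  \<open>t\<close> only shows that correlations of the two factors are uncorrelated under
  \<open>\<nu>\<close>, while independence is wanted. Mixing repairs this, because a product of two
  correlations of one factor is a limit of correlations of that same factor. Test functions are
  bounded at every point, not merely almost everywhere, so that a coordinate may be frozen and an
  average over times formed without a new exceptional set.\<close>

definition bdd_meas :: "'a measure \<Rightarrow> ('a \<Rightarrow> real) \<Rightarrow> bool" where
  "bdd_meas P f \<longleftrightarrow> f \<in> borel_measurable P \<and> (\<exists>C. \<forall>x. \<bar>f x\<bar> \<le> C)"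

lemma bdd_measI: "f \<in> borel_measurable P \<Longrightarrow> (\<And>x. \<bar>f x\<bar> \<le> C) \<Longrightarrow> bdd_meas P f"
  unfolding bdd_meas_def by blast

lemma bdd_measD [measurable_dest]: "bdd_meas P f \<Longrightarrow> f \<in> borel_measurable P"
  unfolding bdd_meas_def by blast

lemma bdd_meas_bound:
  assumes "bdd_meas P f" obtains C where "0 < C" "\<And>x. \<bar>f x\<bar> \<le> C"
proof -
  from assms obtain C where "\<And>x. \<bar>f x\<bar> \<le> C" unfolding bdd_meas_def by blast
  then have "\<bar>f x\<bar> \<le> \<bar>C\<bar> + 1" for x using abs_ge_self[of C] by (meson add_increasing2 order_trans zero_le_one)
  then show ?thesis using that[of "\<bar>C\<bar> + 1"] by simp
qed

lemma bdd_meas_const [intro, simp]: "bdd_meas P (\<lambda>_. c)"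
  by (rule bdd_measI[of _ _ "\<bar>c\<bar>"]) auto

lemma bdd_meas_indicator [intro]: "A \<in> sets P \<Longrightarrow> bdd_meas P (indicator A)"
  by (rule bdd_measI[of _ _ 1]) (auto simp: indicator_def)

lemma bdd_meas_add [intro]:
  assumes "bdd_meas P f" "bdd_meas P g" shows "bdd_meas P (\<lambda>x. f x + g x)"
proof -
  from assms obtain C D where "\<And>x. \<bar>f x\<bar> \<le> C" "\<And>x. \<bar>g x\<bar> \<le> D"
    unfolding bdd_meas_def by blast
  then show ?thesis using assms
    by (intro bdd_measI[of _ _ "C + D"]) (auto simp: bdd_meas_def intro: order_trans[OF abs_triangle_ineq] add_mono)
qed

lemma bdd_meas_mult [intro]:
  assumes "bdd_meas P f" "bdd_meas P g" shows "bdd_meas P (\<lambda>x. f x * g x)"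
proof -
  obtain C where "0 < C" "\<And>x. \<bar>f x\<bar> \<le> C" using bdd_meas_bound[OF assms(1)] by blast
  moreover obtain D where "0 < D" "\<And>x. \<bar>g x\<bar> \<le> D" using bdd_meas_bound[OF assms(2)] by blast
  ultimately have "\<bar>f x * g x\<bar> \<le> C * D" for x
    unfolding abs_mult by (intro mult_mono) (auto intro: less_imp_le)
  then show ?thesis using assms by (intro bdd_measI[of _ _ "C * D"]) (auto dest: bdd_measD)
qed

lemma bdd_meas_diff [intro]:
  assumes "bdd_meas P f" "bdd_meas P g" shows "bdd_meas P (\<lambda>x. f x - g x)"
  using bdd_meas_add[OF assms(1) bdd_meas_mult[OF bdd_meas_const[of P "-1"] assms(2)]] by simp

lemma bdd_meas_abs [intro]: "bdd_meas P f \<Longrightarrow> bdd_meas P (\<lambda>x. \<bar>f x\<bar>)"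
  unfolding bdd_meas_def by auto

lemma bdd_meas_comp: "bdd_meas P f \<Longrightarrow> \<tau> \<in> Q \<rightarrow>\<^sub>M P \<Longrightarrow> bdd_meas Q (\<lambda>x. f (\<tau> x))"
  unfolding bdd_meas_def by (auto intro: measurable_compose)

lemma (in finite_measure) bdd_meas_integrable: "bdd_meas M f \<Longrightarrow> integrable M f"
  unfolding bdd_meas_def by (metis integrable_const_bound AE_I2 real_norm_def)

text \<open>A nonintegrable function has Bochner integral 0, and \<open>C\<close> is nonnegative as
  a bound of absolute values, so the estimate covers that case as well.\<close>

lemma (in prob_space) abs_integral_le_const:
  fixes f :: "'a \<Rightarrow> real"
  assumes "\<And>x. \<bar>f x\<bar> \<le> C" shows "\<bar>\<integral>x. f x \<partial>M\<bar> \<le> C"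
proof (cases "integrable M f")
  case True
  have "\<bar>\<integral>x. f x \<partial>M\<bar> \<le> (\<integral>x. \<bar>f x\<bar> \<partial>M)" by (rule integral_abs_bound)
  also have "\<dots> \<le> (\<integral>x. C \<partial>M)" using True assms by (intro integral_mono) auto
  finally show ?thesis by (simp add: prob_space)
next
  case False
  have "0 \<le> C" using assms[of undefined] by linarith
  with False show ?thesis by (simp add: not_integrable_integral_eq)
qed

lemma (in prob_space) bdd_meas_integral:
  assumes Q: "(\<lambda>(x, y). f x y) \<in> borel_measurable (Q \<Otimes>\<^sub>M M)" and C: "\<And>x y. \<bar>f x y\<bar> \<le> C"
  shows "bdd_meas Q (\<lambda>x. \<integral>y. f x y \<partial>M)"
  using Q by (intro bdd_measI[of _ _ C] borel_measurable_lebesgue_integral abs_integral_le_const C) auto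

lemma (in prob_space) bounded_convergence:
  fixes s :: "nat \<Rightarrow> 'a \<Rightarrow> real"
  assumes "\<And>i. s i \<in> borel_measurable M" "f \<in> borel_measurable M" "\<And>i x. \<bar>s i x\<bar> \<le> C"
    and "AE x in M. (\<lambda>i. s i x) \<longlonglongrightarrow> f x"
  shows "(\<lambda>i. \<integral>x. s i x \<partial>M) \<longlonglongrightarrow> (\<integral>x. f x \<partial>M)"
  by (rule integral_dominated_convergence[where w="\<lambda>_. C"]) (use assms in auto)

lemma (in prob_space) AE_eq_0I:
  fixes f :: "'a \<Rightarrow> real"
  assumes "bdd_meas M f" "(\<integral>x. f x * f x \<partial>M) = 0" shows "AE x in M. f x = 0"
proof -
  have "AE x in M. f x * f x = 0"
    using integral_nonneg_eq_0_iff_AE[of M "\<lambda>x. f x * f x"] assms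
    by (auto intro!: bdd_meas_integrable)
  then show ?thesis by simp
qed

lemma (in prob_space) integral_indicator_prob:
  assumes "A \<in> sets M" shows "(\<integral>x. indicator A x \<partial>M) = prob A"
  using assms sets.sets_into_space[OF assms] by (simp add: Int_absorb2)

lemma (in prob_space) integral_distr_eq:
  assumes "\<tau> \<in> M \<rightarrow>\<^sub>M P" "distr M P \<tau> = P" "f \<in> borel_measurable P"
  shows "(\<integral>x. f (\<tau> x) \<partial>M) = (\<integral>y. (f y :: real) \<partial>P)"
  using integral_distr[OF assms(1,3)] assms(2) by simp

text \<open>\<open>R\<close> is an arbitrary predicate: what is pulled back along
  \<open>\<tau>\<close> is a null set containing the points where \<open>R\<close> fails.\<close>

lemma AE_distr_eq:
  assumes "\<tau> \<in> M \<rightarrow>\<^sub>M P" "distr M P \<tau> = P" "AE y in P. R y"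
  shows "AE x in M. R (\<tau> x)"
proof -
  from assms(3) obtain Z where Z: "Z \<in> null_sets P" "{y \<in> space P. \<not> R y} \<subseteq> Z"
    unfolding eventually_ae_filter by blast
  then have "Z \<in> null_sets (distr M P \<tau>)" using assms(2) by simp
  then have "\<tau> -` Z \<inter> space M \<in> null_sets M"
    using assms(1) by (simp add: null_sets_distr_iff)
  moreover have "{x \<in> space M. \<not> R (\<tau> x)} \<subseteq> \<tau> -` Z \<inter> space M"
    using Z(2) measurable_space[OF assms(1)] by blast
  ultimately show ?thesis by (rule AE_I')
qed

lemma integral_prod_mult:
  fixes f :: "'a \<Rightarrow> real" and g :: "'b \<Rightarrow> real"
  assumes "prob_space P" "prob_space Q" "bdd_meas P f" "bdd_meas Q g"
  shows "(\<integral>z. f (fst z) * g (snd z) \<partial>(P \<Otimes>\<^sub>M Q)) = (\<integral>x. f x \<partial>P) * (\<integral>y. g y \<partial>Q)"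
proof -
  interpret P: prob_space P by fact
  interpret Q: prob_space Q by fact
  interpret PQ: pair_prob_space P Q ..
  have "bdd_meas (P \<Otimes>\<^sub>M Q) (\<lambda>z. f (fst z) * g (snd z))"
    by (intro bdd_meas_mult bdd_meas_comp[OF assms(3)] bdd_meas_comp[OF assms(4)]) auto
  then have "integrable (P \<Otimes>\<^sub>M Q) (\<lambda>z. f (fst z) * g (snd z))"
    by (rule PQ.P.bdd_meas_integrable)
  then have "(\<integral>z. f (fst z) * g (snd z) \<partial>(P \<Otimes>\<^sub>M Q)) = (\<integral>x. (\<integral>y. f x * g y \<partial>Q) \<partial>P)"
    by (subst PQ.integral_fst'[symmetric]) auto
  then show ?thesis by simp
qed

lemma Fubini_bdd:
  assumes "prob_space P" "prob_space Q" "bdd_meas (P \<Otimes>\<^sub>M Q) f"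
  shows "(\<integral>z. f z \<partial>(P \<Otimes>\<^sub>M Q)) = (\<integral>x. (\<integral>y. f (x, y) \<partial>Q) \<partial>P)"
    and "(\<integral>z. f z \<partial>(P \<Otimes>\<^sub>M Q)) = (\<integral>y. (\<integral>x. f (x, y) \<partial>P) \<partial>Q)"
proof -
  interpret P: prob_space P by fact
  interpret Q: prob_space Q by fact
  interpret PQ: pair_prob_space P Q ..
  have i: "integrable (P \<Otimes>\<^sub>M Q) f" using assms(3) by (rule PQ.P.bdd_meas_integrable)
  show "(\<integral>z. f z \<partial>(P \<Otimes>\<^sub>M Q)) = (\<integral>x. (\<integral>y. f (x, y) \<partial>Q) \<partial>P)"
    by (rule PQ.integral_fst'[OF i, symmetric])
  show "(\<integral>z. f z \<partial>(P \<Otimes>\<^sub>M Q)) = (\<integral>y. (\<integral>x. f (x, y) \<partial>P) \<partial>Q)"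
    using PQ.integral_snd[of "\<lambda>x y. f (x, y)"] i by (simp add: case_prod_beta')
qed

section \<open>Functionals bounded by the \<open>L\<^sup>1\<close> norm\<close>

text \<open>Elements of the dual of \<open>L1\<close>, restricted to bounded functions. The norm
  bound \<open>C\<close> is a parameter so that one constant can serve a whole sequence.\<close>

definition L1_functional :: "'c measure \<Rightarrow> real \<Rightarrow> (('c \<Rightarrow> real) \<Rightarrow> real) \<Rightarrow> bool" where
  "L1_functional P C L \<longleftrightarrow>
     (\<forall>f g. bdd_meas P f \<longrightarrow> bdd_meas P g \<longrightarrow> L (\<lambda>x. f x + g x) = L f + L g) \<and>
     (\<forall>c f. bdd_meas P f \<longrightarrow> L (\<lambda>x. c * f x) = c * L f) \<and>
     (\<forall>f. bdd_meas P f \<longrightarrow> \<bar>L f\<bar> \<le> C * (\<integral>x. \<bar>f x\<bar> \<partial>P))"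

lemma L1_functionalI:
  assumes "\<And>f g. bdd_meas P f \<Longrightarrow> bdd_meas P g \<Longrightarrow> L (\<lambda>x. f x + g x) = L f + L g"
    and "\<And>c f. bdd_meas P f \<Longrightarrow> L (\<lambda>x. c * f x) = c * L f"
    and "\<And>f. bdd_meas P f \<Longrightarrow> \<bar>L f\<bar> \<le> C * (\<integral>x. \<bar>f x\<bar> \<partial>P)"
  shows "L1_functional P C L"
  using assms unfolding L1_functional_def by blast

lemma L1_functional_add:
  "L1_functional P C L \<Longrightarrow> bdd_meas P f \<Longrightarrow> bdd_meas P g \<Longrightarrow> L (\<lambda>x. f x + g x) = L f + L g"
  unfolding L1_functional_def by blast

lemma L1_functional_scale:
  "L1_functional P C L \<Longrightarrow> bdd_meas P f \<Longrightarrow> L (\<lambda>x. c * f x) = c * L f"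
  unfolding L1_functional_def by blast

lemma L1_functional_bound:
  "L1_functional P C L \<Longrightarrow> bdd_meas P f \<Longrightarrow> \<bar>L f\<bar> \<le> C * (\<integral>x. \<bar>f x\<bar> \<partial>P)"
  unfolding L1_functional_def by blast

lemma L1_functional_diff:
  assumes "L1_functional P C L" "bdd_meas P f" "bdd_meas P g"
  shows "L (\<lambda>x. f x - g x) = L f - L g"
  using L1_functional_add[OF assms(1,2) bdd_meas_mult[OF bdd_meas_const[of P "-1"] assms(3)]]
    L1_functional_scale[OF assms(1,3), of "-1"] by simp

lemma L1_functional_zero: "L1_functional P C L \<Longrightarrow> L (\<lambda>x. 0) = 0"
  using L1_functional_scale[of P C L "\<lambda>_. 0" 0] by simp

text \<open>The source of most functionals below: the weight \<open>K\<close> costs its supremum,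
  and composition with a measure-preserving \<open>\<tau>\<close> leaves the \<open>L1\<close> norm
  unchanged.\<close>

lemma L1_functional_comp:
  assumes Q: "prob_space Q" and K: "K \<in> borel_measurable Q" "\<And>x. \<bar>K x\<bar> \<le> C"
    and \<tau>: "\<tau> \<in> Q \<rightarrow>\<^sub>M P" "distr Q P \<tau> = P"
  shows "L1_functional P C (\<lambda>f. \<integral>x. K x * f (\<tau> x) \<partial>Q)"
proof -
  interpret Q: prob_space Q by fact
  have K': "bdd_meas Q K" using K by (rule bdd_measI)
  have int: "integrable Q (\<lambda>x. K x * f (\<tau> x))" if "bdd_meas P f" for f
    using bdd_meas_mult[OF K' bdd_meas_comp[OF that \<tau>(1)]] by (rule Q.bdd_meas_integrable)
  show ?thesis
  proof (rule L1_functionalI)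
    fix f g assume "bdd_meas P f" "bdd_meas P g"
    from int[OF this(1)] int[OF this(2)]
    show "(\<integral>x. K x * (f (\<tau> x) + g (\<tau> x)) \<partial>Q) = (\<integral>x. K x * f (\<tau> x) \<partial>Q) + (\<integral>x. K x * g (\<tau> x) \<partial>Q)"
      by (simp add: algebra_simps)
  next
    fix c f
    have "(\<lambda>x. K x * (c * f (\<tau> x))) = (\<lambda>x. c * (K x * f (\<tau> x)))" by auto
    then show "(\<integral>x. K x * (c * f (\<tau> x)) \<partial>Q) = c * (\<integral>x. K x * f (\<tau> x) \<partial>Q)" by simp
  next
    fix f assume f: "bdd_meas P f"
    have "\<bar>\<integral>x. K x * f (\<tau> x) \<partial>Q\<bar> \<le> (\<integral>x. \<bar>K x * f (\<tau> x)\<bar> \<partial>Q)" by (rule integral_abs_bound)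
    also have "\<dots> \<le> (\<integral>x. C * \<bar>f (\<tau> x)\<bar> \<partial>Q)"
    proof (rule integral_mono)
      show "integrable Q (\<lambda>x. \<bar>K x * f (\<tau> x)\<bar>)" using int[OF f] by auto
      show "integrable Q (\<lambda>x. C * \<bar>f (\<tau> x)\<bar>)"
        using f by (intro Q.bdd_meas_integrable bdd_meas_mult bdd_meas_abs bdd_meas_comp[OF f \<tau>(1)]) auto
    qed (use K in \<open>auto simp: abs_mult intro!: mult_right_mono\<close>)
    also have "\<dots> = C * (\<integral>x. \<bar>f x\<bar> \<partial>P)"
      using Q.integral_distr_eq[OF \<tau>, of "\<lambda>x. \<bar>f x\<bar>"] f by simp
    finally show "\<bar>\<integral>x. K x * f (\<tau> x) \<partial>Q\<bar> \<le> C * (\<integral>x. \<bar>f x\<bar> \<partial>P)" .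
  qed
qed

lemma L1_functional_mult:
  assumes "prob_space P" "K \<in> borel_measurable P" "\<And>x. \<bar>K x\<bar> \<le> C"
  shows "L1_functional P C (\<lambda>f. \<integral>x. K x * f x \<partial>P)"
  using L1_functional_comp[OF assms, of "\<lambda>x. x" P] by (simp add: distr_id[unfolded id_def])

lemma L1_functional_mono:
  assumes "L1_functional P C L" "C \<le> D" shows "L1_functional P D L"
proof (rule L1_functionalI)
  fix f assume f: "bdd_meas P f"
  have "C * (\<integral>x. \<bar>f x\<bar> \<partial>P) \<le> D * (\<integral>x. \<bar>f x\<bar> \<partial>P)"
    using assms(2) by (intro mult_right_mono integral_nonneg_AE) auto
  then show "\<bar>L f\<bar> \<le> D * (\<integral>x. \<bar>f x\<bar> \<partial>P)"
    using L1_functional_bound[OF assms(1) f] by linarith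
qed (auto simp: L1_functional_add[OF assms(1)] L1_functional_scale[OF assms(1)])

text \<open>The abstract density argument: the approximants converge, are close to \<open>x\<close>
  uniformly in \<open>n\<close>, and their limit is close to the candidate \<open>y\<close>.\<close>

lemma dense_limit:
  fixes x :: "nat \<Rightarrow> real"
  assumes "\<And>e. e > 0 \<Longrightarrow> \<exists>z l. z \<longlonglongrightarrow> l \<and> (\<forall>n. \<bar>x n - z n\<bar> \<le> e) \<and> \<bar>y - l\<bar> \<le> e"
  shows "x \<longlonglongrightarrow> y"
proof (rule LIMSEQ_I)
  fix r :: real assume "0 < r"
  then obtain z l where z: "z \<longlonglongrightarrow> l" "\<And>n. \<bar>x n - z n\<bar> \<le> r/4" "\<bar>y - l\<bar> \<le> r/4"
    using assms[of "r/4"] by auto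
  obtain n0 where n0: "\<And>n. n \<ge> n0 \<Longrightarrow> norm (z n - l) < r/4"
    using LIMSEQ_D[OF z(1), of "r/4"] \<open>0 < r\<close> by auto
  have "norm (x n - y) < r" if "n \<ge> n0" for n
    using n0[OF that] z(2)[of n] z(3) \<open>0 < r\<close> by (simp add: abs_if split: if_splits)
  then show "\<exists>no. \<forall>n\<ge>no. norm (x n - y) < r" by blast
qed

text \<open>A family that is uniformly bounded in the \<open>L\<^sup>1\<close> norm and converges on a generating
  \<open>\<pi>\<close>-system converges everywhere, by Dynkin's theorem and monotone approximation.\<close>

lemma L1_functional_limit:
  fixes P :: "'c measure"
  assumes P: "prob_space P" and sp: "space P = UNIV"
    and E: "Int_stable E" "sets P = sigma_sets UNIV E" "UNIV \<in> E"
    and L: "\<And>n::nat. L1_functional P C (L n)" and L': "L1_functional P C L'"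
    and conv: "\<And>A. A \<in> E \<Longrightarrow> (\<lambda>n. L n (indicator A)) \<longlonglongrightarrow> L' (indicator A)"
    and f: "bdd_meas P f"
  shows "(\<lambda>n. L n f) \<longlonglongrightarrow> L' f"
proof -
  interpret P: prob_space P by fact
  have C0: "0 \<le> C"
    using L1_functional_bound[OF L', of "\<lambda>_. 1"] by (simp add: P.prob_space)
  have approx: "(\<lambda>n. L n g) \<longlonglongrightarrow> L' g"
    if g: "bdd_meas P g" and U: "\<And>i. bdd_meas P (U i)" "\<And>i. (\<lambda>n. L n (U i)) \<longlonglongrightarrow> L' (U i)"
      and lim: "(\<lambda>i. \<integral>x. \<bar>g x - U i x\<bar> \<partial>P) \<longlonglongrightarrow> 0" for g and U :: "nat \<Rightarrow> 'c \<Rightarrow> real"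
  proof (rule dense_limit)
    fix e :: real assume e: "e > 0"
    \<comment> \<open>Division is by \<open>C + 1\<close> because \<open>C\<close> may
      vanish.\<close>
    then have "e / (C + 1) > 0" using C0 by simp
    from LIMSEQ_D[OF lim this] obtain i where "norm (\<integral>x. \<bar>g x - U i x\<bar> \<partial>P) < e / (C + 1)" by fastforce
    then have "(C + 1) * (\<integral>x. \<bar>g x - U i x\<bar> \<partial>P) \<le> e" using C0 by (simp add: field_simps)
    moreover have "C * (\<integral>x. \<bar>g x - U i x\<bar> \<partial>P) \<le> (C + 1) * (\<integral>x. \<bar>g x - U i x\<bar> \<partial>P)"
      by (intro mult_right_mono) (auto intro: integral_nonneg_AE)
    ultimately have i: "C * (\<integral>x. \<bar>g x - U i x\<bar> \<partial>P) \<le> e" by linarith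
    have "\<bar>L n g - L n (U i)\<bar> \<le> e" for n
      using L1_functional_bound[OF L bdd_meas_diff[OF g U(1)], of n i] i
      by (simp add: L1_functional_diff[OF L g U(1)])
    moreover have "\<bar>L' g - L' (U i)\<bar> \<le> e"
      using L1_functional_bound[OF L' bdd_meas_diff[OF g U(1)], of i] i
      by (simp add: L1_functional_diff[OF L' g U(1)])
    ultimately show "\<exists>z l. z \<longlonglongrightarrow> l \<and> (\<forall>n. \<bar>L n g - z n\<bar> \<le> e) \<and> \<bar>L' g - l\<bar> \<le> e"
      using U(2)[of i] by blast
  qed
  have sets: "(\<lambda>n. L n (indicator A)) \<longlonglongrightarrow> L' (indicator A)" if "A \<in> sets P" for A
  proof -
    from that have "A \<in> sigma_sets UNIV E" using E by simp
    from E(1) subset_UNIV[of E, folded Pow_UNIV] this show ?thesis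
    proof (induction rule: sigma_sets_induct_disjoint)
    next
      case (basic A) then show ?case by (rule conv)
    next
      case empty
      have "indicator {} = (\<lambda>x::'c. 0::real)" by auto
      then show ?case by (simp add: L1_functional_zero[OF L] L1_functional_zero[OF L'])
    next
      case (compl A)
      have eq: "indicator (UNIV - A) = (\<lambda>x. indicator UNIV x - indicator A x :: real)"
        by (auto simp: indicator_def)
      have A: "bdd_meas P (indicator A)" using compl E by auto
      have U: "bdd_meas P (indicator UNIV)" by (auto simp: sp[symmetric])
      show ?case unfolding eq L1_functional_diff[OF L U A] L1_functional_diff[OF L' U A]
        by (intro tendsto_diff conv E compl)
    next
      case (union A)
      have A: "A i \<in> sets P" for i using union E by blast
      \<comment> \<open>Additivity handles the finite disjoint unions \<open>U i\<close>; they
        approximate the countable union in \<open>L1\<close>, which \<open>approx\<close> turns into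
        convergence.\<close>
      define U where "U i = (\<Union>j<i. A j)" for i
      have U: "U i \<in> sets P" for i unfolding U_def using A by auto
      have Uc: "(\<lambda>n. L n (indicator (U i))) \<longlonglongrightarrow> L' (indicator (U i))" for i
      proof (induction i)
        case 0
        have "indicator (U 0) = (\<lambda>x::'c. 0::real)" by (auto simp: U_def)
        then show ?case by (simp add: L1_functional_zero[OF L] L1_functional_zero[OF L'])
      next
        case (Suc i)
        have "A j \<inter> A i = {}" if "j < i" for j
          using union(1) that unfolding disjoint_family_on_def by simp
        then have disj: "U i \<inter> A i = {}" unfolding U_def by auto
        have eq: "indicator (U (Suc i)) = (\<lambda>x. indicator (U i) x + indicator (A i) x :: real)"
          using disj by (auto simp: U_def indicator_def lessThan_Suc fun_eq_iff)
        have b: "bdd_meas P (indicator (U i))" "bdd_meas P (indicator (A i))" using U A by auto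
        show ?case unfolding eq L1_functional_add[OF L b] L1_functional_add[OF L' b]
          by (intro tendsto_add Suc union)
      qed
      have un: "(\<Union>i. A i) \<in> sets P" using A by auto
      show ?case
      proof (rule approx[of _ "\<lambda>i. indicator (U i)"])
        have "(\<lambda>i. \<integral>x. \<bar>indicator (\<Union>i. A i) x - indicator (U i) x\<bar> \<partial>P) \<longlonglongrightarrow> (\<integral>x. (0::real) \<partial>P)"
        proof (rule P.bounded_convergence[where C=1])
          show "AE x in P. (\<lambda>i. \<bar>indicator (\<Union>i. A i) x - indicator (U i) x\<bar>) \<longlonglongrightarrow> (0::real)"
          proof (rule AE_I2)
            fix x
            show "(\<lambda>i. \<bar>indicator (\<Union>i. A i) x - indicator (U i) x\<bar>) \<longlonglongrightarrow> (0::real)"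
            proof (cases "x \<in> (\<Union>i. A i)")
              case True
              then obtain j where "x \<in> A j" by blast
              then have "\<forall>\<^sub>F i in sequentially. x \<in> U i"
                unfolding eventually_sequentially U_def by (intro exI[of _ "Suc j"]) fastforce
              then have "\<forall>\<^sub>F i in sequentially. \<bar>indicator (\<Union>i. A i) x - indicator (U i) x\<bar> = (0::real)"
                by eventually_elim (use True in auto)
              then show ?thesis by (rule tendsto_eventually)
            next
              case False then show ?thesis by (auto simp: U_def indicator_def)
            qed
          qed
          show "\<bar>\<bar>indicator (\<Union>i. A i) x - indicator (U i) x\<bar>\<bar> \<le> (1::real)" for i x
            by (auto simp: indicator_def)
          have [measurable]: "(\<Union>i. A i) \<in> sets P" "\<And>i. U i \<in> sets P" using un U by auto
          show "(\<lambda>x. \<bar>indicator (\<Union>i. A i) x - indicator (U i) x\<bar> :: real) \<in> borel_measurable P" for i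
            by measurable
        qed simp
        then show "(\<lambda>i. \<integral>x. \<bar>indicator (\<Union>i. A i) x - indicator (U i) x\<bar> \<partial>P) \<longlonglongrightarrow> (0::real)"
          by simp
      qed (use un U Uc in auto)
    qed
  qed
  have pos: "(\<lambda>n. L n g) \<longlonglongrightarrow> L' g" if g: "bdd_meas P g" and g0: "\<And>x. 0 \<le> g x" for g
  proof -
    have "bdd_meas P g \<longrightarrow> (\<lambda>n. L n g) \<longlonglongrightarrow> L' g"
    proof (rule borel_measurable_induct_real[of g P])
      show "g \<in> borel_measurable P" using g by (rule bdd_measD)
      show "0 \<le> g x" for x by (rule g0)
    next
      fix A assume "A \<in> sets P" then show "bdd_meas P (indicator A) \<longrightarrow> (\<lambda>n. L n (indicator A)) \<longlonglongrightarrow> L' (indicator A)"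
        using sets by blast
    next
      fix u :: "'c \<Rightarrow> real" and c :: real
      assume u: "0 \<le> c" "u \<in> borel_measurable P" "\<And>x. 0 \<le> u x" "bdd_meas P u \<longrightarrow> (\<lambda>n. L n u) \<longlonglongrightarrow> L' u"
      show "bdd_meas P (\<lambda>x. c * u x) \<longrightarrow> (\<lambda>n. L n (\<lambda>x. c * u x)) \<longlonglongrightarrow> L' (\<lambda>x. c * u x)"
      proof (cases "c = 0")
        case True then show ?thesis by (simp add: L1_functional_zero[OF L] L1_functional_zero[OF L'])
      next
        case False
        show ?thesis
        proof
          assume "bdd_meas P (\<lambda>x. c * u x)"
          from bdd_meas_mult[OF bdd_meas_const this, of "1/c"] have "bdd_meas P u" using False by simp
          with u show "(\<lambda>n. L n (\<lambda>x. c * u x)) \<longlonglongrightarrow> L' (\<lambda>x. c * u x)"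
            by (simp add: L1_functional_scale[OF L] L1_functional_scale[OF L'] tendsto_mult_left)
        qed
      qed
    next
      fix u v :: "'c \<Rightarrow> real"
      assume u: "u \<in> borel_measurable P" "\<And>x. 0 \<le> u x" "bdd_meas P u \<longrightarrow> (\<lambda>n. L n u) \<longlonglongrightarrow> L' u"
        and v: "v \<in> borel_measurable P" "\<And>x. 0 \<le> v x" "bdd_meas P v \<longrightarrow> (\<lambda>n. L n v) \<longlonglongrightarrow> L' v"
      show "bdd_meas P (\<lambda>x. v x + u x) \<longrightarrow> (\<lambda>n. L n (\<lambda>x. v x + u x)) \<longlonglongrightarrow> L' (\<lambda>x. v x + u x)"
      proof
        assume "bdd_meas P (\<lambda>x. v x + u x)"
        then obtain D where D: "\<And>x. \<bar>v x + u x\<bar> \<le> D" unfolding bdd_meas_def by blast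
        have "\<bar>u x\<bar> \<le> D" "\<bar>v x\<bar> \<le> D" for x using D[of x] u(2)[of x] v(2)[of x] by linarith+
        then have b: "bdd_meas P v" "bdd_meas P u" using u(1) v(1) by (auto intro: bdd_measI)
        show "(\<lambda>n. L n (\<lambda>x. v x + u x)) \<longlonglongrightarrow> L' (\<lambda>x. v x + u x)"
          unfolding L1_functional_add[OF L b] L1_functional_add[OF L' b]
          using u(3) v(3) b by (intro tendsto_add) auto
      qed
    next
      fix U assume U: "\<And>i. U i \<in> borel_measurable P" "\<And>i x. 0 \<le> U i x"
        "\<And>i. bdd_meas P (U i) \<longrightarrow> (\<lambda>n. L n (U i)) \<longlonglongrightarrow> L' (U i)" "incseq U"
        "\<And>x. x \<in> space P \<Longrightarrow> (\<lambda>i. U i x) \<longlonglongrightarrow> g x"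
      obtain D where D: "\<And>x. \<bar>g x\<bar> \<le> D" using g unfolding bdd_meas_def by blast
      have le: "U i x \<le> g x" for i x
        using incseq_le[OF _ U(5)[of x], of i] U(4) sp by (auto simp: incseq_def le_fun_def)
      have b: "bdd_meas P (U i)" for i
      proof (rule bdd_measI[of _ _ D])
        show "\<bar>U i x\<bar> \<le> D" for x using le[of i x] U(2)[of i x] D[of x] by linarith
      qed (rule U(1))
      show "bdd_meas P g \<longrightarrow> (\<lambda>n. L n g) \<longlonglongrightarrow> L' g"
      proof (rule impI, rule approx[OF g b])
        have "(\<lambda>i. \<integral>x. \<bar>g x - U i x\<bar> \<partial>P) \<longlonglongrightarrow> (\<integral>x. 0 \<partial>P)"
        proof (rule P.bounded_convergence[where C=D])
          show "\<bar>\<bar>g x - U i x\<bar>\<bar> \<le> D" for i x using le[of i x] U(2)[of i x] D[of x] by linarith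
          show "AE x in P. (\<lambda>i. \<bar>g x - U i x\<bar>) \<longlonglongrightarrow> 0"
            using U(5) by (intro AE_I2) (auto intro!: tendsto_eq_intros)
        qed (use g U in \<open>auto simp: bdd_meas_def\<close>)
        then show "(\<lambda>i. \<integral>x. \<bar>g x - U i x\<bar> \<partial>P) \<longlonglongrightarrow> 0" by simp
      qed (use U(3) b in blast)
    qed
    with g show ?thesis by blast
  qed
  obtain D where D: "\<And>x. \<bar>f x\<bar> \<le> D" using f unfolding bdd_meas_def by blast
  have b: "bdd_meas P (\<lambda>x. f x + D)" by (intro bdd_meas_add bdd_meas_const f)
  have "f x + D \<ge> 0" for x using D[of x] by linarith
  from pos[OF b this] have 1: "(\<lambda>n. L n (\<lambda>x. f x + D)) \<longlonglongrightarrow> L' (\<lambda>x. f x + D)" .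
  have 2: "(\<lambda>n. L n (\<lambda>_. \<bar>D\<bar>)) \<longlonglongrightarrow> L' (\<lambda>_. \<bar>D\<bar>)" by (rule pos) auto
  have D0: "0 \<le> D" using D[of undefined] by linarith
  have eq: "L n f = L n (\<lambda>x. f x + D) - L n (\<lambda>_. \<bar>D\<bar>)" for n
    using L1_functional_diff[OF L b bdd_meas_const, of n D] D0 by simp
  have eq': "L' f = L' (\<lambda>x. f x + D) - L' (\<lambda>_. \<bar>D\<bar>)"
    using L1_functional_diff[OF L' b bdd_meas_const, of D] D0 by simp
  show ?thesis unfolding eq eq' by (intro tendsto_diff 1 2)
qed

text \<open>The previous limit for a constant sequence. Most orthogonality arguments below end here:
  an identity checked on a generator is then evaluated at a cleverly chosen
  \<open>f\<close>.\<close>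

lemma L1_functional_unique:
  fixes P :: "'c measure"
  assumes P: "prob_space P" "space P = UNIV"
    and E: "Int_stable E" "sets P = sigma_sets UNIV E" "UNIV \<in> E"
    and L: "L1_functional P C L" "L1_functional P C' L'"
    and eq: "\<And>A. A \<in> E \<Longrightarrow> L (indicator A) = L' (indicator A)" and f: "bdd_meas P f"
  shows "L f = L' f"
proof -
  have "(\<lambda>n::nat. L f) \<longlonglongrightarrow> L' f"
    by (rule L1_functional_limit[OF P E, where C="max C C'"])
      (use eq f in \<open>auto intro: L1_functional_mono[OF L(1)] L1_functional_mono[OF L(2)]\<close>)
  then show ?thesis by (simp add: LIMSEQ_const_iff)
qed

text \<open>The two arguments are extended one after the other: first \<open>k\<close> becomes
  arbitrary while \<open>h\<close> is an indicator, then \<open>h\<close> while \<open>k\<close> is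
  a fixed bounded function. Each form is bounded by the supremum of one argument times the
  \<open>L1\<close> norm of the other.\<close>

lemma bilinear_limit:
  fixes P :: "'c measure" and Q :: "'d measure"
  assumes P: "prob_space P" "space P = UNIV"
    and E: "Int_stable E" "sets P = sigma_sets UNIV E" "UNIV \<in> E"
    and Q: "prob_space Q" "space Q = UNIV"
    and F: "Int_stable F" "sets Q = sigma_sets UNIV F" "UNIV \<in> F"
    and B1: "\<And>h C n. h \<in> borel_measurable Q \<Longrightarrow> (\<And>x. \<bar>h x\<bar> \<le> C) \<Longrightarrow> L1_functional P C (\<lambda>k. B n k h)"
    and B1': "\<And>h C. h \<in> borel_measurable Q \<Longrightarrow> (\<And>x. \<bar>h x\<bar> \<le> C) \<Longrightarrow> L1_functional P C (\<lambda>k. B' k h)"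
    and B2: "\<And>k C n. k \<in> borel_measurable P \<Longrightarrow> (\<And>x. \<bar>k x\<bar> \<le> C) \<Longrightarrow> L1_functional Q C (\<lambda>h. B n k h)"
    and B2': "\<And>k C. k \<in> borel_measurable P \<Longrightarrow> (\<And>x. \<bar>k x\<bar> \<le> C) \<Longrightarrow> L1_functional Q C (\<lambda>h. B' k h)"
    and conv: "\<And>U V. U \<in> E \<Longrightarrow> V \<in> F \<Longrightarrow>
      (\<lambda>n::nat. B n (indicator U) (indicator V)) \<longlonglongrightarrow> B' (indicator U) (indicator V)"
    and k: "bdd_meas P k" and h: "bdd_meas Q h"
  shows "(\<lambda>n. B n k h) \<longlonglongrightarrow> B' k h"
proof -
  have V: "V \<in> sets Q" if "V \<in> F" for V using that F by auto
  have 1: "(\<lambda>n. B n k (indicator V)) \<longlonglongrightarrow> B' k (indicator V)" if "V \<in> F" for V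
  proof (rule L1_functional_limit[OF P E, where L="\<lambda>n k. B n k (indicator V)"
        and L'="\<lambda>k. B' k (indicator V)" and C=1 and f=k])
    have i: "\<bar>indicator V x :: real\<bar> \<le> 1" for x :: 'd by (auto simp: indicator_def)
    have m: "indicator V \<in> borel_measurable Q" using V[OF that] by simp
    show "L1_functional P 1 (\<lambda>k. B n k (indicator V))" for n by (rule B1[OF m i])
    show "L1_functional P 1 (\<lambda>k. B' k (indicator V))" by (rule B1'[OF m i])
  qed (use conv[OF _ that] k in auto)
  obtain C where C: "\<And>x. \<bar>k x\<bar> \<le> C" using k unfolding bdd_meas_def by blast
  show ?thesis
    by (rule L1_functional_limit[OF Q F, where L="\<lambda>n. B n k" and L'="B' k",
          OF B2[OF bdd_measD[OF k] C] B2'[OF bdd_measD[OF k] C] 1 h])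
qed

text \<open>The limit is presented as a coupling, that is, as the joint law of \<open>\<tau>1\<close> and \<open>\<tau>2\<close>, so that
  both marginals are visibly preserved.\<close>

lemma coupling_limit:
  fixes P :: "'c measure"
  assumes P: "prob_space P" "space P = UNIV"
    and E: "Int_stable E" "sets P = sigma_sets UNIV E" "UNIV \<in> E"
    and Q: "prob_space Q"
    and \<sigma>: "\<And>n::nat. \<sigma> n \<in> P \<rightarrow>\<^sub>M P" "\<And>n. distr P P (\<sigma> n) = P"
    and \<tau>1: "\<tau>1 \<in> Q \<rightarrow>\<^sub>M P" "distr Q P \<tau>1 = P"
    and \<tau>2: "\<tau>2 \<in> Q \<rightarrow>\<^sub>M P" "distr Q P \<tau>2 = P"
    and conv: "\<And>U V. U \<in> E \<Longrightarrow> V \<in> E \<Longrightarrow>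
      (\<lambda>n. \<integral>x. indicator U x * indicator V (\<sigma> n x) \<partial>P)
        \<longlonglongrightarrow> (\<integral>q. indicator U (\<tau>1 q) * (indicator V (\<tau>2 q) :: real) \<partial>Q)"
    and k: "bdd_meas P k" and h: "bdd_meas P h"
  shows "(\<lambda>n. \<integral>x. k x * h (\<sigma> n x) \<partial>P) \<longlonglongrightarrow> (\<integral>q. k (\<tau>1 q) * h (\<tau>2 q) \<partial>Q)"
proof (rule bilinear_limit[OF P E P E, where B="\<lambda>n k h. \<integral>x. k x * h (\<sigma> n x) \<partial>P"
      and B'="\<lambda>k h. \<integral>q. k (\<tau>1 q) * h (\<tau>2 q) \<partial>Q", OF _ _ _ _ conv k h])
  fix h :: "'c \<Rightarrow> real" and C n assume h: "h \<in> borel_measurable P" "\<And>x. \<bar>h x\<bar> \<le> C"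
  have m: "(\<lambda>x. h (\<sigma> n x)) \<in> borel_measurable P" "(\<lambda>q. h (\<tau>2 q)) \<in> borel_measurable Q"
    using h(1) \<sigma>(1) \<tau>2(1) by simp_all
  show "L1_functional P C (\<lambda>k. \<integral>x. k x * h (\<sigma> n x) \<partial>P)"
    using L1_functional_mult[OF P(1) m(1), OF h(2)] by (simp add: mult.commute)
  show "L1_functional P C (\<lambda>k. \<integral>q. k (\<tau>1 q) * h (\<tau>2 q) \<partial>Q)"
    using L1_functional_comp[OF Q m(2) h(2) \<tau>1] by (simp add: mult.commute)
next
  fix k :: "'c \<Rightarrow> real" and C n assume k: "k \<in> borel_measurable P" "\<And>x. \<bar>k x\<bar> \<le> C"
  have m: "(\<lambda>q. k (\<tau>1 q)) \<in> borel_measurable Q" using k(1) \<tau>1(1) by simp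
  show "L1_functional P C (\<lambda>h. \<integral>x. k x * h (\<sigma> n x) \<partial>P)"
    by (rule L1_functional_comp[OF P(1) k \<sigma>])
  show "L1_functional P C (\<lambda>h. \<integral>q. k (\<tau>1 q) * h (\<tau>2 q) \<partial>Q)"
    by (rule L1_functional_comp[OF Q m k(2) \<tau>2])
qed

lemma rectangles_generate:
  assumes "space P = UNIV" "space Q = UNIV"
  shows "Int_stable {A \<times> B | A B. A \<in> sets P \<and> B \<in> sets Q}"
    and "sets (P \<Otimes>\<^sub>M Q) = sigma_sets UNIV {A \<times> B | A B. A \<in> sets P \<and> B \<in> sets Q}"
    and "UNIV \<in> {A \<times> B | A B. A \<in> sets P \<and> B \<in> sets Q}"
    and "space (P \<Otimes>\<^sub>M Q) = UNIV"
proof -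
  show "UNIV \<in> {A \<times> B | A B. A \<in> sets P \<and> B \<in> sets Q}"
    using sets.top[of P] sets.top[of Q] assms by (auto intro!: exI[of _ UNIV])
qed (auto simp: Int_stable_pair_measure_generator sets_pair_measure assms space_pair_measure)

section \<open>Countable generators and functions of one coordinate\<close>

text \<open>Finite intersections of a countable base. Stability under intersection serves the
  uniqueness arguments, countability lets null sets be united, and T1 separation recovers a point
  from the indicators of the generator.\<close>

lemma countable_generator:
  obtains E :: "'a::{second_countable_topology, t1_space} set set"
  where "countable E" "Int_stable E" "UNIV \<in> E" "sets (borel :: 'a measure) = sigma_sets UNIV E"
    "\<And>x y. (\<And>U. U \<in> E \<Longrightarrow> x \<in> U \<longleftrightarrow> y \<in> U) \<Longrightarrow> x = y"
proof -
  obtain B :: "'a set set" where B: "countable B" "topological_basis B"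
    using ex_countable_basis by blast
  define E where "E = Inter ` {F. finite F \<and> F \<subseteq> B}"
  have BE: "B \<subseteq> E" unfolding E_def by (auto intro!: image_eqI[of _ _ "{_}"])
  have opB: "open U" if "U \<in> B" for U using B(2) that by (rule topological_basis_open)
  have op: "open U" if "U \<in> E" for U using that opB unfolding E_def by (auto intro!: open_Inter)
  show thesis
  proof
    show "countable E" unfolding E_def using countable_Collect_finite_subset[OF B(1)] by simp
    show "Int_stable E"
    proof (rule Int_stableI)
      fix U V assume "U \<in> E" "V \<in> E"
      then obtain F G where "U = \<Inter>F" "V = \<Inter>G" "finite F" "F \<subseteq> B" "finite G" "G \<subseteq> B"
        unfolding E_def by auto
      then show "U \<inter> V \<in> E" unfolding E_def by (auto intro!: image_eqI[of _ _ "F \<union> G"])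
    qed
    show "UNIV \<in> E" unfolding E_def by (auto intro!: image_eqI[of _ _ "{}"])
    have "sets (borel :: 'a measure) = sigma_sets UNIV B"
      by (simp add: borel_eq_countable_basis[OF B])
    also have "\<dots> = sigma_sets UNIV E"
    proof (rule sigma_sets_eqI)
      show "U \<in> sigma_sets UNIV E" if "U \<in> B" for U using that BE by auto
      show "U \<in> sigma_sets UNIV B" if "U \<in> E" for U
        using op[OF that] \<open>sets borel = sigma_sets UNIV B\<close> by (metis borel_open)
    qed
    finally show "sets (borel :: 'a measure) = sigma_sets UNIV E" .
    fix x y :: 'a assume eq: "\<And>U. U \<in> E \<Longrightarrow> x \<in> U \<longleftrightarrow> y \<in> U"
    show "x = y"
    proof (rule ccontr)
      assume "x \<noteq> y"
      then obtain V where V: "open V" "x \<in> V" "y \<notin> V" using t1_space by blast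
      then obtain U where "U \<in> B" "x \<in> U" "U \<subseteq> V" using B(2) by (meson topological_basisE)
      with eq[of U] BE V show False by blast
    qed
  qed
qed

section \<open>Projections and the coordinate swap on product spaces\<close>

lemma (in prob_space) AE_ex: "AE x in M. P x \<Longrightarrow> \<exists>x. P x"
  by (metis (mono_tags) AE_False eventually_mono)

lemma swap_measure_preserving:
  assumes "prob_space P" "prob_space Q"
  shows "prod.swap \<in> (P \<Otimes>\<^sub>M Q) \<rightarrow>\<^sub>M (Q \<Otimes>\<^sub>M P)" "distr (P \<Otimes>\<^sub>M Q) (Q \<Otimes>\<^sub>M P) prod.swap = Q \<Otimes>\<^sub>M P"
proof -
  interpret P: prob_space P by fact
  interpret Q: prob_space Q by fact
  interpret QP: pair_prob_space Q P ..
  have eq: "prod.swap = (\<lambda>(x, y). (y, x))" by auto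
  show "prod.swap \<in> (P \<Otimes>\<^sub>M Q) \<rightarrow>\<^sub>M (Q \<Otimes>\<^sub>M P)" unfolding eq by measurable
  show "distr (P \<Otimes>\<^sub>M Q) (Q \<Otimes>\<^sub>M P) prod.swap = Q \<Otimes>\<^sub>M P"
    unfolding eq by (rule QP.distr_pair_swap[symmetric])
qed

lemma fst_measure_preserving:
  assumes "prob_space P" "prob_space Q"
  shows "distr (P \<Otimes>\<^sub>M Q) P fst = P"
proof -
  interpret Q: prob_space Q by fact
  show ?thesis by (rule Q.distr_pair_fst)
qed

lemma snd_measure_preserving:
  assumes "prob_space P" "prob_space Q"
  shows "distr (P \<Otimes>\<^sub>M Q) Q snd = Q"
proof -
  have "distr (P \<Otimes>\<^sub>M Q) Q snd = distr (distr (P \<Otimes>\<^sub>M Q) (Q \<Otimes>\<^sub>M P) prod.swap) Q fst"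
    by (subst distr_distr) (auto simp: swap_measure_preserving(1)[OF assms] comp_def)
  then show ?thesis
    by (simp add: swap_measure_preserving(2)[OF assms] fst_measure_preserving[OF assms(2,1)])
qed

text \<open>The candidate is the fibre average of \<open>h\<close>. By \<open>ind\<close> the
  difference between \<open>h\<close> and this average is orthogonal to every rectangle, hence to
  itself.\<close>

lemma bdd_function_of_fst:
  fixes M :: "'a measure"
  assumes M: "prob_space M" "space M = UNIV" and h: "bdd_meas (M \<Otimes>\<^sub>M M) h"
    and ind: "\<And>f k. bdd_meas M f \<Longrightarrow> bdd_meas M k \<Longrightarrow>
      (\<integral>z. f (fst z) * k (snd z) * h z \<partial>(M \<Otimes>\<^sub>M M)) = (\<integral>x. k x \<partial>M) * (\<integral>z. f (fst z) * h z \<partial>(M \<Otimes>\<^sub>M M))"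
  shows "bdd_meas M (\<lambda>x. \<integral>x'. h (x, x') \<partial>M)"
    and "AE z in M \<Otimes>\<^sub>M M. h z = (\<integral>x'. h (fst z, x') \<partial>M)"
proof -
  interpret M: prob_space M by fact
  interpret MM: pair_prob_space M M ..
  let ?MM = "M \<Otimes>\<^sub>M M"
  define w where "w x = (\<integral>x'. h (x, x') \<partial>M)" for x
  obtain K where K: "\<And>z. \<bar>h z\<bar> \<le> K" using h unfolding bdd_meas_def by blast
  show w: "bdd_meas M (\<lambda>x. \<integral>x'. h (x, x') \<partial>M)"
  proof (rule M.bdd_meas_integral)
    show "(\<lambda>(x, x'). h (x, x')) \<in> borel_measurable ?MM"
      using bdd_measD[OF h] by (simp add: case_prod_beta')
  qed (rule K)
  then have wb: "bdd_meas M w" unfolding w_def .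
  let ?d = "\<lambda>z. h z - w (fst z)"
  have wb': "bdd_meas ?MM (\<lambda>z. w (fst z))" using wb by (rule bdd_meas_comp) auto
  have db: "bdd_meas ?MM ?d" by (intro bdd_meas_diff h wb')
  obtain D where D: "\<And>x. \<bar>?d x\<bar> \<le> D" using db unfolding bdd_meas_def by blast
  have rect: "(\<integral>z. ?d z * indicator (A \<times> B) z \<partial>?MM) = 0" if A: "A \<in> sets M" and B: "B \<in> sets M" for A B
  proof -
    have a: "bdd_meas M (indicator A)" and b: "bdd_meas M (indicator B)" using A B by auto
    have a': "bdd_meas ?MM (\<lambda>z. indicator A (fst z) :: real)" and b': "bdd_meas ?MM (\<lambda>z. indicator B (snd z) :: real)"
      using bdd_meas_comp[OF a, of fst ?MM] bdd_meas_comp[OF b, of snd ?MM] by auto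
    have "(\<integral>z. ?d z * indicator (A \<times> B) z \<partial>?MM)
      = (\<integral>z. indicator A (fst z) * indicator B (snd z) * h z - (indicator A (fst z) * w (fst z)) * indicator B (snd z) \<partial>?MM)"
      by (intro Bochner_Integration.integral_cong) (auto simp: indicator_times algebra_simps)
    also have "\<dots> = (\<integral>z. indicator A (fst z) * indicator B (snd z) * h z \<partial>?MM)
        - (\<integral>z. (indicator A (fst z) * w (fst z)) * indicator B (snd z) \<partial>?MM)"
      by (intro Bochner_Integration.integral_diff MM.P.bdd_meas_integrable bdd_meas_mult a' b' h wb')
    also have "(\<integral>z. indicator A (fst z) * indicator B (snd z) * h z \<partial>?MM)
        = (\<integral>x. indicator B x \<partial>M) * (\<integral>z. indicator A (fst z) * h z \<partial>?MM)"
      by (rule ind[OF a b])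
    also have "(\<integral>z. indicator A (fst z) * h z \<partial>?MM) = (\<integral>x. \<integral>x'. indicator A x * h (x, x') \<partial>M \<partial>M)"
      using Fubini_bdd(1)[OF M(1) M(1) bdd_meas_mult[OF a' h]] by simp
    also have "\<dots> = (\<integral>x. indicator A x * w x \<partial>M)" by (simp add: w_def)
    also have "(\<integral>z. (indicator A (fst z) * w (fst z)) * indicator B (snd z) \<partial>?MM)
        = (\<integral>x. indicator A x * w x \<partial>M) * (\<integral>x. indicator B x \<partial>M)"
      by (rule integral_prod_mult[OF M(1) M(1) bdd_meas_mult[OF a wb] b])
    finally show ?thesis by (simp add: algebra_simps)
  qed
  note R = rectangles_generate[OF M(2) M(2)]
  \<comment> \<open>The zero functional agrees with integration against \<open>?d\<close> on
    rectangles; uniqueness is applied with \<open>?d\<close> itself as the test function.\<close>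
  have "(\<integral>z. ?d z * ?d z \<partial>?MM) = 0 * (\<integral>z. ?d z \<partial>?MM)"
  proof (rule L1_functional_unique[OF MM.P.prob_space_axioms R(4,1,2,3), where f="?d"
        and L="\<lambda>f. \<integral>z. ?d z * f z \<partial>?MM" and L'="\<lambda>f. 0 * (\<integral>z. f z \<partial>?MM)"])
    show "L1_functional ?MM D (\<lambda>f. \<integral>z. ?d z * f z \<partial>?MM)"
      by (rule L1_functional_mult[OF MM.P.prob_space_axioms bdd_measD[OF db] D])
    show "L1_functional ?MM 0 (\<lambda>f. 0 * (\<integral>z. f z \<partial>?MM))"
      by (intro L1_functionalI) auto
  qed (use rect db in auto)
  then have "(\<integral>z. ?d z * ?d z \<partial>?MM) = 0" by simp
  from MM.P.AE_eq_0I[OF db this] show "AE z in ?MM. h z = (\<integral>x'. h (fst z, x') \<partial>M)"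
    by (simp add: w_def)
qed

text \<open>A map on a product that is independent, jointly with the first coordinate, of the second
  coordinate is obtained by freezing the second coordinate at a generic point.\<close>

lemma function_of_fst:
  fixes M :: "'a measure" and \<tau> :: "'a \<times> 'a \<Rightarrow> 'c::{second_countable_topology, t1_space}"
  assumes M: "prob_space M" "space M = UNIV"
    and \<tau>: "\<tau> \<in> (M \<Otimes>\<^sub>M M) \<rightarrow>\<^sub>M Z" and Z: "sets Z = sets borel"
    and ind: "\<And>f k g. bdd_meas M f \<Longrightarrow> bdd_meas M k \<Longrightarrow> bdd_meas Z g \<Longrightarrow>
      (\<integral>z. f (fst z) * k (snd z) * g (\<tau> z) \<partial>(M \<Otimes>\<^sub>M M))
        = (\<integral>x. k x \<partial>M) * (\<integral>z. f (fst z) * g (\<tau> z) \<partial>(M \<Otimes>\<^sub>M M))"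
  shows "\<exists>\<phi>\<in>M \<rightarrow>\<^sub>M Z. AE z in M \<Otimes>\<^sub>M M. \<tau> z = \<phi> (fst z)"
proof -
  interpret M: prob_space M by fact
  interpret MM: pair_prob_space M M ..
  let ?MM = "M \<Otimes>\<^sub>M M"
  obtain E :: "'c set set" where E: "countable E" "sets (borel :: 'c measure) = sigma_sets UNIV E"
    "\<And>x y. (\<And>U. U \<in> E \<Longrightarrow> x \<in> U \<longleftrightarrow> y \<in> U) \<Longrightarrow> x = y"
    by (rule countable_generator) blast
  have EZ: "C \<in> sets Z" if "C \<in> E" for C using that E(2) Z by auto
  define h where "h C z = (indicator C (\<tau> z) :: real)" for C z
  define w where "w C x = (\<integral>x'. h C (x, x') \<partial>M)" for C x
  have ae: "AE z in ?MM. h C z = w C (fst z)" if C: "C \<in> E" for C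
    unfolding w_def
  proof (rule bdd_function_of_fst(2)[OF M])
    show "bdd_meas ?MM (h C)"
      unfolding h_def using bdd_meas_comp[OF bdd_meas_indicator[OF EZ[OF C]] \<tau>] .
  qed (unfold h_def, intro ind bdd_meas_indicator EZ C)
  then have all: "AE z in ?MM. \<forall>C\<in>E. h C z = w C (fst z)"
    using E(1) by (simp add: AE_ball_countable)
  then have "AE z in ?MM. \<forall>C\<in>E. h C (prod.swap z) = w C (snd z)"
  proof -
    from AE_distr_eq[OF swap_measure_preserving[OF M(1) M(1)] all] show ?thesis by simp
  qed
  then have "AE x' in M. AE x in M. \<forall>C\<in>E. h C (x, x') = w C x"
    using MM.AE_pair[of "\<lambda>z. \<forall>C\<in>E. h C (prod.swap z) = w C (snd z)"] by simp
  then obtain x' where x': "AE x in M. \<forall>C\<in>E. h C (x, x') = w C x"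
    using M.AE_ex[OF \<open>AE x' in M. _ x'\<close>] by blast
  define \<phi> where "\<phi> x = \<tau> (x, x')" for x
  have \<phi>: "\<phi> \<in> M \<rightarrow>\<^sub>M Z"
    unfolding \<phi>_def using \<tau> by (rule measurable_compose_rev) (simp add: M(2))
  from AE_distr_eq[OF measurable_fst fst_measure_preserving[OF M(1) M(1)] x'] have "AE z in ?MM. \<forall>C\<in>E. h C (fst z, x') = w C (fst z)" by simp
  with all have "AE z in ?MM. \<tau> z = \<phi> (fst z)"
  proof eventually_elim
    case (elim z)
    show ?case
    proof (rule E(3))
      fix U assume "U \<in> E"
      with elim have "h U z = h U (fst z, x')" by simp
      then show "\<tau> z \<in> U \<longleftrightarrow> \<phi> (fst z) \<in> U" unfolding h_def \<phi>_def by (auto simp: indicator_def split: if_splits)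
    qed
  qed
  with \<phi> show ?thesis by blast
qed

section \<open>Measure-preserving flows\<close>

lemma mp_flowD:
  assumes "mp_flow Q U"
  shows "prob_space Q" "(\<lambda>(t, x). U t x) \<in> (borel \<Otimes>\<^sub>M Q) \<rightarrow>\<^sub>M Q" "U t \<in> Q \<rightarrow>\<^sub>M Q" "distr Q Q (U t) = Q"
    "x \<in> space Q \<Longrightarrow> U 0 x = x" "x \<in> space Q \<Longrightarrow> U (s + t) x = U s (U t x)"
  using assms unfolding mp_flow_def by blast+

lemma mp_flow_measurable:
  assumes "mp_flow Q U" "f \<in> R \<rightarrow>\<^sub>M borel" "g \<in> R \<rightarrow>\<^sub>M Q"
  shows "(\<lambda>x. U (f x) (g x)) \<in> R \<rightarrow>\<^sub>M Q"
proof -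
  have "(\<lambda>x. (f x, g x)) \<in> R \<rightarrow>\<^sub>M borel \<Otimes>\<^sub>M Q" using assms(2,3) by simp
  from measurable_compose[OF this mp_flowD(2)[OF assms(1)]] show ?thesis by simp
qed

text \<open>By almost everywhere approximation with continuous functions.\<close>

lemma translation_continuous:
  fixes g :: "real \<Rightarrow> real"
  assumes g[measurable]: "g \<in> borel_measurable borel" and C: "\<And>x. \<bar>g x\<bar> \<le> C"
    and h: "h \<longlonglongrightarrow> 0" "\<And>n. \<bar>h n\<bar> \<le> 1"
  shows "(\<lambda>n. \<integral>s. indicator {0..1} s * \<bar>g (s + h n) - g s\<bar> \<partial>lborel) \<longlonglongrightarrow> 0"
proof -
  have C0: "0 \<le> C" using C[of 0] by linarith
  have "g \<in> borel_measurable lebesgue" using g by (simp add: measurable_completion)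
  then have "g measurable_on UNIV" by (rule lebesgue_measurable_imp_measurable_on) simp
  then obtain Z k where Z: "negligible Z" and k: "\<And>n. continuous_on UNIV (k n)"
    "\<And>x. x \<notin> Z \<Longrightarrow> (\<lambda>n. k n x) \<longlonglongrightarrow> g x"
    unfolding measurable_on_def by auto
  \<comment> \<open>Clipping the continuous approximants to the bound of \<open>g\<close> leaves
    their limit unchanged and makes dominated convergence available.\<close>
  define c where "c m x = max (- C) (min C (k m x))" for m x
  have cc: "continuous_on UNIV (c m)" for m unfolding c_def by (intro continuous_intros k)
  have [measurable]: "c m \<in> borel_measurable borel" for m
    using cc by (rule borel_measurable_continuous_onI)
  have cC: "\<bar>c m x\<bar> \<le> C" for m x unfolding c_def using C0 by auto
  have lim: "(\<lambda>m. c m x) \<longlonglongrightarrow> g x" if "x \<notin> Z" for x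
  proof -
    have "(\<lambda>m. c m x) \<longlonglongrightarrow> max (- C) (min C (g x))"
      unfolding c_def by (intro tendsto_intros k that)
    moreover have "max (- C) (min C (g x)) = g x" using C[of x] by auto
    ultimately show ?thesis by simp
  qed
  have aeZ: "AE x in lborel. x \<notin> Z"
    using AE_not_in[of Z lebesgue] Z by (simp add: negligible_iff_null_sets AE_completion_iff)
  have bnd: "\<bar>u - v\<bar> \<le> 2 * C" if "\<bar>u\<bar> \<le> C" "\<bar>v\<bar> \<le> C" for u v :: real using that by linarith
  have int: "integrable lborel (\<lambda>s. indicator {l..r} s * F s)"
    if "F \<in> borel_measurable borel" "\<And>s. \<bar>F s\<bar> \<le> D" for F :: "real \<Rightarrow> real" and D l r
  proof (rule Bochner_Integration.integrable_bound)
    show "integrable lborel (\<lambda>s. indicator {l..r} s * D)"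
      by (intro integrable_mult_left integrable_real_indicator) (auto simp: emeasure_lborel_Icc_eq)
    show "AE s in lborel. norm (indicator {l..r} s * F s) \<le> norm (indicator {l..r} s * D)"
      using that(2) by (intro AE_I2) (auto simp: indicator_def intro: order_trans[OF that(2)])
  qed (use that(1) in auto)
  \<comment> \<open>The window contains every \<open>s + h n\<close> with \<open>s\<close> in the
    unit interval and \<open>\<bar>h n\<bar> \<le> 1\<close>, so the single error \<open>a m\<close>
    controls the approximation at \<open>s\<close> and at \<open>s + h n\<close>.\<close>
  define a where "a m = (\<integral>s. indicator {-1..2} s * \<bar>g s - c m s\<bar> \<partial>lborel)" for m
  have a: "a \<longlonglongrightarrow> 0"
  proof -
    have "(\<lambda>m. \<integral>s. indicator {-1..2} s * \<bar>g s - c m s\<bar> \<partial>lborel) \<longlonglongrightarrow> (\<integral>s. 0 \<partial>(lborel :: real measure))"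
    proof (rule integral_dominated_convergence[where w="\<lambda>s. indicator {-1..2} s * (2 * C)"])
      show "AE s in lborel. (\<lambda>m. indicator {-1..2} s * \<bar>g s - c m s\<bar>) \<longlonglongrightarrow> 0"
        using aeZ by eventually_elim (auto intro!: tendsto_eq_intros lim)
      show "AE s in lborel. norm (indicator {-1..2} s * \<bar>g s - c m s\<bar>) \<le> indicator {-1..2} s * (2 * C)" for m
        by (intro AE_I2) (auto simp: indicator_def bnd[OF C cC])
    qed auto
    then show ?thesis unfolding a_def by simp
  qed
  have mid: "(\<lambda>n. \<integral>s. indicator {0..1} s * \<bar>c m (s + h n) - c m s\<bar> \<partial>lborel) \<longlonglongrightarrow> 0" for m
  proof -
    have "(\<lambda>n. \<integral>s. indicator {0..1} s * \<bar>c m (s + h n) - c m s\<bar> \<partial>lborel) \<longlonglongrightarrow> (\<integral>s. 0 \<partial>(lborel :: real measure))"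
    proof (rule integral_dominated_convergence[where w="\<lambda>s. indicator {0..1} s * (2 * C)"])
      show "AE s in lborel. (\<lambda>n. indicator {0..1} s * \<bar>c m (s + h n) - c m s\<bar>) \<longlonglongrightarrow> 0"
      proof (rule AE_I2)
        fix s
        have "isCont (c m) s" using cc by (simp add: continuous_on_eq_continuous_at)
        moreover have "(\<lambda>n. s + h n) \<longlonglongrightarrow> s" using tendsto_add[OF tendsto_const h(1), of s] by simp
        ultimately have "(\<lambda>n. c m (s + h n)) \<longlonglongrightarrow> c m s" by (rule isCont_tendsto_compose)
        then show "(\<lambda>n. indicator {0..1} s * \<bar>c m (s + h n) - c m s\<bar>) \<longlonglongrightarrow> 0"
          by (auto intro!: tendsto_eq_intros)
      qed
      show "AE s in lborel. norm (indicator {0..1} s * \<bar>c m (s + h n) - c m s\<bar>) \<le> indicator {0..1} s * (2 * C)" for n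
        by (intro AE_I2) (auto simp: indicator_def bnd[OF cC cC])
    qed auto
    then show ?thesis by simp
  qed
  show ?thesis
  proof (rule dense_limit)
    fix e :: real assume "e > 0"
    then obtain m where "norm (a m - 0) < e / 2" using LIMSEQ_D[OF a, of "e/2"] by fastforce
    then have m: "2 * a m \<le> e" by simp
    have "\<bar>(\<integral>s. indicator {0..1} s * \<bar>g (s + h n) - g s\<bar> \<partial>lborel)
        - (\<integral>s. indicator {0..1} s * \<bar>c m (s + h n) - c m s\<bar> \<partial>lborel)\<bar> \<le> e" for n
    proof -
      have i1: "integrable lborel (\<lambda>s. indicator {0..1} s * \<bar>g (s + h n) - g s\<bar>)"
        by (rule int[of _ "2 * C"]) (auto intro: bnd[OF C C])
      have i2: "integrable lborel (\<lambda>s. indicator {0..1} s * \<bar>c m (s + h n) - c m s\<bar>)"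
        by (rule int[of _ "2 * C"]) (auto intro: bnd[OF cC cC])
      have i3: "integrable lborel (\<lambda>s. indicator {-1..2} s * \<bar>g s - c m s\<bar>)"
        by (rule int[of _ "2 * C"]) (auto intro: bnd[OF C cC])
      have i4: "integrable lborel (\<lambda>s. indicator {-1..2} (h n + 1 * s) * \<bar>g (h n + 1 * s) - c m (h n + 1 * s)\<bar>)"
        by (rule lborel_integrable_real_affine[OF i3, of 1 "h n"]) simp
      have a': "a m = (\<integral>s. indicator {-1..2} (h n + 1 * s) * \<bar>g (h n + 1 * s) - c m (h n + 1 * s)\<bar> \<partial>lborel)"
        unfolding a_def by (subst lborel_integral_real_affine[of 1 _ "h n"]) auto
      have "\<bar>(\<integral>s. indicator {0..1} s * \<bar>g (s + h n) - g s\<bar> \<partial>lborel)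
        - (\<integral>s. indicator {0..1} s * \<bar>c m (s + h n) - c m s\<bar> \<partial>lborel)\<bar>
        = \<bar>\<integral>s. indicator {0..1} s * \<bar>g (s + h n) - g s\<bar> - indicator {0..1} s * \<bar>c m (s + h n) - c m s\<bar> \<partial>lborel\<bar>"
        by (simp only: Bochner_Integration.integral_diff[OF i1 i2])
      also have "\<dots> \<le> (\<integral>s. \<bar>indicator {0..1} s * \<bar>g (s + h n) - g s\<bar> - indicator {0..1} s * \<bar>c m (s + h n) - c m s\<bar>\<bar> \<partial>lborel)"
        by (rule integral_abs_bound)
      also have "\<dots> \<le> (\<integral>s. indicator {-1..2} (h n + 1 * s) * \<bar>g (h n + 1 * s) - c m (h n + 1 * s)\<bar>
          + indicator {-1..2} s * \<bar>g s - c m s\<bar> \<partial>lborel)"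
      proof (rule integral_mono)
        show "integrable lborel (\<lambda>s. indicator {-1..2} (h n + 1 * s) * \<bar>g (h n + 1 * s) - c m (h n + 1 * s)\<bar>
          + indicator {-1..2} s * \<bar>g s - c m s\<bar>)" using i4 i3 by (rule Bochner_Integration.integrable_add)
        show "integrable lborel (\<lambda>s. \<bar>indicator {0..1} s * \<bar>g (s + h n) - g s\<bar> - indicator {0..1} s * \<bar>c m (s + h n) - c m s\<bar>\<bar>)"
          using i1 i2 by (intro integrable_abs Bochner_Integration.integrable_diff)
        fix s
        show "\<bar>indicator {0..1} s * \<bar>g (s + h n) - g s\<bar> - indicator {0..1} s * \<bar>c m (s + h n) - c m s\<bar>\<bar>
          \<le> indicator {-1..2} (h n + 1 * s) * \<bar>g (h n + 1 * s) - c m (h n + 1 * s)\<bar> + indicator {-1..2} s * \<bar>g s - c m s\<bar>"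
        proof (cases "s \<in> {0..1}")
          case True
          then have "s \<in> {-1..2}" "h n + s \<in> {-1..2}" using h(2)[of n] by auto
          then show ?thesis using True by (simp add: add.commute)
        qed auto
      qed
      also have "\<dots> = a m + a m" using Bochner_Integration.integral_add[OF i4 i3] a' a_def by simp
      finally show ?thesis using m by linarith
    qed
    then show "\<exists>z l. z \<longlonglongrightarrow> l \<and> (\<forall>n. \<bar>(\<integral>s. indicator {0..1} s * \<bar>g (s + h n) - g s\<bar> \<partial>lborel) - z n\<bar> \<le> e) \<and> \<bar>0 - l\<bar> \<le> e"
      using mid[of m] \<open>e > 0\<close> by (intro exI conjI) auto
  qed
qed

text \<open>By invariance \<open>x\<close> may be replaced by \<open>U s x\<close>. Averaged over
  \<open>s\<close> in the unit interval, the integral measures translation by \<open>h n\<close>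
  along each orbit, and there joint measurability alone gives continuity in
  \<open>L1\<close>.\<close>

lemma mp_flow_continuous:
  assumes U: "mp_flow Q U" and f: "bdd_meas Q f" and h: "h \<longlonglongrightarrow> (0::real)"
  shows "(\<lambda>n. \<integral>x. \<bar>f (U (h n) x) - f x\<bar> \<partial>Q) \<longlonglongrightarrow> 0"
proof -
  interpret Q: prob_space Q using mp_flowD(1)[OF U] .
  have [measurable]: "f \<in> borel_measurable Q" using f by (rule bdd_measD)
  note m[measurable] = mp_flow_measurable[OF U]
  obtain C where C: "0 < C" "\<And>x. \<bar>f x\<bar> \<le> C" using bdd_meas_bound[OF f] by blast
  have bnd: "\<bar>u - v\<bar> \<le> 2 * C" if "\<bar>u\<bar> \<le> C" "\<bar>v\<bar> \<le> C" for u v :: real using that by linarith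
  \<comment> \<open>Uniform law on the unit interval, as a probability measure, so that
    \<open>Fubini_bdd\<close> applies to the average over \<open>s\<close>.\<close>
  define J where "J = density lborel (\<lambda>x::real. ennreal (indicator {0..1} x))"
  interpret J: prob_space J
    by (rule prob_spaceI) (simp add: J_def emeasure_density ennreal_indicator)
  have sJ[measurable_cong]: "sets J = sets borel" by (simp add: J_def)
  have Jint: "(\<integral>s. F s \<partial>J) = (\<integral>s. indicator {0..1} s * F s \<partial>lborel)"
    if "F \<in> borel_measurable borel" for F :: "real \<Rightarrow> real"
    unfolding J_def using that by (subst integral_density) auto
  have eq: "(\<integral>x. \<bar>f (U k x) - f x\<bar> \<partial>Q) = (\<integral>x. (\<integral>s. indicator {0..1} s * \<bar>f (U (s + k) x) - f (U s x)\<bar> \<partial>lborel) \<partial>Q)" for k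
  proof -
    let ?d = "\<lambda>s x. \<bar>f (U (s + k) x) - f (U s x)\<bar>"
    have b: "bdd_meas (J \<Otimes>\<^sub>M Q) (\<lambda>z. ?d (fst z) (snd z))"
      by (rule bdd_measI[of _ _ "2 * C"]) (use bnd[OF C(2) C(2)] in auto)
    have "(\<integral>x. ?d s x \<partial>Q) = (\<integral>x. \<bar>f (U k x) - f x\<bar> \<partial>Q)" for s
    proof -
      have "(\<integral>x. ?d s x \<partial>Q) = (\<integral>x. (\<lambda>y. \<bar>f (U k y) - f y\<bar>) (U s x) \<partial>Q)"
        by (intro Bochner_Integration.integral_cong) (auto simp: mp_flowD(6)[OF U, symmetric] add.commute)
      also have "\<dots> = (\<integral>x. \<bar>f (U k x) - f x\<bar> \<partial>Q)"
        by (rule Q.integral_distr_eq[OF mp_flowD(3,4)[OF U]]) measurable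
      finally show ?thesis .
    qed
    then have "(\<integral>x. \<bar>f (U k x) - f x\<bar> \<partial>Q) = (\<integral>s. (\<integral>x. ?d s x \<partial>Q) \<partial>J)"
      by (simp add: J.prob_space)
    also have "\<dots> = (\<integral>x. (\<integral>s. ?d s x \<partial>J) \<partial>Q)"
      using Fubini_bdd[OF J.prob_space_axioms Q.prob_space_axioms b] by simp
    also have "\<dots> = (\<integral>x. (\<integral>s. indicator {0..1} s * ?d s x \<partial>lborel) \<partial>Q)"
      by (intro Bochner_Integration.integral_cong refl Jint) measurable
    finally show ?thesis .
  qed
  obtain n0 where n0: "\<And>n. n \<ge> n0 \<Longrightarrow> norm (h n - 0) < 1" using LIMSEQ_D[OF h, of 1] by auto
  \<comment> \<open>\<open>translation_continuous\<close> asks for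
    \<open>\<bar>h n\<bar> \<le> 1\<close> from the first index on; dropping an initial segment does
    not affect the limit.\<close>
  let ?h = "\<lambda>n. h (n + n0)"
  have h': "?h \<longlonglongrightarrow> 0" "\<bar>?h n\<bar> \<le> 1" for n
    using h n0[of "n + n0"] by (auto intro: LIMSEQ_ignore_initial_segment)
  have "(\<lambda>n. \<integral>x. (\<integral>s. indicator {0..1} s * \<bar>f (U (s + ?h n) x) - f (U s x)\<bar> \<partial>lborel) \<partial>Q) \<longlonglongrightarrow> (\<integral>x. (0::real) \<partial>Q)"
  proof (rule Q.bounded_convergence[where C="2 * C"])
    show "(\<lambda>x. \<integral>s. indicator {0..1} s * \<bar>f (U (s + ?h n) x) - f (U s x)\<bar> \<partial>lborel) \<in> borel_measurable Q" for n
      by measurable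
    show "AE x in Q. (\<lambda>n. \<integral>s. indicator {0..1} s * \<bar>f (U (s + ?h n) x) - f (U s x)\<bar> \<partial>lborel) \<longlonglongrightarrow> 0"
    proof (rule AE_I2)
      fix x assume x: "x \<in> space Q"
      then have "(\<lambda>s. f (U s x)) \<in> borel_measurable borel" by measurable
      from translation_continuous[OF this C(2) h']
      show "(\<lambda>n. \<integral>s. indicator {0..1} s * \<bar>f (U (s + ?h n) x) - f (U s x)\<bar> \<partial>lborel) \<longlonglongrightarrow> 0" .
    qed
    show "\<bar>\<integral>s. indicator {0..1} s * \<bar>f (U (s + ?h n) x) - f (U s x)\<bar> \<partial>lborel\<bar> \<le> 2 * C" for n x
    proof (cases "integrable lborel (\<lambda>s. indicator {0..1} s * \<bar>f (U (s + ?h n) x) - f (U s x)\<bar>)")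
      case True
      have i: "integrable lborel (\<lambda>s. indicator {0..1::real} s * (2 * C))"
        by (intro integrable_mult_left integrable_real_indicator) auto
      have "\<bar>\<integral>s. indicator {0..1} s * \<bar>f (U (s + ?h n) x) - f (U s x)\<bar> \<partial>lborel\<bar>
          = (\<integral>s. indicator {0..1} s * \<bar>f (U (s + ?h n) x) - f (U s x)\<bar> \<partial>lborel)"
        by (intro abs_of_nonneg integral_nonneg_AE) auto
      also have "\<dots> \<le> (\<integral>s. indicator {0..1::real} s * (2 * C) \<partial>lborel)"
      proof (rule integral_mono)
        show "integrable lborel (\<lambda>s. indicator {0..1} s * \<bar>f (U (s + ?h n) x) - f (U s x)\<bar>)" by fact
        show "integrable lborel (\<lambda>s. indicator {0..1::real} s * (2 * C))" by fact
      qed (intro mult_left_mono bnd C(2), simp)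
      finally show ?thesis by simp
    qed (use C(1) in \<open>simp add: not_integrable_integral_eq\<close>)
  qed auto
  then have "(\<lambda>n. \<integral>x. \<bar>f (U (?h n) x) - f x\<bar> \<partial>Q) \<longlonglongrightarrow> 0" unfolding eq by simp
  then show ?thesis by (rule LIMSEQ_offset)
qed

lemma mp_flow_correlation_continuous:
  assumes U: "mp_flow Q U" and f: "bdd_meas Q f" and k: "bdd_meas Q k" and c: "c \<longlonglongrightarrow> (c0::real)"
  shows "(\<lambda>n. \<integral>x. k x * f (U (c n) x) \<partial>Q) \<longlonglongrightarrow> (\<integral>x. k x * f (U c0 x) \<partial>Q)"
proof -
  interpret Q: prob_space Q using mp_flowD(1)[OF U] .
  obtain C where C: "0 < C" "\<And>x. \<bar>k x\<bar> \<le> C" using bdd_meas_bound[OF k] by blast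
  have fU: "bdd_meas Q (\<lambda>x. f (U s x))" for s by (rule bdd_meas_comp[OF f mp_flowD(3)[OF U]])
  have "(\<lambda>n. c n - c0) \<longlonglongrightarrow> 0" using c by (simp add: LIM_zero)
  from mp_flow_continuous[OF U fU[of c0] this]
  have "(\<lambda>n. \<integral>x. \<bar>f (U c0 (U (c n - c0) x)) - f (U c0 x)\<bar> \<partial>Q) \<longlonglongrightarrow> 0" .
  moreover have "(\<integral>x. \<bar>f (U c0 (U (c n - c0) x)) - f (U c0 x)\<bar> \<partial>Q) = (\<integral>x. \<bar>f (U (c n) x) - f (U c0 x)\<bar> \<partial>Q)" for n
    by (intro Bochner_Integration.integral_cong) (auto simp flip: mp_flowD(6)[OF U])
  ultimately have "(\<lambda>n. C * (\<integral>x. \<bar>f (U (c n) x) - f (U c0 x)\<bar> \<partial>Q)) \<longlonglongrightarrow> C * 0"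
    by (intro tendsto_mult_left) simp
  then have lim: "(\<lambda>n. C * (\<integral>x. \<bar>f (U (c n) x) - f (U c0 x)\<bar> \<partial>Q)) \<longlonglongrightarrow> 0" by simp
  have le: "\<bar>(\<integral>x. k x * f (U (c n) x) \<partial>Q) - (\<integral>x. k x * f (U c0 x) \<partial>Q)\<bar>
      \<le> C * (\<integral>x. \<bar>f (U (c n) x) - f (U c0 x)\<bar> \<partial>Q)" for n
  proof -
    have "(\<integral>x. k x * f (U (c n) x) \<partial>Q) - (\<integral>x. k x * f (U c0 x) \<partial>Q)
        = (\<integral>x. k x * (f (U (c n) x) - f (U c0 x)) \<partial>Q)"
      unfolding right_diff_distrib
      by (intro Bochner_Integration.integral_diff[symmetric] Q.bdd_meas_integrable bdd_meas_mult k fU)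
    then show ?thesis
      using L1_functional_bound[OF L1_functional_mult[OF Q.prob_space_axioms bdd_measD[OF k] C(2)]
          bdd_meas_diff[OF fU fU], of "c n" c0] by simp
  qed
  have "(\<lambda>n. (\<integral>x. k x * f (U (c n) x) \<partial>Q) - (\<integral>x. k x * f (U c0 x) \<partial>Q)) \<longlonglongrightarrow> 0"
    by (rule Lim_null_comparison[OF _ lim]) (unfold real_norm_def, intro always_eventually allI le)
  then show ?thesis by (rule LIM_zero_cancel)
qed

section \<open>Mixing sequences and weak limits of tensor products\<close>

text \<open>Weak mixing gives only vanishing Cesaro averages. As the pairs from a countable
  generator can be enumerated, one time can make the first \<open>n\<close> deviations small
  together; the times so chosen mix all generator pairs, hence all bounded functions.\<close>

lemma weakly_mixing_sequence:
  fixes N :: "'b::polish_space measure"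
  assumes wm: "weakly_mixing_flow N T" and sN: "sets N = sets borel"
  shows "\<exists>r. \<forall>f g. bdd_meas N f \<longrightarrow> bdd_meas N g \<longrightarrow>
    (\<lambda>n::nat. \<integral>y. f y * g (T (r n) y) \<partial>N) \<longlonglongrightarrow> (\<integral>y. f y \<partial>N) * (\<integral>y. g y \<partial>N)"
proof -
  have T: "mp_flow N T" using wm unfolding weakly_mixing_flow_def by blast
  interpret N: prob_space N using mp_flowD(1)[OF T] .
  have spN: "space N = UNIV" using sets_eq_imp_space_eq[OF sN] by simp
  note m[measurable] = mp_flow_measurable[OF T]
  obtain E :: "'b set set" where E: "countable E" "Int_stable E" "UNIV \<in> E"
    "sets (borel :: 'b measure) = sigma_sets UNIV E"
    by (rule countable_generator) blast
  have EN[measurable]: "A \<in> sets N" if "A \<in> E" for A using that E(4) sN by auto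
  define e where "e = from_nat_into (E \<times> E)"
  have re: "range e = E \<times> E" unfolding e_def using E by (intro range_from_nat_into) auto
  define c where "c j t = \<bar>(\<integral>y. indicator (snd (e j)) y * indicator (fst (e j)) (T t y) \<partial>N)
    - N.prob (fst (e j)) * N.prob (snd (e j))\<bar>" for j t
  have eN[measurable]: "fst (e j) \<in> sets N" "snd (e j) \<in> sets N" for j
    using rangeI[of e j] EN unfolding re mem_Times_iff by auto
  have cm[measurable]: "c j \<in> borel_measurable borel" for j unfolding c_def by measurable
  have i01: "\<bar>\<integral>y. indicator A y * indicator B (T t y) \<partial>N\<bar> \<le> (1::real)" for A B t
    by (rule N.abs_integral_le_const) (auto simp: indicator_def)
  have cb: "\<bar>c j t\<bar> \<le> 2" for j t
  proof -
    have "N.prob (fst (e j)) * N.prob (snd (e j)) \<le> 1 * 1" by (intro mult_mono) auto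
    moreover have "0 \<le> N.prob (fst (e j)) * N.prob (snd (e j))" by simp
    ultimately show ?thesis using i01[of "snd (e j)" "fst (e j)" t] unfolding c_def by linarith
  qed
  have c0: "0 \<le> c j t" for j t unfolding c_def by simp
  have c_alt: "\<bar>measure N (T t -` fst (e j) \<inter> space N \<inter> snd (e j)) - N.prob (fst (e j)) * N.prob (snd (e j))\<bar> = c j t" for j t
  proof -
    have "T t -` fst (e j) \<inter> space N \<inter> snd (e j) \<in> sets N"
      using measurable_sets[OF mp_flowD(3)[OF T] eN(1)] eN(2) by (rule sets.Int)
    then have "measure N (T t -` fst (e j) \<inter> space N \<inter> snd (e j))
        = (\<integral>y. indicator (T t -` fst (e j) \<inter> space N \<inter> snd (e j)) y \<partial>N)"
      by (simp add: N.integral_indicator_prob)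
    also have "\<dots> = (\<integral>y. indicator (snd (e j)) y * indicator (fst (e j)) (T t y) \<partial>N)"
      by (intro Bochner_Integration.integral_cong) (auto simp: indicator_def)
    finally show ?thesis unfolding c_def by simp
  qed
  have lim: "((\<lambda>R. (1 / R) * (LBINT t:{0..R}. c j t)) \<longlongrightarrow> 0) at_top" for j
    using wm eN[of j] unfolding weakly_mixing_flow_def c_alt[symmetric] by blast
  have int: "set_integrable lborel {0..R} (c j)" for j R
    unfolding set_integrable_def
  proof (rule Bochner_Integration.integrable_bound)
    show "integrable lborel (\<lambda>t. indicator {0..R} t * (2::real))"
      by (intro integrable_mult_left integrable_real_indicator) (auto simp: emeasure_lborel_Icc_eq)
    show "AE t in lborel. norm (indicator {0..R} t *\<^sub>R c j t) \<le> norm (indicator {0..R} t * (2::real))"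
      using cb[of j] by (intro AE_I2) (auto simp: indicator_def)
  qed measurable
  \<comment> \<open>If the first \<open>n\<close> deviations always summed to at least
    \<open>1 / real (Suc n)\<close>, so would the averages of this sum, which tend to 0.\<close>
  have ex: "\<exists>t. (\<Sum>j<n. c j t) < 1 / real (Suc n)" for n
  proof (rule ccontr)
    assume "\<not> ?thesis"
    then have ge: "1 / real (Suc n) \<le> (\<Sum>j<n. c j t)" for t by (simp add: not_less)
    have "((\<lambda>R. \<Sum>j<n. (1 / R) * (LBINT t:{0..R}. c j t)) \<longlongrightarrow> (\<Sum>j<n. 0)) at_top"
      by (intro tendsto_sum lim)
    then have "\<forall>\<^sub>F R in at_top. (\<Sum>j<n. (1 / R) * (LBINT t:{0..R}. c j t)) < 1 / real (Suc n)"
      by (intro order_tendstoD(2)) auto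
    then have "\<forall>\<^sub>F R in at_top. R > 0 \<and> (\<Sum>j<n. (1 / R) * (LBINT t:{0..R}. c j t)) < 1 / real (Suc n)"
      using eventually_gt_at_top[of 0] by eventually_elim simp
    then obtain R where R: "R > 0" "(\<Sum>j<n. (1 / R) * (LBINT t:{0..R}. c j t)) < 1 / real (Suc n)"
      using eventually_happens[of _ "at_top :: real filter"] by (auto simp: trivial_limit_at_top_linorder)
    have "(LBINT t:{0..R}. 1 / real (Suc n)) \<le> (LBINT t:{0..R}. \<Sum>j<n. c j t)"
    proof (rule set_integral_mono)
      show "set_integrable lborel {0..R} (\<lambda>t. 1 / real (Suc n))"
        unfolding set_integrable_def
        by (intro integrable_scaleR_left integrable_real_indicator) (auto simp: emeasure_lborel_Icc_eq)
      show "set_integrable lborel {0..R} (\<lambda>t. \<Sum>j<n. c j t)"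
        using int unfolding set_integrable_def scaleR_sum_right by (intro Bochner_Integration.integrable_sum) auto
    qed (rule ge)
    moreover have "(LBINT t:{0..R}. 1 / real (Suc n)) = R / real (Suc n)"
      using R(1) unfolding set_lebesgue_integral_def by simp
    moreover have "(LBINT t:{0..R}. \<Sum>j<n. c j t) = (\<Sum>j<n. (LBINT t:{0..R}. c j t))"
      using int unfolding set_lebesgue_integral_def set_integrable_def scaleR_sum_right
      by (intro Bochner_Integration.integral_sum) auto
    ultimately have "R / real (Suc n) \<le> (\<Sum>j<n. (LBINT t:{0..R}. c j t))" by simp
    then have "(1 / R) * (R / real (Suc n)) \<le> (1 / R) * (\<Sum>j<n. (LBINT t:{0..R}. c j t))"
      using R(1) by (intro mult_left_mono) auto
    with R show False by (simp add: sum_distrib_left)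
  qed
  then obtain r where r: "\<And>n. (\<Sum>j<n. c j (r n)) < 1 / real (Suc n)" by metis
  have cr: "(\<lambda>n. c j (r n)) \<longlonglongrightarrow> 0" for j
  proof (rule tendsto_sandwich[OF _ _ tendsto_const LIMSEQ_inverse_real_of_nat])
    show "\<forall>\<^sub>F n in sequentially. c j (r n) \<le> inverse (real (Suc n))"
      using eventually_gt_at_top[of j]
    proof eventually_elim
      case (elim n)
      then have "c j (r n) \<le> (\<Sum>j<n. c j (r n))" using c0 by (intro member_le_sum) auto
      with r[of n] show ?case by (simp add: inverse_eq_divide)
    qed
  qed (simp add: c0)
  have NN: "prob_space (N \<Otimes>\<^sub>M N)" by (intro prob_space_pair N.prob_space_axioms)
  have split: "(\<integral>q. k (fst q) * h (snd q) \<partial>(N \<Otimes>\<^sub>M N)) = (\<integral>y. k y \<partial>N) * (\<integral>y. h y \<partial>N)"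
    if "bdd_meas N k" "bdd_meas N h" for k h
    by (rule integral_prod_mult[OF N.prob_space_axioms N.prob_space_axioms that])
  have "(\<lambda>n. \<integral>y. f y * g (T (r n) y) \<partial>N) \<longlonglongrightarrow> (\<integral>q. f (fst q) * g (snd q) \<partial>(N \<Otimes>\<^sub>M N))"
    if f: "bdd_meas N f" and g: "bdd_meas N g" for f g
  proof (rule coupling_limit[OF N.prob_space_axioms spN E(2) _ E(3) NN, of "\<lambda>n. T (r n)"])
    show "sets N = sigma_sets UNIV E" using sN E(4) by simp
    show "distr (N \<Otimes>\<^sub>M N) N fst = N" "distr (N \<Otimes>\<^sub>M N) N snd = N"
      by (rule fst_measure_preserving snd_measure_preserving; fact N.prob_space_axioms)+
    fix U V assume "U \<in> E" "V \<in> E"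
    then have "(V, U) \<in> range e" unfolding re by simp
    then obtain j where j: "e j = (V, U)" by (metis imageE)
    have "(\<lambda>n. (\<integral>y. indicator U y * indicator V (T (r n) y) \<partial>N) - N.prob V * N.prob U) \<longlonglongrightarrow> 0"
      using cr[of j] j unfolding c_def by (simp add: tendsto_rabs_zero_iff)
    then show "(\<lambda>n. \<integral>y. indicator U y * indicator V (T (r n) y) \<partial>N)
        \<longlonglongrightarrow> (\<integral>q. indicator U (fst q) * (indicator V (snd q) :: real) \<partial>(N \<Otimes>\<^sub>M N))"
      using split[of "indicator U" "indicator V"] \<open>U \<in> E\<close> \<open>V \<in> E\<close>
      by (auto simp: N.integral_indicator_prob EN bdd_meas_indicator LIM_zero_iff mult.commute)
  qed (use f g mp_flowD[OF T] in auto)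
  then show ?thesis using split by (intro exI[of _ r] allI impI) simp
qed

text \<open>Two separate times are allowed: the diagonal \<open>tens T s s\<close> is the product
  flow, but the weak limit and the mixing of one coordinate alone leave the diagonal.\<close>

definition tens :: "(real \<Rightarrow> 'b \<Rightarrow> 'b) \<Rightarrow> real \<Rightarrow> real \<Rightarrow> 'b \<times> 'b \<Rightarrow> 'b \<times> 'b" where
  "tens T a b z = (T a (fst z), T b (snd z))"

lemma map_prod_measure_preserving:
  assumes P: "prob_space P'" "prob_space Q'"
    and \<sigma>: "\<sigma> \<in> P \<rightarrow>\<^sub>M P'" "distr P P' \<sigma> = P'" and \<tau>: "\<tau> \<in> Q \<rightarrow>\<^sub>M Q'" "distr Q Q' \<tau> = Q'"
  shows "(\<lambda>z. (\<sigma> (fst z), \<tau> (snd z))) \<in> (P \<Otimes>\<^sub>M Q) \<rightarrow>\<^sub>M (P' \<Otimes>\<^sub>M Q')"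
    and "distr (P \<Otimes>\<^sub>M Q) (P' \<Otimes>\<^sub>M Q') (\<lambda>z. (\<sigma> (fst z), \<tau> (snd z))) = P' \<Otimes>\<^sub>M Q'"
proof -
  interpret Q': prob_space Q' by fact
  show "(\<lambda>z. (\<sigma> (fst z), \<tau> (snd z))) \<in> (P \<Otimes>\<^sub>M Q) \<rightarrow>\<^sub>M (P' \<Otimes>\<^sub>M Q')"
    using \<sigma>(1) \<tau>(1) by simp
  have "sigma_finite_measure (distr Q Q' \<tau>)" unfolding \<tau>(2) by (rule Q'.sigma_finite_measure_axioms)
  from pair_measure_distr[OF \<sigma>(1) \<tau>(1) this]
  show "distr (P \<Otimes>\<^sub>M Q) (P' \<Otimes>\<^sub>M Q') (\<lambda>z. (\<sigma> (fst z), \<tau> (snd z))) = P' \<Otimes>\<^sub>M Q'"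
    by (simp add: \<sigma>(2) \<tau>(2) case_prod_beta')
qed

text \<open>Each fibre map \<open>w p\<close> preserves \<open>Q\<close>, so choosing
  \<open>p\<close> at random does too. This provides the second marginal of the coupling with random
  times.\<close>

lemma random_measure_preserving:
  assumes R: "prob_space R" and Q: "prob_space Q"
    and m: "(\<lambda>q. w (fst q) (snd q)) \<in> (R \<Otimes>\<^sub>M Q) \<rightarrow>\<^sub>M Q"
    and w: "\<And>p. w p \<in> Q \<rightarrow>\<^sub>M Q" "\<And>p. distr Q Q (w p) = Q"
  shows "distr (R \<Otimes>\<^sub>M Q) Q (\<lambda>q. w (fst q) (snd q)) = Q"
proof (rule measure_eqI)
  interpret R: prob_space R by fact
  interpret Q: prob_space Q by fact
  fix A assume "A \<in> sets (distr (R \<Otimes>\<^sub>M Q) Q (\<lambda>q. w (fst q) (snd q)))"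
  then have A: "A \<in> sets Q" by simp
  have "emeasure (distr (R \<Otimes>\<^sub>M Q) Q (\<lambda>q. w (fst q) (snd q))) A
      = (\<integral>\<^sup>+p. emeasure Q (Pair p -` ((\<lambda>q. w (fst q) (snd q)) -` A \<inter> space (R \<Otimes>\<^sub>M Q))) \<partial>R)"
    using A m by (simp add: emeasure_distr Q.emeasure_pair_measure_alt)
  also have "\<dots> = (\<integral>\<^sup>+p. emeasure Q A \<partial>R)"
  proof (rule nn_integral_cong)
    fix p assume "p \<in> space R"
    then have "Pair p -` ((\<lambda>q. w (fst q) (snd q)) -` A \<inter> space (R \<Otimes>\<^sub>M Q)) = w p -` A \<inter> space Q"
      by (auto simp: space_pair_measure)
    then show "emeasure Q (Pair p -` ((\<lambda>q. w (fst q) (snd q)) -` A \<inter> space (R \<Otimes>\<^sub>M Q))) = emeasure Q A"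
      using emeasure_distr[OF w(1) A] w(2) by simp
  qed
  finally show "emeasure (distr (R \<Otimes>\<^sub>M Q) Q (\<lambda>q. w (fst q) (snd q))) A = emeasure Q A"
    by (simp add: R.emeasure_space_1)
qed simp

section \<open>Limits of correlations on the square of a flow\<close>

locale tensor_flow =
  fixes N :: "'b measure" and T :: "real \<Rightarrow> 'b \<Rightarrow> 'b"
  assumes T: "mp_flow N T" and spN: "space N = UNIV"
begin

abbreviation "NN \<equiv> N \<Otimes>\<^sub>M N"

sublocale N: prob_space N using mp_flowD(1)[OF T] .

sublocale NN: pair_prob_space N N ..

lemma N_prob: "prob_space N" and NN_prob: "prob_space NN" and spNN: "space NN = UNIV"
  by (rule N.prob_space_axioms NN.P.prob_space_axioms)+ (simp add: spN space_pair_measure)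

lemma T_mp: "T a \<in> N \<rightarrow>\<^sub>M N" "distr N N (T a) = N" using mp_flowD[OF T] by blast+

lemma T_add: "T (a + b) y = T a (T b y)" and T_0: "T 0 y = y"
  using mp_flowD(5,6)[OF T] spN by simp_all

lemma tens_mp: "tens T a b \<in> NN \<rightarrow>\<^sub>M NN" "distr NN NN (tens T a b) = NN"
  unfolding tens_def using map_prod_measure_preserving[OF N_prob N_prob T_mp T_mp] by auto

lemma tens_add: "tens T (a + a') (b + b') z = tens T a b (tens T a' b' z)"
  by (simp add: tens_def T_add)

lemma tens_0: "tens T 0 0 z = z"
  by (simp add: tens_def T_0)

lemma tens_measurable:
  assumes "f \<in> R \<rightarrow>\<^sub>M borel" "g \<in> R \<rightarrow>\<^sub>M borel" "h \<in> R \<rightarrow>\<^sub>M NN"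
  shows "(\<lambda>x. tens T (f x) (g x) (h x)) \<in> R \<rightarrow>\<^sub>M NN"
  unfolding tens_def using assms
  by (intro measurable_Pair mp_flow_measurable[OF T] measurable_compose[OF assms(3)]) auto

text \<open>Makes continuity of correlations in time available when the first coordinate moves and
  the second rests.\<close>

lemma tens_flow: "mp_flow NN (\<lambda>c. tens T c 0)"
  unfolding mp_flow_def
proof (intro conjI allI ballI)
  show "(\<lambda>(t, x). tens T t 0 x) \<in> borel \<Otimes>\<^sub>M NN \<rightarrow>\<^sub>M NN"
    unfolding case_prod_beta' by (rule tens_measurable) auto
  show "tens T (s + t) 0 x = tens T s 0 (tens T t 0 x)" for s t x
    using tens_add[of s t 0 0] by simp
qed (auto simp: tens_mp tens_0 NN_prob)

text \<open>On rectangles the integral over \<open>NN\<close> is a product of two correlations on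
  \<open>N\<close>, so the limit is a matter of multiplying scalar limits;
  \<open>coupling_limit\<close> does the rest.\<close>

lemma tensor_coupling_limit:
  assumes Q: "prob_space Q"
    and \<tau>1: "\<tau>1 \<in> Q \<rightarrow>\<^sub>M NN" "distr Q NN \<tau>1 = NN"
    and \<tau>2: "\<tau>2 \<in> Q \<rightarrow>\<^sub>M NN" "distr Q NN \<tau>2 = NN"
    and conv: "\<And>A B C D. A \<in> sets N \<Longrightarrow> B \<in> sets N \<Longrightarrow> C \<in> sets N \<Longrightarrow> D \<in> sets N \<Longrightarrow>
      (\<lambda>n::nat. (\<integral>y. indicator A y * indicator C (T (a n) y) \<partial>N) * (\<integral>y. indicator B y * indicator D (T (b n) y) \<partial>N))
      \<longlonglongrightarrow> (\<integral>q. (indicator A (fst (\<tau>1 q)) * indicator B (snd (\<tau>1 q))) *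
                (indicator C (fst (\<tau>2 q)) * indicator D (snd (\<tau>2 q))) \<partial>Q :: real)"
    and k: "bdd_meas NN k" and h: "bdd_meas NN h"
  shows "(\<lambda>n. \<integral>z. k z * h (tens T (a n) (b n) z) \<partial>NN) \<longlonglongrightarrow> (\<integral>q. k (\<tau>1 q) * h (\<tau>2 q) \<partial>Q)"
proof (rule coupling_limit[OF NN_prob spNN rectangles_generate(1,2,3)[OF spN spN] Q tens_mp \<tau>1 \<tau>2 _ k h])
  fix U V assume "U \<in> {A \<times> B |A B. A \<in> sets N \<and> B \<in> sets N}" "V \<in> {A \<times> B |A B. A \<in> sets N \<and> B \<in> sets N}"
  then obtain A B C D where U: "U = A \<times> B" "A \<in> sets N" "B \<in> sets N" and V: "V = C \<times> D" "C \<in> sets N" "D \<in> sets N"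
    by auto
  have "(\<integral>z. indicator U z * indicator V (tens T (a n) (b n) z) \<partial>NN)
    = (\<integral>z. (indicator A (fst z) * indicator C (T (a n) (fst z))) * (indicator B (snd z) * indicator D (T (b n) (snd z))) \<partial>NN :: real)" for n
    by (intro Bochner_Integration.integral_cong) (auto simp: U V tens_def indicator_def)
  also have "\<dots> n = (\<integral>y. indicator A y * indicator C (T (a n) y) \<partial>N) * (\<integral>y. indicator B y * indicator D (T (b n) y) \<partial>N)" for n
    by (rule integral_prod_mult[OF N_prob N_prob])
      (intro bdd_meas_mult bdd_meas_indicator U V bdd_meas_comp[OF _ T_mp(1)])+
  finally have eq: "(\<integral>z. indicator U z * indicator V (tens T (a n) (b n) z) \<partial>NN)
    = (\<integral>y. indicator A y * indicator C (T (a n) y) \<partial>N) * (\<integral>y. indicator B y * indicator D (T (b n) y) \<partial>N :: real)" for n .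
  have eq': "(\<integral>q. indicator U (\<tau>1 q) * indicator V (\<tau>2 q) \<partial>Q) =
    (\<integral>q. (indicator A (fst (\<tau>1 q)) * indicator B (snd (\<tau>1 q))) *
                (indicator C (fst (\<tau>2 q)) * indicator D (snd (\<tau>2 q))) \<partial>Q :: real)"
    by (intro Bochner_Integration.integral_cong) (auto simp: U V indicator_times)
  show "(\<lambda>n. \<integral>z. indicator U z * indicator V (tens T (a n) (b n) z) \<partial>NN)
    \<longlonglongrightarrow> (\<integral>q. indicator U (\<tau>1 q) * (indicator V (\<tau>2 q) :: real) \<partial>Q)"
    unfolding eq eq' by (rule conv) (fact U V)+
qed

text \<open>The limiting coupling is the independent one: two independent points of
  \<open>NN\<close>.\<close>

lemma tensor_mixing:
  assumes mix: "\<And>f g. bdd_meas N f \<Longrightarrow> bdd_meas N g \<Longrightarrow>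
      (\<lambda>n::nat. \<integral>y. f y * g (T (r n) y) \<partial>N) \<longlonglongrightarrow> (\<integral>y. f y \<partial>N) * (\<integral>y. g y \<partial>N)"
    and k: "bdd_meas NN k" and h: "bdd_meas NN h"
  shows "(\<lambda>n. \<integral>z. k z * h (tens T (r n) (r n) z) \<partial>NN) \<longlonglongrightarrow> (\<integral>z. k z \<partial>NN) * (\<integral>z. h z \<partial>NN)"
proof -
  have "(\<lambda>n. \<integral>z. k z * h (tens T (r n) (r n) z) \<partial>NN) \<longlonglongrightarrow> (\<integral>q. k (fst q) * h (snd q) \<partial>(NN \<Otimes>\<^sub>M NN))"
  proof (rule tensor_coupling_limit[OF prob_space_pair[OF NN_prob NN_prob] _ _ _ _ _ k h])
    fix A B C D assume S: "A \<in> sets N" "B \<in> sets N" "C \<in> sets N" "D \<in> sets N"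
    then have b: "bdd_meas N (indicator A)" "bdd_meas N (indicator B)" "bdd_meas N (indicator C)" "bdd_meas N (indicator D)"
      by auto
    have bb: "bdd_meas NN (\<lambda>z. f (fst z) * g (snd z))" if "bdd_meas N f" "bdd_meas N g" for f g
      by (intro bdd_meas_mult bdd_meas_comp[OF that(1)] bdd_meas_comp[OF that(2)]) auto
    have "(\<integral>q. (indicator A (fst (fst q)) * indicator B (snd (fst q))) *
        (indicator C (fst (snd q)) * indicator D (snd (snd q))) \<partial>(NN \<Otimes>\<^sub>M NN) :: real)
      = ((\<integral>y. indicator A y \<partial>N) * (\<integral>y. indicator B y \<partial>N)) * ((\<integral>y. indicator C y \<partial>N) * (\<integral>y. indicator D y \<partial>N))"
      using integral_prod_mult[OF NN_prob NN_prob bb[OF b(1,2)] bb[OF b(3,4)]]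
        integral_prod_mult[OF N_prob N_prob b(1,2)] integral_prod_mult[OF N_prob N_prob b(3,4)] by simp
    moreover have "(\<lambda>n. (\<integral>y. indicator A y * indicator C (T (r n) y) \<partial>N) * (\<integral>y. indicator B y * indicator D (T (r n) y) \<partial>N))
      \<longlonglongrightarrow> ((\<integral>y. indicator A y \<partial>N) * (\<integral>y. indicator C y \<partial>N)) * ((\<integral>y. indicator B y \<partial>N) * (\<integral>y. indicator D y \<partial>N) :: real)"
      by (intro tendsto_mult mix b)
    ultimately show "(\<lambda>n. (\<integral>y. indicator A y * indicator C (T (r n) y) \<partial>N) * (\<integral>y. indicator B y * indicator D (T (r n) y) \<partial>N))
      \<longlonglongrightarrow> (\<integral>q. (indicator A (fst (fst q)) * indicator B (snd (fst q))) *
        (indicator C (fst (snd q)) * indicator D (snd (snd q))) \<partial>(NN \<Otimes>\<^sub>M NN) :: real)"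
      by (simp only: mult_ac)
  qed (auto intro: fst_measure_preserving snd_measure_preserving NN_prob)
  then show ?thesis by (simp add: integral_prod_mult[OF NN_prob NN_prob k h])
qed

text \<open>Mixing in the first coordinate only replaces it by an independent copy. The coupling
  therefore lives on \<open>N \<Otimes>\<^sub>M NN\<close> and pairs a point with its version
  resampled in the first coordinate: the weak limit is the conditional expectation given the second
  coordinate.\<close>

lemma tensor_conditional:
  assumes mix: "\<And>f g. bdd_meas N f \<Longrightarrow> bdd_meas N g \<Longrightarrow>
      (\<lambda>n::nat. \<integral>y. f y * g (T (r n) y) \<partial>N) \<longlonglongrightarrow> (\<integral>y. f y \<partial>N) * (\<integral>y. g y \<partial>N)"
    and k: "bdd_meas NN k" and h: "bdd_meas NN h"
  shows "(\<lambda>n. \<integral>z. k z * h (tens T (r n) 0 z) \<partial>NN) \<longlonglongrightarrow> (\<integral>z. k z * (\<integral>y. h (y, snd z) \<partial>N) \<partial>NN)"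
proof -
  have NNN: "prob_space (N \<Otimes>\<^sub>M NN)" by (rule prob_space_pair[OF N_prob NN_prob])
  have id: "(\<lambda>y. y) \<in> N \<rightarrow>\<^sub>M N" "distr N N (\<lambda>y. y) = N" by (auto simp: distr_id)
  have snd: "snd \<in> NN \<rightarrow>\<^sub>M N" "distr NN N snd = N" by (auto intro: snd_measure_preserving N_prob)
  note mp = map_prod_measure_preserving[OF N_prob N_prob id snd]
  have "(\<lambda>n. \<integral>z. k z * h (tens T (r n) 0 z) \<partial>NN)
      \<longlonglongrightarrow> (\<integral>q. k (snd q) * h (fst q, snd (snd q)) \<partial>(N \<Otimes>\<^sub>M NN))"
  proof (rule tensor_coupling_limit[OF NNN _ _ mp _ k h])
    fix A B C D assume S: "A \<in> sets N" "B \<in> sets N" "C \<in> sets N" "D \<in> sets N"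
    then have b: "bdd_meas N (indicator A)" "bdd_meas N (indicator C)" and b2: "bdd_meas N (\<lambda>y. indicator B y * indicator D y :: real)"
      by auto
    have bb: "bdd_meas NN (\<lambda>z. indicator A (fst z) * (indicator B (snd z) * indicator D (snd z) :: real))"
      by (intro bdd_meas_mult bdd_meas_comp[OF b(1)] bdd_meas_comp[OF bdd_meas_indicator[OF S(2)]] bdd_meas_comp[OF bdd_meas_indicator[OF S(4)]]) auto
    have "(\<integral>q. (indicator A (fst (snd q)) * indicator B (snd (snd q))) *
        (indicator C (fst (fst q, snd (snd q))) * indicator D (snd (fst q, snd (snd q)))) \<partial>(N \<Otimes>\<^sub>M NN) :: real)
      = (\<integral>q. indicator C (fst q) * (indicator A (fst (snd q)) * (indicator B (snd (snd q)) * indicator D (snd (snd q)))) \<partial>(N \<Otimes>\<^sub>M NN))"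
      by (intro Bochner_Integration.integral_cong) auto
    also have "\<dots> = (\<integral>y. indicator C y \<partial>N) * ((\<integral>y. indicator A y \<partial>N) * (\<integral>y. indicator B y * indicator D y \<partial>N))"
      using integral_prod_mult[OF N_prob NN_prob b(2) bb] integral_prod_mult[OF N_prob N_prob b(1) b2] by simp
    also have "\<dots> = ((\<integral>y. indicator A y \<partial>N) * (\<integral>y. indicator C y \<partial>N)) * (\<integral>y. indicator B y * indicator D y \<partial>N)" by simp
    finally have eq: "(\<integral>q. (indicator A (fst (snd q)) * indicator B (snd (snd q))) *
        (indicator C (fst (fst q, snd (snd q))) * indicator D (snd (fst q, snd (snd q)))) \<partial>(N \<Otimes>\<^sub>M NN) :: real)
      = ((\<integral>y. indicator A y \<partial>N) * (\<integral>y. indicator C y \<partial>N)) * (\<integral>y. indicator B y * indicator D y \<partial>N)" .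
    show "(\<lambda>n. (\<integral>y. indicator A y * indicator C (T (r n) y) \<partial>N) * (\<integral>y. indicator B y * indicator D (T 0 y) \<partial>N))
      \<longlonglongrightarrow> (\<integral>q. (indicator A (fst (snd q)) * indicator B (snd (snd q))) *
        (indicator C (fst (fst q, snd (snd q))) * indicator D (snd (fst q, snd (snd q)))) \<partial>(N \<Otimes>\<^sub>M NN) :: real)"
      unfolding eq T_0 by (intro tendsto_mult_right mix b)
  qed (auto intro: snd_measure_preserving N_prob NN_prob)
  also have "(\<integral>q. k (snd q) * h (fst q, snd (snd q)) \<partial>(N \<Otimes>\<^sub>M NN)) = (\<integral>z. k z * (\<integral>y. h (y, snd z) \<partial>N) \<partial>NN)"
  proof -
    have "bdd_meas (N \<Otimes>\<^sub>M NN) (\<lambda>q. k (snd q) * h (fst q, snd (snd q)))"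
      by (intro bdd_meas_mult bdd_meas_comp[OF k] bdd_meas_comp[OF h]) auto
    from Fubini_bdd(2)[OF N_prob NN_prob this] show ?thesis by simp
  qed
  finally show ?thesis .
qed

text \<open>A product of two integrals over \<open>\<nu>\<close> is one integral over
  \<open>\<nu> \<Otimes>\<^sub>M \<nu>\<close>; this is where two independent times arise from the
  single sequence \<open>t\<close>. The coupling draws \<open>p\<close> and \<open>z\<close>
  independently and pairs \<open>z\<close> with \<open>W p z\<close>, in the notation
  \<open>w p z\<close>.\<close>

lemma tensor_weak_limit:
  assumes \<nu>: "prob_space \<nu>" "sets \<nu> = sets borel"
    and conv: "\<And>f g. bdd_meas N f \<Longrightarrow> bdd_meas N g \<Longrightarrow>
      (\<lambda>i::nat. \<integral>y. f y * g (T (t i) y) \<partial>N) \<longlonglongrightarrow> (\<integral>a. (\<integral>y. f y * g (T a y) \<partial>N) \<partial>\<nu>)"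
    and k: "bdd_meas NN k" and h: "bdd_meas NN h"
  shows "(\<lambda>i. \<integral>z. k z * h (tens T (t i) (t i) z) \<partial>NN)
    \<longlonglongrightarrow> (\<integral>p. (\<integral>z. k z * h (tens T (fst p) (snd p) z) \<partial>NN) \<partial>(\<nu> \<Otimes>\<^sub>M \<nu>))"
proof -
  interpret \<nu>: prob_space \<nu> by fact
  note \<nu>m[measurable_cong] = \<nu>(2)
  have \<nu>\<nu>: "prob_space (\<nu> \<Otimes>\<^sub>M \<nu>)" by (rule prob_space_pair[OF \<nu>(1) \<nu>(1)])
  let ?Q = "(\<nu> \<Otimes>\<^sub>M \<nu>) \<Otimes>\<^sub>M NN"
  have Q: "prob_space ?Q" by (rule prob_space_pair[OF \<nu>\<nu> NN_prob])
  define w where "w p z = tens T (fst p) (snd p) z" for p z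
  have wm: "(\<lambda>q. w (fst q) (snd q)) \<in> ?Q \<rightarrow>\<^sub>M NN"
    unfolding w_def by (rule tens_measurable) (auto simp: measurable_compose[OF measurable_fst] cong: measurable_cong_sets)
  have wmp: "distr ?Q NN (\<lambda>q. w (fst q) (snd q)) = NN"
    by (rule random_measure_preserving[OF \<nu>\<nu> NN_prob wm]) (auto simp: w_def[abs_def] tens_mp)
  have fub: "(\<integral>q. k' (snd q) * h' (w (fst q) (snd q)) \<partial>?Q) = (\<integral>p. (\<integral>z. k' z * h' (w p z) \<partial>NN) \<partial>(\<nu> \<Otimes>\<^sub>M \<nu>))"
    if k': "bdd_meas NN k'" and h': "bdd_meas NN h'" for k' h'
  proof -
    have "bdd_meas ?Q (\<lambda>q. k' (snd q) * h' (w (fst q) (snd q)))"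
      by (intro bdd_meas_mult bdd_meas_comp[OF h' wm] bdd_meas_comp[OF k']) auto
    from Fubini_bdd(1)[OF \<nu>\<nu> NN_prob this] show ?thesis by simp
  qed
  have "(\<lambda>i. \<integral>z. k z * h (tens T (t i) (t i) z) \<partial>NN) \<longlonglongrightarrow> (\<integral>q. k (snd q) * h (w (fst q) (snd q)) \<partial>?Q)"
  proof (rule tensor_coupling_limit[OF Q _ _ wm wmp _ k h])
    fix A B C D assume S: "A \<in> sets N" "B \<in> sets N" "C \<in> sets N" "D \<in> sets N"
    then have b: "bdd_meas N (indicator A)" "bdd_meas N (indicator B)" "bdd_meas N (indicator C)" "bdd_meas N (indicator D)"
      by auto
    have bb: "bdd_meas NN (\<lambda>z. f (fst z) * g (snd z))" if "bdd_meas N f" "bdd_meas N g" for f g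
      by (intro bdd_meas_mult bdd_meas_comp[OF that(1)] bdd_meas_comp[OF that(2)]) auto
    define p where "p A C a = (\<integral>y. indicator A y * indicator C (T a y) \<partial>N :: real)" for A C a
    have pb: "bdd_meas \<nu> (p A C)" if "A \<in> sets N" "C \<in> sets N" for A C
      unfolding p_def
    proof (rule N.bdd_meas_integral[of _ _ 1])
      have "(\<lambda>q. T (fst q) (snd q)) \<in> \<nu> \<Otimes>\<^sub>M N \<rightarrow>\<^sub>M N"
        by (rule mp_flow_measurable[OF T]) (auto cong: measurable_cong_sets)
      from bdd_meas_comp[OF bdd_meas_indicator[OF that(2)] this]
        bdd_meas_comp[OF bdd_meas_indicator[OF that(1)] measurable_snd]
      have "bdd_meas (\<nu> \<Otimes>\<^sub>M N) (\<lambda>q. indicator A (snd q) * indicator C (T (fst q) (snd q)))"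
        by (intro bdd_meas_mult)
      then show "(\<lambda>(x, y). indicator A y * indicator C (T x y) :: real) \<in> borel_measurable (\<nu> \<Otimes>\<^sub>M N)"
        by (simp add: case_prod_beta' bdd_measD)
    qed (auto simp: indicator_def)
    have "(\<integral>z. (indicator A (fst z) * indicator B (snd z)) * (indicator C (fst (w q z)) * indicator D (snd (w q z))) \<partial>NN)
      = (\<integral>z. (indicator A (fst z) * indicator C (T (fst q) (fst z))) * (indicator B (snd z) * indicator D (T (snd q) (snd z))) \<partial>NN :: real)" for q
      by (intro Bochner_Integration.integral_cong) (auto simp: w_def tens_def)
    also have "\<dots> q = p A C (fst q) * p B D (snd q)" for q
      unfolding p_def by (rule integral_prod_mult[OF N_prob N_prob])
        (intro bdd_meas_mult bdd_meas_indicator S bdd_meas_comp[OF _ T_mp(1)])+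
    finally have in_eq: "(\<integral>z. (indicator A (fst z) * indicator B (snd z)) * (indicator C (fst (w q z)) * indicator D (snd (w q z))) \<partial>NN)
      = p A C (fst q) * p B D (snd q)" for q .
    have eq: "(\<integral>q. (indicator A (fst (snd q)) * indicator B (snd (snd q))) *
        (indicator C (fst (w (fst q) (snd q))) * indicator D (snd (w (fst q) (snd q)))) \<partial>?Q :: real)
      = (\<integral>a. p A C a \<partial>\<nu>) * (\<integral>a. p B D a \<partial>\<nu>)"
      using fub[OF bb[OF b(1,2)] bb[OF b(3,4)]] integral_prod_mult[OF \<nu>(1) \<nu>(1) pb pb, OF S(1,3,2,4)]
      by (simp add: in_eq)
    show "(\<lambda>i. (\<integral>y. indicator A y * indicator C (T (t i) y) \<partial>N) * (\<integral>y. indicator B y * indicator D (T (t i) y) \<partial>N))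
      \<longlonglongrightarrow> (\<integral>q. (indicator A (fst (snd q)) * indicator B (snd (snd q))) *
        (indicator C (fst (w (fst q) (snd q))) * indicator D (snd (w (fst q) (snd q)))) \<partial>?Q :: real)"
      unfolding eq p_def by (intro tendsto_mult conv b)
  qed (auto intro: snd_measure_preserving \<nu>\<nu> NN_prob)
  then show ?thesis unfolding fub[OF k h] unfolding w_def .
qed

end

section \<open>Isomorphic tensor squares\<close>

text \<open>The data are arranged so that exchanging the coordinates on either side gives another
  instance (\<open>swap_X\<close>, \<open>swap_Y\<close>). Every statement about \<open>X1\<close>
  thus has its twin for \<open>X2\<close>, and every statement about the second coordinate of
  \<open>NN\<close> its twin for the first. \<open>r\<close> is a mixing sequence for
  \<open>T\<close>, \<open>t\<close> the sequence of the weak limit.\<close>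

locale tensor_square = tensor_flow N T
  for N :: "'b::polish_space measure" and T :: "real \<Rightarrow> 'b \<Rightarrow> 'b" +
  fixes M :: "'a::polish_space measure" and S :: "real \<Rightarrow> 'a \<Rightarrow> 'a"
    and \<Phi> :: "'a \<times> 'a \<Rightarrow> 'b \<times> 'b" and \<Psi> :: "'b \<times> 'b \<Rightarrow> 'a \<times> 'a"
    and r :: "nat \<Rightarrow> real" and t :: "nat \<Rightarrow> real" and \<nu> :: "real measure"
  assumes sN: "sets N = sets borel" and sM: "sets M = sets borel" and M_prob: "prob_space M"
    and S_mp: "S s \<in> M \<rightarrow>\<^sub>M M" "distr M M (S s) = M"
    and Psi_mp: "\<Psi> \<in> N \<Otimes>\<^sub>M N \<rightarrow>\<^sub>M M \<Otimes>\<^sub>M M" "distr (N \<Otimes>\<^sub>M N) (M \<Otimes>\<^sub>M M) \<Psi> = M \<Otimes>\<^sub>M M"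
    and Phi_mp: "\<Phi> \<in> M \<Otimes>\<^sub>M M \<rightarrow>\<^sub>M N \<Otimes>\<^sub>M N" "distr (M \<Otimes>\<^sub>M M) (N \<Otimes>\<^sub>M N) \<Phi> = N \<Otimes>\<^sub>M N"
    and Phi_Psi: "AE y in N \<Otimes>\<^sub>M N. \<Phi> (\<Psi> y) = y"
    and Psi_Phi: "AE x in M \<Otimes>\<^sub>M M. \<Psi> (\<Phi> x) = x"
    and equivariant: "AE y in N \<Otimes>\<^sub>M N. \<Psi> (tens T s s y) = (S s (fst (\<Psi> y)), S s (snd (\<Psi> y)))"
    and mix: "bdd_meas N f \<Longrightarrow> bdd_meas N g \<Longrightarrow>
      (\<lambda>n. \<integral>y. f y * g (T (r n) y) \<partial>N) \<longlonglongrightarrow> (\<integral>y. f y \<partial>N) * (\<integral>y. g y \<partial>N)"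
    and nu: "prob_space \<nu>" "sets \<nu> = sets borel" "emeasure \<nu> {a} = 0"
    and weak_limit: "bdd_meas N f \<Longrightarrow> bdd_meas N g \<Longrightarrow>
      (\<lambda>i. \<integral>y. f y * g (T (t i) y) \<partial>N) \<longlonglongrightarrow> (\<integral>a. (\<integral>y. f y * g (T a y) \<partial>N) \<partial>\<nu>)"
begin

abbreviation "MM \<equiv> M \<Otimes>\<^sub>M M"

abbreviation "X1 y \<equiv> fst (\<Psi> y)"

abbreviation "X2 y \<equiv> snd (\<Psi> y)"

abbreviation "W \<equiv> tens T"

sublocale M: prob_space M by (rule M_prob)

sublocale MM: pair_prob_space M M ..

lemma spM: "space M = UNIV" using sets_eq_imp_space_eq[OF sM] by simp

lemma MM_prob: "prob_space MM" by (rule MM.P.prob_space_axioms)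

lemma swap_X: "tensor_square N T M S (\<lambda>x. \<Phi> (prod.swap x)) (\<lambda>y. prod.swap (\<Psi> y)) r t \<nu>"
proof (rule tensor_square.intro[OF tensor_flow_axioms tensor_square_axioms.intro])
  note sw = swap_measure_preserving[OF M_prob M_prob]
  show "(\<lambda>y. prod.swap (\<Psi> y)) \<in> NN \<rightarrow>\<^sub>M MM" by (rule measurable_compose[OF Psi_mp(1) sw(1)])
  show "(\<lambda>x. \<Phi> (prod.swap x)) \<in> MM \<rightarrow>\<^sub>M NN" by (rule measurable_compose[OF sw(1) Phi_mp(1)])
  show "distr NN MM (\<lambda>y. prod.swap (\<Psi> y)) = MM"
    using distr_distr[OF sw(1) Psi_mp(1)] by (simp add: comp_def Psi_mp(2) sw(2))
  show "distr MM NN (\<lambda>x. \<Phi> (prod.swap x)) = NN"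
    using distr_distr[OF Phi_mp(1) sw(1)] by (simp add: comp_def Phi_mp(2) sw(2))
  show "AE y in NN. \<Phi> (prod.swap (prod.swap (\<Psi> y))) = y" using Phi_Psi by simp
  show "AE x in MM. prod.swap (\<Psi> (\<Phi> (prod.swap x))) = x"
    using AE_distr_eq[OF sw Psi_Phi] by eventually_elim simp
  show "AE y in NN. prod.swap (\<Psi> (W s s y)) = (S s (fst (prod.swap (\<Psi> y))), S s (snd (prod.swap (\<Psi> y))))" for s
    using equivariant[of s] by eventually_elim (simp add: prod.swap_def)
qed (fact sN sM M_prob S_mp mix nu weak_limit)+

lemma swap_Y: "tensor_square N T M S (\<lambda>x. prod.swap (\<Phi> x)) (\<lambda>y. \<Psi> (prod.swap y)) r t \<nu>"
proof (rule tensor_square.intro[OF tensor_flow_axioms tensor_square_axioms.intro])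
  note sw = swap_measure_preserving[OF N_prob N_prob]
  show "(\<lambda>y. \<Psi> (prod.swap y)) \<in> NN \<rightarrow>\<^sub>M MM" by (rule measurable_compose[OF sw(1) Psi_mp(1)])
  show "(\<lambda>x. prod.swap (\<Phi> x)) \<in> MM \<rightarrow>\<^sub>M NN" by (rule measurable_compose[OF Phi_mp(1) sw(1)])
  show "distr NN MM (\<lambda>y. \<Psi> (prod.swap y)) = MM"
    using distr_distr[OF Psi_mp(1) sw(1)] by (simp add: comp_def Psi_mp(2) sw(2))
  show "distr MM NN (\<lambda>x. prod.swap (\<Phi> x)) = NN"
    using distr_distr[OF sw(1) Phi_mp(1)] by (simp add: comp_def Phi_mp(2) sw(2))
  show "AE y in NN. prod.swap (\<Phi> (\<Psi> (prod.swap y))) = y"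
    using AE_distr_eq[OF sw Phi_Psi] by eventually_elim simp
  show "AE x in MM. \<Psi> (prod.swap (prod.swap (\<Phi> x))) = x" using Psi_Phi by simp
  have "prod.swap (W s s y) = W s s (prod.swap y)" for s y by (simp add: tens_def prod.swap_def)
  then show "AE y in NN. \<Psi> (prod.swap (W s s y)) = (S s (fst (\<Psi> (prod.swap y))), S s (snd (\<Psi> (prod.swap y))))" for s
    using AE_distr_eq[OF sw equivariant[of s]] by simp
qed (fact sN sM M_prob S_mp mix nu weak_limit)+

lemma X1_mp: "(\<lambda>y. X1 y) \<in> NN \<rightarrow>\<^sub>M M" "distr NN M (\<lambda>y. X1 y) = M"
proof -
  show "(\<lambda>y. X1 y) \<in> NN \<rightarrow>\<^sub>M M" using measurable_compose[OF Psi_mp(1) measurable_fst] .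
  have "distr NN M (\<lambda>y. X1 y) = distr (distr NN MM \<Psi>) M fst"
    by (subst distr_distr[OF measurable_fst Psi_mp(1)]) (simp add: comp_def)
  then show "distr NN M (\<lambda>y. X1 y) = M" by (simp add: Psi_mp(2) fst_measure_preserving M_prob)
qed

lemma X2_mp: "(\<lambda>y. X2 y) \<in> NN \<rightarrow>\<^sub>M M" "distr NN M (\<lambda>y. X2 y) = M"
  using tensor_square.X1_mp[OF swap_X] by simp_all

lemma X1_equivariant: "AE y in NN. X1 (W s s y) = S s (X1 y)"
  using equivariant[of s] by eventually_elim simp

lemma X2_equivariant: "AE y in NN. X2 (W s s y) = S s (X2 y)"
  using equivariant[of s] by eventually_elim simp

section \<open>Testing for functions of one coordinate\<close>

lemma transfer:
  assumes "bdd_meas MM F" shows "(\<integral>y. F (\<Psi> y) \<partial>NN) = (\<integral>x. F x \<partial>MM)"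
  by (rule NN.P.integral_distr_eq[OF Psi_mp bdd_measD[OF assms]])

lemma bdd_X1: "bdd_meas M f \<Longrightarrow> bdd_meas NN (\<lambda>y. f (X1 y))"
  and bdd_X2: "bdd_meas M f \<Longrightarrow> bdd_meas NN (\<lambda>y. f (X2 y))"
  using bdd_meas_comp X1_mp X2_mp by blast+

lemma bdd_W: "bdd_meas NN f \<Longrightarrow> bdd_meas NN (\<lambda>y. f (W a b y))"
  using bdd_meas_comp tens_mp by blast

lemma integral_X1: "bdd_meas M f \<Longrightarrow> (\<integral>y. f (X1 y) \<partial>NN) = (\<integral>x. f x \<partial>M)"
  by (rule NN.P.integral_distr_eq[OF X1_mp bdd_measD])

lemma integral_X2: "bdd_meas M f \<Longrightarrow> (\<integral>y. f (X2 y) \<partial>NN) = (\<integral>x. f x \<partial>M)"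
  by (rule NN.P.integral_distr_eq[OF X2_mp bdd_measD])

lemma X1_X2_independent:
  assumes f: "bdd_meas M f" and k: "bdd_meas M k"
  shows "(\<integral>y. f (X1 y) * k (X2 y) \<partial>NN) = (\<integral>x. f x \<partial>M) * (\<integral>x. k x \<partial>M)"
proof -
  have "bdd_meas MM (\<lambda>x. f (fst x) * k (snd x))"
    by (intro bdd_meas_mult bdd_meas_comp[OF f] bdd_meas_comp[OF k]) auto
  from transfer[OF this] integral_prod_mult[OF M_prob M_prob f k] show ?thesis by simp
qed

text \<open>The conditional independence of \<open>h\<close> and \<open>X2\<close> given
  \<open>X1\<close>. Because \<open>X1\<close> and \<open>X2\<close> are independent and together
  determine the point, this singles out the functions of \<open>X1\<close>, by a condition that is
  stable under weak limits.\<close>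

definition indep_X2 :: "('b \<times> 'b \<Rightarrow> real) \<Rightarrow> bool" where
  "indep_X2 h \<longleftrightarrow> (\<forall>f k. bdd_meas M f \<longrightarrow> bdd_meas M k \<longrightarrow>
    (\<integral>y. f (X1 y) * k (X2 y) * h y \<partial>NN) = (\<integral>x. k x \<partial>M) * (\<integral>y. f (X1 y) * h y \<partial>NN))"

lemma indep_X2I:
  assumes "\<And>f k. bdd_meas M f \<Longrightarrow> bdd_meas M k \<Longrightarrow>
    (\<integral>y. f (X1 y) * k (X2 y) * h y \<partial>NN) = (\<integral>x. k x \<partial>M) * (\<integral>y. f (X1 y) * h y \<partial>NN)"
  shows "indep_X2 h"
  using assms unfolding indep_X2_def by blast

lemma indep_X2D:
  assumes "indep_X2 h" "bdd_meas M f" "bdd_meas M k"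
  shows "(\<integral>y. f (X1 y) * k (X2 y) * h y \<partial>NN) = (\<integral>x. k x \<partial>M) * (\<integral>y. f (X1 y) * h y \<partial>NN)"
  using assms unfolding indep_X2_def by blast

lemma Phi_transfer:
  assumes F: "bdd_meas MM F" and h: "bdd_meas NN h"
  shows "(\<integral>x. F x * h (\<Phi> x) \<partial>MM) = (\<integral>y. F (\<Psi> y) * h y \<partial>NN)"
proof -
  have hP: "bdd_meas MM (\<lambda>x. h (\<Phi> x))" by (rule bdd_meas_comp[OF h Phi_mp(1)])
  have "(\<integral>x. F x * h (\<Phi> x) \<partial>MM) = (\<integral>y. F (\<Psi> y) * h (\<Phi> (\<Psi> y)) \<partial>NN)"
    by (rule transfer[symmetric]) (intro bdd_meas_mult F hP)
  also have "\<dots> = (\<integral>y. F (\<Psi> y) * h y \<partial>NN)"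
  proof (rule integral_cong_AE)
    show "AE y in NN. F (\<Psi> y) * h (\<Phi> (\<Psi> y)) = F (\<Psi> y) * h y"
      using Phi_Psi by eventually_elim simp
  qed (intro bdd_measD bdd_meas_mult bdd_meas_comp[OF F Psi_mp(1)] bdd_meas_comp[OF hP Psi_mp(1)] h)+
  finally show ?thesis .
qed

lemma indep_X2_Phi:
  assumes h: "bdd_meas NN h" and ind: "indep_X2 h" and f: "bdd_meas M f" and k: "bdd_meas M k"
  shows "(\<integral>z. f (fst z) * k (snd z) * h (\<Phi> z) \<partial>MM) = (\<integral>x. k x \<partial>M) * (\<integral>z. f (fst z) * h (\<Phi> z) \<partial>MM)"
proof -
  have f': "bdd_meas MM (\<lambda>z. f (fst z))" and k': "bdd_meas MM (\<lambda>z. k (snd z))"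
    by (intro bdd_meas_comp[OF f] bdd_meas_comp[OF k] measurable_fst measurable_snd)+
  show ?thesis
    using Phi_transfer[OF bdd_meas_mult[OF f' k'] h] Phi_transfer[OF f' h] indep_X2D[OF ind f k] by simp
qed

text \<open>Transported to \<open>MM\<close> by \<open>\<Phi>\<close>, the coordinate
  \<open>X1\<close> becomes \<open>fst\<close> and the criterion for products applies;
  \<open>\<Psi>\<close> carries the result back.\<close>

lemma indep_X2_bdd:
  assumes h: "bdd_meas NN h" and ind: "indep_X2 h"
  shows "\<exists>w. bdd_meas M w \<and> (AE y in NN. h y = w (X1 y))"
proof -
  have hP: "bdd_meas MM (\<lambda>x. h (\<Phi> x))" by (rule bdd_meas_comp[OF h Phi_mp(1)])
  have w: "bdd_meas M (\<lambda>x. \<integral>x'. h (\<Phi> (x, x')) \<partial>M)"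
    "AE z in MM. h (\<Phi> z) = (\<integral>x'. h (\<Phi> (fst z, x')) \<partial>M)"
  proof -
    show "bdd_meas M (\<lambda>x. \<integral>x'. h (\<Phi> (x, x')) \<partial>M)"
      by (rule bdd_function_of_fst(1)[OF M_prob spM hP]) (rule indep_X2_Phi[OF h ind])
    show "AE z in MM. h (\<Phi> z) = (\<integral>x'. h (\<Phi> (fst z, x')) \<partial>M)"
      by (rule bdd_function_of_fst(2)[OF M_prob spM hP]) (rule indep_X2_Phi[OF h ind])
  qed
  from AE_distr_eq[OF Psi_mp w(2)] Phi_Psi
  have "AE y in NN. h y = (\<integral>x'. h (\<Phi> (X1 y, x')) \<partial>M)" by eventually_elim simp
  with w(1) show ?thesis by blast
qed

lemma indep_X2_function:
  fixes \<tau> :: "'b \<times> 'b \<Rightarrow> 'c::{second_countable_topology, t1_space}"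
  assumes \<tau>: "\<tau> \<in> NN \<rightarrow>\<^sub>M Z" and Z: "sets Z = sets borel"
    and ind: "\<And>g. bdd_meas Z g \<Longrightarrow> indep_X2 (\<lambda>y. g (\<tau> y))"
  shows "\<exists>\<phi>\<in>M \<rightarrow>\<^sub>M Z. AE y in NN. \<tau> y = \<phi> (X1 y)"
proof -
  have "\<exists>\<phi>\<in>M \<rightarrow>\<^sub>M Z. AE z in MM. \<tau> (\<Phi> z) = \<phi> (fst z)"
    by (rule function_of_fst[OF M_prob spM measurable_compose[OF Phi_mp(1) \<tau>] Z])
      (rule indep_X2_Phi[OF bdd_meas_comp[OF _ \<tau>] ind])
  then obtain \<phi> where \<phi>: "\<phi> \<in> M \<rightarrow>\<^sub>M Z" "AE z in MM. \<tau> (\<Phi> z) = \<phi> (fst z)" by blast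
  from AE_distr_eq[OF Psi_mp \<phi>(2)] Phi_Psi have "AE y in NN. \<tau> y = \<phi> (X1 y)"
    by eventually_elim simp
  with \<phi>(1) show ?thesis by blast
qed

text \<open>The converse direction, by which product maps at given times feed identities into a
  limit of times.\<close>

lemma function_indep_X2:
  assumes \<tau>: "\<tau> \<in> NN \<rightarrow>\<^sub>M Z" and \<phi>: "\<phi> \<in> M \<rightarrow>\<^sub>M Z" "AE y in NN. \<tau> y = \<phi> (X1 y)" and g: "bdd_meas Z g"
  shows "indep_X2 (\<lambda>y. g (\<tau> y))"
proof (rule indep_X2I)
  fix f k assume f: "bdd_meas M f" and k: "bdd_meas M k"
  have g\<tau>: "bdd_meas NN (\<lambda>y. g (\<tau> y))" by (rule bdd_meas_comp[OF g \<tau>])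
  have g\<phi>: "bdd_meas M (\<lambda>x. g (\<phi> x))" by (rule bdd_meas_comp[OF g \<phi>(1)])
  have "(\<integral>y. f (X1 y) * k (X2 y) * g (\<tau> y) \<partial>NN) = (\<integral>y. (f (X1 y) * g (\<phi> (X1 y))) * k (X2 y) \<partial>NN)"
  proof (rule integral_cong_AE)
    show "AE y in NN. f (X1 y) * k (X2 y) * g (\<tau> y) = (f (X1 y) * g (\<phi> (X1 y))) * k (X2 y)"
      using \<phi>(2) by eventually_elim simp
  qed (intro bdd_measD bdd_meas_mult bdd_X1 bdd_X2 f k g\<tau> bdd_X1[OF g\<phi>])+
  also have "\<dots> = (\<integral>x. f x * g (\<phi> x) \<partial>M) * (\<integral>x. k x \<partial>M)"
    by (rule X1_X2_independent[OF bdd_meas_mult[OF f g\<phi>] k])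
  also have "(\<integral>x. f x * g (\<phi> x) \<partial>M) = (\<integral>y. f (X1 y) * g (\<phi> (X1 y)) \<partial>NN)"
    by (rule integral_X1[OF bdd_meas_mult[OF f g\<phi>], symmetric])
  also have "\<dots> = (\<integral>y. f (X1 y) * g (\<tau> y) \<partial>NN)"
  proof (rule integral_cong_AE)
    show "AE y in NN. f (X1 y) * g (\<phi> (X1 y)) = f (X1 y) * g (\<tau> y)"
      using \<phi>(2) by eventually_elim simp
  qed (intro bdd_measD bdd_meas_mult bdd_X1 f g\<tau> bdd_X1[OF g\<phi>])+
  finally show "(\<integral>y. f (X1 y) * k (X2 y) * g (\<tau> y) \<partial>NN) = (\<integral>x. k x \<partial>M) * (\<integral>y. f (X1 y) * g (\<tau> y) \<partial>NN)"
    by simp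
qed

subsection \<open>The maps in the weak limit are products\<close>

text \<open>For \<open>k\<close> of mean zero put \<open>w = 1\<^sub>A(X1) k(X2) 1\<^sub>C(X1 \<circ> W a b)\<close>. By mixing, the average over \<open>(a, b)\<close>
  of \<open>(\<integral>w)\<^sup>2\<close> is the limit of the averages of \<open>\<integral>w \<cdot> w \<circ> W s s\<close>; the weak limit turns these into limits of
  products containing the factor \<open>\<integral>k \<cdot> k \<circ> S s\<close>, which tends to zero.\<close>

lemma average_square_zero:
  assumes A: "A \<in> sets M" and C: "C \<in> sets M" and k: "bdd_meas M k" "\<And>x. \<bar>k x\<bar> \<le> 1" "(\<integral>x. k x \<partial>M) = 0"
  shows "AE p in \<nu> \<Otimes>\<^sub>M \<nu>. (\<integral>y. indicator A (X1 y) * k (X2 y) * indicator C (X1 (W (fst p) (snd p) y)) \<partial>NN) = 0"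
proof -
  have \<nu>\<nu>: "prob_space (\<nu> \<Otimes>\<^sub>M \<nu>)" by (rule prob_space_pair[OF nu(1) nu(1)])
  interpret \<nu>\<nu>: prob_space "\<nu> \<Otimes>\<^sub>M \<nu>" by fact
  note [measurable_cong] = nu(2)
  let ?R = "(\<nu> \<Otimes>\<^sub>M \<nu>) \<Otimes>\<^sub>M NN"
  have a: "bdd_meas M (indicator A)" and c: "bdd_meas M (indicator C)" using A C by auto
  define w where "w p y = indicator A (X1 y) * k (X2 y) * (indicator C (X1 (W (fst p) (snd p) y)) :: real)" for p y
  have w1: "\<bar>w p y\<bar> \<le> 1" for p y unfolding w_def using k(2) by (simp add: indicator_def)
  have wN: "bdd_meas NN (w p)" for p
    unfolding w_def by (intro bdd_meas_mult bdd_X1[OF a] bdd_X2[OF k(1)] bdd_W[OF bdd_X1[OF c]])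
  have Wm: "(\<lambda>q. W (fst (fst q)) (snd (fst q)) (snd q)) \<in> ?R \<rightarrow>\<^sub>M NN"
    by (rule tens_measurable) (auto simp: measurable_compose[OF measurable_fst] cong: measurable_cong_sets)
  have wR: "bdd_meas ?R (\<lambda>q. w (fst q) (snd q))"
    unfolding w_def
    by (intro bdd_meas_mult bdd_meas_comp[OF bdd_X1[OF a] measurable_snd] bdd_meas_comp[OF bdd_X2[OF k(1)] measurable_snd]
        bdd_meas_comp[OF bdd_X1[OF c] Wm])
  have wsR: "bdd_meas ?R (\<lambda>q. w (fst q) (W s s (snd q)))" for s
  proof -
    have "(\<lambda>q. (fst q, W s s (snd q))) \<in> ?R \<rightarrow>\<^sub>M ?R"
      by (intro measurable_Pair measurable_fst measurable_compose[OF measurable_snd tens_mp(1)])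
    from bdd_meas_comp[OF wR this] show ?thesis by simp
  qed
  define I where "I p = (\<integral>y. w p y \<partial>NN)" for p
  define v where "v s p = (\<integral>y. w p y * w p (W s s y) \<partial>NN)" for s p
  have ww1: "\<bar>w p y * w p y'\<bar> \<le> 1" for p y y'
  proof -
    have "\<bar>w p y\<bar> * \<bar>w p y'\<bar> \<le> 1 * 1" by (intro mult_mono w1) auto
    then show ?thesis by (simp add: abs_mult)
  qed
  have Ib: "bdd_meas (\<nu> \<Otimes>\<^sub>M \<nu>) I"
    unfolding I_def using bdd_measD[OF wR]
    by (intro NN.P.bdd_meas_integral[of _ _ 1] w1) (simp add: case_prod_beta')
  have vb: "bdd_meas (\<nu> \<Otimes>\<^sub>M \<nu>) (v s)" for s
    unfolding v_def using bdd_measD[OF bdd_meas_mult[OF wR wsR]]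
    by (intro NN.P.bdd_meas_integral[of _ _ 1] ww1) (simp add: case_prod_beta')
  have v1: "\<bar>v s p\<bar> \<le> 1" for s p unfolding v_def by (rule NN.P.abs_integral_le_const) (rule ww1)
  have "(\<lambda>n. v (r n) p) \<longlonglongrightarrow> I p * I p" for p
    unfolding v_def I_def by (rule tensor_mixing[OF mix wN wN])
  then have lim: "(\<lambda>n. \<integral>p. v (r n) p \<partial>(\<nu> \<Otimes>\<^sub>M \<nu>)) \<longlonglongrightarrow> (\<integral>p. I p * I p \<partial>(\<nu> \<Otimes>\<^sub>M \<nu>))"
    using bdd_measD[OF vb] bdd_measD[OF bdd_meas_mult[OF Ib Ib]] v1
    by (intro \<nu>\<nu>.bounded_convergence[where C=1]) auto
  define \<kappa> where "\<kappa> s = (\<integral>x. k x * k (S s x) \<partial>M)" for s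
  have kS: "bdd_meas M (\<lambda>x. k x * k (S s x))" for s
    by (intro bdd_meas_mult k(1) bdd_meas_comp[OF k(1) S_mp(1)])
  have le: "\<bar>\<integral>p. v s p \<partial>(\<nu> \<Otimes>\<^sub>M \<nu>)\<bar> \<le> \<bar>\<kappa> s\<bar>" for s
  proof -
    \<comment> \<open>\<open>W a b\<close> commutes with \<open>W s s\<close>, so the product of
      \<open>w\<close> and its translate regroups into a factor \<open>K\<close> free of
      \<open>(a, b)\<close> and a function \<open>H\<close> composed with \<open>W a b\<close>: the
      form to which the weak limit applies.\<close>
    define K where "K y = (indicator A (X1 y) * indicator A (S s (X1 y))) * (k (X2 y) * k (S s (X2 y)))" for y
    define H where "H y = (indicator C (X1 y) * indicator C (S s (X1 y)) :: real)" for y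
    have aa: "bdd_meas M (\<lambda>x. indicator A x * indicator A (S s x) :: real)"
      by (intro bdd_meas_mult a bdd_meas_comp[OF a S_mp(1)])
    have cc: "bdd_meas M (\<lambda>x. indicator C x * indicator C (S s x) :: real)"
      by (intro bdd_meas_mult c bdd_meas_comp[OF c S_mp(1)])
    have Kb: "bdd_meas NN K" unfolding K_def by (intro bdd_meas_mult[OF bdd_X1[OF aa] bdd_X2[OF kS]])
    have Hb: "bdd_meas NN H" unfolding H_def by (rule bdd_X1[OF cc])
    have v_eq: "v s p = (\<integral>y. K y * H (W (fst p) (snd p) y) \<partial>NN)" for p
      unfolding v_def
    proof (rule integral_cong_AE)
      have comm: "W (fst p) (snd p) (W s s y) = W s s (W (fst p) (snd p) y)" for y
        using tens_add[of "fst p" s "snd p" s y] tens_add[of s "fst p" s "snd p" y] by (simp add: add.commute)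
      show "AE y in NN. w p y * w p (W s s y) = K y * H (W (fst p) (snd p) y)"
        using X1_equivariant[of s] X2_equivariant[of s]
          AE_distr_eq[OF tens_mp[of "fst p" "snd p"] X1_equivariant[of s]]
        by eventually_elim (simp add: w_def K_def H_def comm)
    qed (intro bdd_measD bdd_meas_mult wN bdd_W[OF wN] Kb bdd_W[OF Hb])+
    \<comment> \<open>At equal times \<open>W (t i) (t i)\<close> acts as \<open>S (t i)\<close> on
      each coordinate, so the integral factorises; the \<open>X1\<close> part is at most 1 and the
      \<open>X2\<close> part does not depend on \<open>t i\<close>.\<close>
    have "\<bar>\<integral>y. K y * H (W (t i) (t i) y) \<partial>NN\<bar> \<le> \<bar>\<kappa> s\<bar>" for i
    proof -
      define a' where "a' x = indicator A x * indicator A (S s x) * (indicator C (S (t i) x) * indicator C (S s (S (t i) x)) :: real)" for x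
      have a'b: "bdd_meas M a'" unfolding a'_def by (rule bdd_meas_mult[OF aa bdd_meas_comp[OF cc S_mp(1)]])
      have "(\<integral>y. K y * H (W (t i) (t i) y) \<partial>NN) = (\<integral>y. a' (X1 y) * (\<lambda>x. k x * k (S s x)) (X2 y) \<partial>NN)"
      proof (rule integral_cong_AE)
        show "AE y in NN. K y * H (W (t i) (t i) y) = a' (X1 y) * (\<lambda>x. k x * k (S s x)) (X2 y)"
          using X1_equivariant[of "t i"] by eventually_elim (simp add: K_def H_def a'_def)
      qed (intro bdd_measD bdd_meas_mult Kb bdd_W[OF Hb] bdd_X1[OF a'b] bdd_X2[OF kS])+
      also have "\<dots> = (\<integral>x. a' x \<partial>M) * \<kappa> s"
        unfolding \<kappa>_def by (rule X1_X2_independent[OF a'b kS])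
      finally have "\<bar>\<integral>y. K y * H (W (t i) (t i) y) \<partial>NN\<bar> = \<bar>\<integral>x. a' x \<partial>M\<bar> * \<bar>\<kappa> s\<bar>" by (simp add: abs_mult)
      moreover have "\<bar>\<integral>x. a' x \<partial>M\<bar> \<le> 1"
        by (rule M.abs_integral_le_const) (simp add: a'_def indicator_def)
      ultimately show ?thesis using mult_right_mono[of _ 1 "\<bar>\<kappa> s\<bar>"] by simp
    qed
    moreover have "(\<lambda>i. \<bar>\<integral>y. K y * H (W (t i) (t i) y) \<partial>NN\<bar>) \<longlonglongrightarrow> \<bar>\<integral>p. v s p \<partial>(\<nu> \<Otimes>\<^sub>M \<nu>)\<bar>"
      unfolding v_eq by (intro tendsto_rabs tensor_weak_limit[OF nu(1,2) weak_limit Kb Hb])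
    ultimately show ?thesis by (meson LIMSEQ_le_const2)
  qed
  \<comment> \<open>Mixing along \<open>r\<close> is available for \<open>T\<close>, so the
    correlation of \<open>k\<close> under \<open>S\<close> is rewritten on
    \<open>NN\<close>.\<close>
  have \<kappa>_eq: "\<kappa> s = (\<integral>y. k (X2 y) * k (X2 (W s s y)) \<partial>NN)" for s
  proof -
    have "\<kappa> s = (\<integral>y. k (X2 y) * k (S s (X2 y)) \<partial>NN)"
      unfolding \<kappa>_def by (rule integral_X2[OF kS, symmetric])
    also have "\<dots> = (\<integral>y. k (X2 y) * k (X2 (W s s y)) \<partial>NN)"
    proof (rule integral_cong_AE)
      show "AE y in NN. k (X2 y) * k (S s (X2 y)) = k (X2 y) * k (X2 (W s s y))"
        using X2_equivariant[of s] by eventually_elim simp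
    qed (intro bdd_measD bdd_meas_mult bdd_X2[OF k(1)] bdd_W[OF bdd_X2[OF k(1)]] bdd_X2[OF bdd_meas_comp[OF k(1) S_mp(1)]])+
    finally show ?thesis .
  qed
  have "(\<lambda>n. \<kappa> (r n)) \<longlonglongrightarrow> (\<integral>y. k (X2 y) \<partial>NN) * (\<integral>y. k (X2 y) \<partial>NN)"
    unfolding \<kappa>_eq by (rule tensor_mixing[OF mix bdd_X2[OF k(1)] bdd_X2[OF k(1)]])
  then have "(\<lambda>n. \<kappa> (r n)) \<longlonglongrightarrow> 0" by (simp only: integral_X2[OF k(1)] k(3) mult_zero_left)
  then have "(\<lambda>n. \<bar>\<kappa> (r n)\<bar>) \<longlonglongrightarrow> 0" by (rule tendsto_rabs_zero)
  then have "(\<lambda>n. \<integral>p. v (r n) p \<partial>(\<nu> \<Otimes>\<^sub>M \<nu>)) \<longlonglongrightarrow> 0"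
    by (rule Lim_null_comparison[rotated]) (simp add: le)
  with lim have "(\<integral>p. I p * I p \<partial>(\<nu> \<Otimes>\<^sub>M \<nu>)) = 0" by (rule LIMSEQ_unique)
  from \<nu>\<nu>.AE_eq_0I[OF Ib this] show ?thesis unfolding I_def w_def .
qed

text \<open>Countably many triples from the generator leave one common null set of pairs
  \<open>p\<close>. Outside it the vanishing integrals extend from indicators to bounded functions,
  one argument at a time, until they say \<open>indep_X2\<close>.\<close>

lemma AE_X1_factor: "AE p in \<nu> \<Otimes>\<^sub>M \<nu>. \<exists>U\<in>M \<rightarrow>\<^sub>M M. AE y in NN. X1 (W (fst p) (snd p) y) = U (X1 y)"
proof -
  obtain E :: "'a set set" where E: "countable E" "Int_stable E" "UNIV \<in> E" "sets (borel :: 'a measure) = sigma_sets UNIV E"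
    by (rule countable_generator) blast
  have sE: "sets M = sigma_sets UNIV E" using sM E(4) by simp
  have EM: "A \<in> sets M" if "A \<in> E" for A using that sE by auto
  define k where "k B x = indicator B x - M.prob B" for B x
  have kb: "bdd_meas M (k B)" if "B \<in> E" for B unfolding k_def using EM[OF that] by (intro bdd_meas_diff) auto
  have k1: "\<bar>k B x\<bar> \<le> 1" for B x
    using M.prob_le_1[of B] measure_nonneg[of M B] unfolding k_def by (auto simp: indicator_def)
  have k0: "(\<integral>x. k B x \<partial>M) = 0" if "B \<in> E" for B
  proof -
    have "(\<integral>x. k B x \<partial>M) = (\<integral>x. indicator B x \<partial>M) - (\<integral>x. M.prob B \<partial>M)"
      unfolding k_def by (intro Bochner_Integration.integral_diff M.bdd_meas_integrable) (auto intro: EM[OF that])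
    then show ?thesis using EM[OF that] by (simp add: M.integral_indicator_prob M.prob_space)
  qed
  have "AE p in \<nu> \<Otimes>\<^sub>M \<nu>. \<forall>A\<in>E. \<forall>B\<in>E. \<forall>C\<in>E.
      (\<integral>y. indicator A (X1 y) * k B (X2 y) * indicator C (X1 (W (fst p) (snd p) y)) \<partial>NN) = 0"
    unfolding AE_ball_countable[OF E(1)]
    by (intro ballI average_square_zero EM kb k1 k0)
  then show ?thesis
  proof eventually_elim
    case (elim p)
    define \<tau> where "\<tau> y = X1 (W (fst p) (snd p) y)" for y
    have \<tau>: "\<tau> \<in> NN \<rightarrow>\<^sub>M M" unfolding \<tau>_def by (rule measurable_compose[OF tens_mp(1) X1_mp(1)])
    have \<tau>d: "distr NN M \<tau> = M"
      using distr_distr[OF X1_mp(1) tens_mp(1), of "fst p" "snd p"] by (simp add: comp_def \<tau>_def[abs_def] tens_mp(2) X1_mp(2))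
    have b: "bdd_meas NN (\<lambda>y. g (\<tau> y))" if "bdd_meas M g" for g by (rule bdd_meas_comp[OF that \<tau>])
    note uniq = L1_functional_unique[OF M_prob spM E(2) sE E(3)]
    have base: "(\<integral>y. indicator A (X1 y) * k B (X2 y) * indicator C (\<tau> y) \<partial>NN) = 0" if "A \<in> E" "B \<in> E" "C \<in> E" for A B C
      using elim that unfolding \<tau>_def by blast
    have zero: "L1_functional M 0 (\<lambda>_. 0)" by (rule L1_functionalI) auto
    have 1: "(\<integral>y. f (X1 y) * k B (X2 y) * indicator C (\<tau> y) \<partial>NN) = 0" if f: "bdd_meas M f" and "B \<in> E" "C \<in> E" for f B C
    proof (rule uniq[where L="\<lambda>f. \<integral>y. f (X1 y) * k B (X2 y) * indicator C (\<tau> y) \<partial>NN" and L'="\<lambda>_. 0", OF _ zero base f])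
      have "\<bar>k B (X2 y) * indicator C (\<tau> y)\<bar> \<le> 1" for y using k1 by (simp add: indicator_def)
      moreover have "(\<lambda>y. k B (X2 y) * indicator C (\<tau> y)) \<in> borel_measurable NN"
        using that EM by (intro bdd_measD bdd_meas_mult bdd_X2 kb b) auto
      ultimately show "L1_functional M 1 (\<lambda>f. \<integral>y. f (X1 y) * k B (X2 y) * indicator C (\<tau> y) \<partial>NN)"
        using L1_functional_comp[OF NN_prob _ _ X1_mp, of "\<lambda>y. k B (X2 y) * indicator C (\<tau> y)" 1] by (simp add: mult_ac)
    qed (use that in auto)
    have 2: "(\<integral>y. f (X1 y) * k B (X2 y) * g (\<tau> y) \<partial>NN) = 0" if f: "bdd_meas M f" and g: "bdd_meas M g" and "B \<in> E" for f g B
    proof -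
      have fk: "bdd_meas NN (\<lambda>y. f (X1 y) * k B (X2 y))" by (intro bdd_meas_mult bdd_X1 f bdd_X2 kb that)
      obtain D where D: "\<And>y. \<bar>f (X1 y) * k B (X2 y)\<bar> \<le> D" using fk unfolding bdd_meas_def by blast
      show ?thesis
        by (rule uniq[where L="\<lambda>g. \<integral>y. f (X1 y) * k B (X2 y) * g (\<tau> y) \<partial>NN" and L'="\<lambda>_. 0", OF _ zero 1 g])
          (use L1_functional_comp[OF NN_prob bdd_measD[OF fk] D \<tau> \<tau>d] f that in auto)
    qed
    \<comment> \<open>Here the centring of \<open>k B\<close> is undone: its integral being 0 means
      that the mean of \<open>indicator B\<close> splits off, and uniqueness passes from
      \<open>indicator B\<close> to all \<open>h\<close>.\<close>
    have "indep_X2 (\<lambda>y. g (\<tau> y))" if g: "bdd_meas M g" for g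
    proof (rule indep_X2I)
      fix f h assume f: "bdd_meas M f" and h: "bdd_meas M h"
      have fg: "bdd_meas NN (\<lambda>y. f (X1 y) * g (\<tau> y))" by (intro bdd_meas_mult bdd_X1 f b g)
      obtain D where D: "\<And>y. \<bar>f (X1 y) * g (\<tau> y)\<bar> \<le> D" using fg unfolding bdd_meas_def by blast
      define c where "c = (\<integral>y. f (X1 y) * g (\<tau> y) \<partial>NN)"
      have "(\<integral>y. (f (X1 y) * g (\<tau> y)) * h (X2 y) \<partial>NN) = (\<integral>x. c * h x \<partial>M)"
      proof (rule uniq[where L="\<lambda>h. \<integral>y. (f (X1 y) * g (\<tau> y)) * h (X2 y) \<partial>NN" and L'="\<lambda>h. \<integral>x. c * h x \<partial>M", OF _ _ _ h])
        show "L1_functional M D (\<lambda>h. \<integral>y. (f (X1 y) * g (\<tau> y)) * h (X2 y) \<partial>NN)"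
          by (rule L1_functional_comp[OF NN_prob bdd_measD[OF fg] D X2_mp])
        show "L1_functional M \<bar>c\<bar> (\<lambda>h. \<integral>x. c * h x \<partial>M)"
          by (rule L1_functional_mult[OF M_prob]) auto
        fix B assume B: "B \<in> E"
        have "0 = (\<integral>y. f (X1 y) * k B (X2 y) * g (\<tau> y) \<partial>NN)" using 2[OF f g B] by simp
        also have "\<dots> = (\<integral>y. (f (X1 y) * g (\<tau> y)) * indicator B (X2 y) - (f (X1 y) * g (\<tau> y)) * M.prob B \<partial>NN)"
          by (intro Bochner_Integration.integral_cong) (auto simp: k_def algebra_simps)
        also have "\<dots> = (\<integral>y. (f (X1 y) * g (\<tau> y)) * indicator B (X2 y) \<partial>NN) - (\<integral>y. (f (X1 y) * g (\<tau> y)) * M.prob B \<partial>NN)"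
          by (intro Bochner_Integration.integral_diff NN.P.bdd_meas_integrable bdd_meas_mult bdd_X1 f b g bdd_X2 bdd_meas_indicator EM B bdd_meas_const)
        finally show "(\<integral>y. (f (X1 y) * g (\<tau> y)) * indicator B (X2 y) \<partial>NN) = (\<integral>x. c * indicator B x \<partial>M)"
          using EM[OF B] by (simp add: c_def M.integral_indicator_prob)
      qed
      then show "(\<integral>y. f (X1 y) * h (X2 y) * g (\<tau> y) \<partial>NN) = (\<integral>x. h x \<partial>M) * (\<integral>y. f (X1 y) * g (\<tau> y) \<partial>NN)"
        by (simp add: c_def mult_ac)
    qed
    from indep_X2_function[OF \<tau> sM this] show ?case unfolding \<tau>_def .
  qed
qed

end

section \<open>The group of times that act as product maps\<close>

context tensor_square
begin

text \<open>An inverse of \<open>U\<close> is not at hand. Substituting \<open>W a b y\<close> for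
  \<open>y\<close> instead moves \<open>U\<close> and \<open>V\<close> onto the test functions,
  where independence of \<open>X1\<close> and \<open>X2\<close> factorises the integral; comparing a
  general \<open>h\<close> with \<open>h = 1\<close> gives the test.\<close>

lemma factor_uminus:
  assumes U: "U \<in> M \<rightarrow>\<^sub>M M" "AE y in NN. X1 (W a b y) = U (X1 y)"
    and V: "V \<in> M \<rightarrow>\<^sub>M M" "AE y in NN. X2 (W a b y) = V (X2 y)"
  shows "\<exists>U'\<in>M \<rightarrow>\<^sub>M M. AE y in NN. X1 (W (- a) (- b) y) = U' (X1 y)"
proof (rule indep_X2_function[OF measurable_compose[OF tens_mp(1) X1_mp(1)] sM], rule indep_X2I)
  fix g f k assume g: "bdd_meas M g" and f: "bdd_meas M f" and k: "bdd_meas M k"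
  have inv: "W (- a) (- b) (W a b y) = y" for y
    using tens_add[of "-a" a "-b" b y] by (simp add: tens_0)
  have fU: "bdd_meas M (\<lambda>x. f (U x))" by (rule bdd_meas_comp[OF f U(1)])
  have kV: "bdd_meas M (\<lambda>x. k (V x))" by (rule bdd_meas_comp[OF k V(1)])
  have gW: "bdd_meas NN (\<lambda>y. g (X1 (W (- a) (- b) y)))" by (rule bdd_W[OF bdd_X1[OF g]])
  have kint: "(\<integral>x. k (V x) \<partial>M) = (\<integral>x. k x \<partial>M)"
  proof -
    have "(\<integral>x. k (V x) \<partial>M) = (\<integral>y. k (V (X2 y)) \<partial>NN)" by (rule integral_X2[OF kV, symmetric])
    also have "\<dots> = (\<integral>y. k (X2 (W a b y)) \<partial>NN)"
    proof (rule integral_cong_AE)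
      show "AE y in NN. k (V (X2 y)) = k (X2 (W a b y))" using V(2) by eventually_elim simp
    qed (intro bdd_measD bdd_X2[OF kV] bdd_W[OF bdd_X2[OF k]])+
    also have "\<dots> = (\<integral>y. k (X2 y) \<partial>NN)"
      by (rule NN.P.integral_distr_eq[OF tens_mp bdd_measD[OF bdd_X2[OF k]]])
    finally show ?thesis by (simp add: integral_X2[OF k])
  qed
  have key: "(\<integral>y. f (X1 y) * h (X2 y) * g (X1 (W (- a) (- b) y)) \<partial>NN)
      = (\<integral>x. f (U x) * g x \<partial>M) * (\<integral>x. h (V x) \<partial>M)" if h: "bdd_meas M h" for h
  proof -
    have hV: "bdd_meas M (\<lambda>x. h (V x))" by (rule bdd_meas_comp[OF h V(1)])
    have "(\<integral>y. f (X1 y) * h (X2 y) * g (X1 (W (- a) (- b) y)) \<partial>NN)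
      = (\<integral>y. (\<lambda>y. f (X1 y) * h (X2 y) * g (X1 (W (- a) (- b) y))) (W a b y) \<partial>NN)"
      by (rule NN.P.integral_distr_eq[OF tens_mp, symmetric]) (intro bdd_measD bdd_meas_mult bdd_X1[OF f] bdd_X2[OF h] gW)
    also have "\<dots> = (\<integral>y. (f (U (X1 y)) * g (X1 y)) * h (V (X2 y)) \<partial>NN)"
    proof (rule integral_cong_AE)
      show "AE y in NN. (\<lambda>y. f (X1 y) * h (X2 y) * g (X1 (W (- a) (- b) y))) (W a b y)
        = (f (U (X1 y)) * g (X1 y)) * h (V (X2 y))"
        using U(2) V(2) by eventually_elim (simp add: inv)
      show "(\<lambda>y. (\<lambda>y. f (X1 y) * h (X2 y) * g (X1 (W (- a) (- b) y))) (W a b y)) \<in> borel_measurable NN"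
        by (intro bdd_measD bdd_W[OF bdd_meas_mult[OF bdd_meas_mult[OF bdd_X1[OF f] bdd_X2[OF h]] gW]])
    qed (intro bdd_measD bdd_meas_mult bdd_X1[OF fU] bdd_X1[OF g] bdd_X2[OF hV])
    also have "\<dots> = (\<integral>x. f (U x) * g x \<partial>M) * (\<integral>x. h (V x) \<partial>M)"
      by (rule X1_X2_independent[OF bdd_meas_mult[OF fU g] hV])
    finally show ?thesis .
  qed
  show "(\<integral>y. f (X1 y) * k (X2 y) * g (X1 (W (- a) (- b) y)) \<partial>NN)
      = (\<integral>x. k x \<partial>M) * (\<integral>y. f (X1 y) * g (X1 (W (- a) (- b) y)) \<partial>NN)"
    using key[OF k] key[OF bdd_meas_const[of M 1]] kint by (simp add: M.prob_space)
qed

text \<open>Both sides of the test \<open>indep_X2\<close> are correlations for the flow on the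
  first coordinate, hence continuous in the time.\<close>

lemma factor_closed:
  assumes c: "c \<longlonglongrightarrow> c0" and U: "\<And>n. \<exists>U\<in>M \<rightarrow>\<^sub>M M. AE y in NN. X1 (W (c n) 0 y) = U (X1 y)"
  shows "\<exists>U\<in>M \<rightarrow>\<^sub>M M. AE y in NN. X1 (W c0 0 y) = U (X1 y)"
proof (rule indep_X2_function[OF measurable_compose[OF tens_mp(1) X1_mp(1)] sM], rule indep_X2I)
  fix g f k assume g: "bdd_meas M g" and f: "bdd_meas M f" and k: "bdd_meas M k"
  have "(\<integral>y. f (X1 y) * k (X2 y) * g (X1 (W (c n) 0 y)) \<partial>NN)
      = (\<integral>x. k x \<partial>M) * (\<integral>y. f (X1 y) * g (X1 (W (c n) 0 y)) \<partial>NN)" for n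
  proof -
    obtain V where V: "V \<in> M \<rightarrow>\<^sub>M M" "AE y in NN. X1 (W (c n) 0 y) = V (X1 y)" using U by blast
    show ?thesis
      by (rule indep_X2D[OF function_indep_X2[OF measurable_compose[OF tens_mp(1) X1_mp(1)] V g] f k])
  qed
  moreover have "(\<lambda>n. \<integral>y. f (X1 y) * k (X2 y) * g (X1 (W (c n) 0 y)) \<partial>NN)
      \<longlonglongrightarrow> (\<integral>y. f (X1 y) * k (X2 y) * g (X1 (W c0 0 y)) \<partial>NN)"
    by (rule mp_flow_correlation_continuous[OF tens_flow bdd_X1[OF g] bdd_meas_mult[OF bdd_X1[OF f] bdd_X2[OF k]] c])
  moreover have "(\<lambda>n. (\<integral>x. k x \<partial>M) * (\<integral>y. f (X1 y) * g (X1 (W (c n) 0 y)) \<partial>NN))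
      \<longlonglongrightarrow> (\<integral>x. k x \<partial>M) * (\<integral>y. f (X1 y) * g (X1 (W c0 0 y)) \<partial>NN)"
    by (intro tendsto_mult_left mp_flow_correlation_continuous[OF tens_flow bdd_X1[OF g] bdd_X1[OF f] c])
  ultimately show "(\<integral>y. f (X1 y) * k (X2 y) * g (X1 (W c0 0 y)) \<partial>NN)
      = (\<integral>x. k x \<partial>M) * (\<integral>y. f (X1 y) * g (X1 (W c0 0 y)) \<partial>NN)"
    by (simp add: LIMSEQ_unique)
qed

text \<open>The two halves are kept together because the inverse in one coordinate uses the map of
  the other.\<close>

definition product_map :: "real \<Rightarrow> real \<Rightarrow> bool" where
  "product_map a b \<longleftrightarrow> (\<exists>U\<in>M \<rightarrow>\<^sub>M M. AE y in NN. X1 (W a b y) = U (X1 y))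
    \<and> (\<exists>V\<in>M \<rightarrow>\<^sub>M M. AE y in NN. X2 (W a b y) = V (X2 y))"

lemma AE_product_map: "AE p in \<nu> \<Otimes>\<^sub>M \<nu>. product_map (fst p) (snd p)"
  using AE_X1_factor tensor_square.AE_X1_factor[OF swap_X]
  by eventually_elim (simp add: product_map_def)

lemma product_map_add:
  assumes "product_map a b" "product_map a' b'" shows "product_map (a + a') (b + b')"
proof -
  from assms obtain U V U' V' where m: "U \<in> M \<rightarrow>\<^sub>M M" "V \<in> M \<rightarrow>\<^sub>M M" "U' \<in> M \<rightarrow>\<^sub>M M" "V' \<in> M \<rightarrow>\<^sub>M M"
    and U: "AE y in NN. X1 (W a b y) = U (X1 y)" and V: "AE y in NN. X2 (W a b y) = V (X2 y)"
    and U': "AE y in NN. X1 (W a' b' y) = U' (X1 y)" and V': "AE y in NN. X2 (W a' b' y) = V' (X2 y)"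
    unfolding product_map_def by blast
  have "AE y in NN. X1 (W (a + a') (b + b') y) = U (U' (X1 y))"
    using AE_distr_eq[OF tens_mp U, of a' b'] U' by eventually_elim (simp add: tens_add)
  moreover have "AE y in NN. X2 (W (a + a') (b + b') y) = V (V' (X2 y))"
    using AE_distr_eq[OF tens_mp V, of a' b'] V' by eventually_elim (simp add: tens_add)
  ultimately show ?thesis
    unfolding product_map_def using measurable_compose[OF m(3,1)] measurable_compose[OF m(4,2)]
    by (intro conjI bexI[of _ "\<lambda>x. U (U' x)"] bexI[of _ "\<lambda>x. V (V' x)"])
qed

lemma product_map_uminus:
  assumes "product_map a b" shows "product_map (- a) (- b)"
proof -
  from assms obtain U V where U: "U \<in> M \<rightarrow>\<^sub>M M" "AE y in NN. X1 (W a b y) = U (X1 y)"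
    and V: "V \<in> M \<rightarrow>\<^sub>M M" "AE y in NN. X2 (W a b y) = V (X2 y)"
    unfolding product_map_def by blast
  show ?thesis
    unfolding product_map_def
    using factor_uminus[OF U V] tensor_square.factor_uminus[OF swap_X, of V a b U] U V by simp
qed

lemma product_map_closed:
  assumes "c \<longlonglongrightarrow> c0" "\<And>n. product_map (c n) 0" shows "product_map c0 0"
  using assms factor_closed[of c c0] tensor_square.factor_closed[OF swap_X, of c c0]
  unfolding product_map_def by simp

lemma product_map_multiple:
  assumes "product_map c 0" shows "product_map (of_int m * c) 0"
proof -
  have nat: "product_map (real n * c) 0" for n
  proof (induction n)
    case 0
    have "(\<lambda>x. x) \<in> M \<rightarrow>\<^sub>M M" by simp
    then show ?case unfolding product_map_def by (auto simp: tens_0 intro!: bexI[of _ "\<lambda>x. x"])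
  next
    case (Suc n)
    from product_map_add[OF Suc assms] show ?case by (simp add: algebra_simps)
  qed
  show ?thesis
  proof (cases "m \<ge> 0")
    case True
    then show ?thesis using nat[of "nat m"] by simp
  next
    case False
    then show ?thesis using product_map_uminus[OF nat[of "nat (- m)"]] by simp
  qed
qed

text \<open>The times \<open>c\<close> for which \<open>T c \<times> id\<close> is a product map form a closed subgroup; it is not discrete because \<open>\<nu>\<close> is
  carried by one of its cosets.\<close>

lemma product_map_all: "product_map c 0"
proof -
  interpret \<nu>: prob_space \<nu> by (rule nu(1))
  interpret \<nu>\<nu>: pair_prob_space \<nu> \<nu> ..
  have spn: "space \<nu> = UNIV" using sets_eq_imp_space_eq[OF nu(2)] by simp
  have "AE p in \<nu> \<Otimes>\<^sub>M \<nu>. product_map (snd p) (fst p)"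
    using AE_distr_eq[OF swap_measure_preserving[OF nu(1) nu(1)] AE_product_map] by simp
  from \<nu>\<nu>.AE_pair[OF this] obtain b where b: "AE a in \<nu>. product_map a b"
    using \<nu>.AE_ex by fastforce
  \<comment> \<open>With \<open>b\<close> fixed, subtracting two members of \<open>D\<close> cancels
    the second time and leaves a product map \<open>(a - a', 0)\<close>.\<close>
  define D where "D = {a. product_map a b}"
  have unc: "uncountable D"
  proof
    assume "countable D"
    then have "emeasure \<nu> D = (\<integral>\<^sup>+a. emeasure \<nu> {a} \<partial>count_space D)"
      by (intro emeasure_countable_singleton) (auto simp: nu(2))
    then have "D \<in> null_sets \<nu>" using \<open>countable D\<close> nu(2,3)
      by (auto simp: null_sets_def sets.countable)
    then have "AE a in \<nu>. a \<notin> D" by (rule AE_not_in)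
    with b have "AE a in \<nu>. False" by eventually_elim (simp add: D_def)
    then show False using \<nu>.AE_False by blast
  qed
  have small: "\<exists>d. d \<noteq> 0 \<and> \<bar>d\<bar> < e \<and> product_map d 0" if e: "e > 0" for e
  proof -
    \<comment> \<open>Pigeonhole: an uncountable set has two points in one of the countably many
      cells of length \<open>e\<close>.\<close>
    have "\<not> inj_on (\<lambda>a. \<lfloor>a / e\<rfloor>) D"
      using unc countable_image_inj_on[of "\<lambda>a. \<lfloor>a / e\<rfloor>" D] by auto
    then obtain a a' where a: "a \<in> D" "a' \<in> D" "\<lfloor>a / e\<rfloor> = \<lfloor>a' / e\<rfloor>" "a \<noteq> a'" unfolding inj_on_def by blast
    have "\<bar>a / e - a' / e\<bar> < 1" using a(3) by linarith
    then have "\<bar>a - a'\<bar> < e" using e by (simp add: field_simps abs_if split: if_splits)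
    moreover have "product_map (a + - a') (b + - b)"
      using a(1,2) by (intro product_map_add product_map_uminus) (auto simp: D_def)
    ultimately show ?thesis using a(4) by (intro exI[of _ "a - a'"]) simp
  qed
  have "\<exists>d. \<bar>d - c\<bar> < e \<and> product_map d 0" if e: "e > 0" for e
  proof -
    obtain d where d: "d \<noteq> 0" "\<bar>d\<bar> < e" "product_map d 0" using small[OF e] by blast
    \<comment> \<open>The integer multiples of \<open>d\<close> form an \<open>e\<close>-dense set
      of product times, so \<open>c\<close> is a limit of them.\<close>
    have "\<bar>of_int \<lfloor>c / d\<rfloor> - c / d\<bar> \<le> 1" by linarith
    then have "\<bar>d\<bar> * \<bar>of_int \<lfloor>c / d\<rfloor> - c / d\<bar> \<le> \<bar>d\<bar>" by (simp add: mult_left_le)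
    moreover have "of_int \<lfloor>c / d\<rfloor> * d - c = d * (of_int \<lfloor>c / d\<rfloor> - c / d)"
      using d(1) by (simp add: right_diff_distrib mult.commute)
    ultimately have "\<bar>of_int \<lfloor>c / d\<rfloor> * d - c\<bar> \<le> \<bar>d\<bar>" by (simp only: abs_mult)
    then show ?thesis using d(2) product_map_multiple[OF d(3), of "\<lfloor>c / d\<rfloor>"] by (intro exI[of _ "of_int \<lfloor>c / d\<rfloor> * d"]) simp
  qed
  then have "\<exists>d. \<bar>d - c\<bar> < inverse (real (Suc n)) \<and> product_map d 0" for n by simp
  then obtain d where d: "\<And>n. \<bar>d n - c\<bar> < inverse (real (Suc n))" "\<And>n. product_map (d n) 0" by metis
  have "(\<lambda>n. d n - c) \<longlonglongrightarrow> 0"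
    by (rule Lim_null_comparison[OF _ LIMSEQ_inverse_real_of_nat])
      (unfold real_norm_def, intro always_eventually allI less_imp_le d(1))
  then have "d \<longlonglongrightarrow> c" by (rule LIM_zero_cancel)
  then show ?thesis using d(2) by (rule product_map_closed)
qed

subsection \<open>Conditioning on the second coordinate\<close>

definition cexp :: "('b \<times> 'b \<Rightarrow> real) \<Rightarrow> 'b \<Rightarrow> real" where
  "cexp h y = (\<integral>y'. h (y', y) \<partial>N)"

lemma cexp_bdd:
  assumes h: "bdd_meas NN h" shows "bdd_meas N (cexp h)"
proof -
  obtain C where C: "\<And>y. \<bar>h y\<bar> \<le> C" using h unfolding bdd_meas_def by blast
  have "bdd_meas NN (\<lambda>z. h (prod.swap z))"
    by (rule bdd_meas_comp[OF h swap_measure_preserving(1)[OF N_prob N_prob]])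
  then have "(\<lambda>(y, y'). h (y', y)) \<in> borel_measurable NN" by (simp add: bdd_measD prod.swap_def case_prod_beta')
  then show ?thesis unfolding cexp_def using C by (rule N.bdd_meas_integral)
qed

lemma cexp_limit:
  "bdd_meas NN k \<Longrightarrow> bdd_meas NN h \<Longrightarrow>
    (\<lambda>n. \<integral>y. k y * h (W (r n) 0 y) \<partial>NN) \<longlonglongrightarrow> (\<integral>y. k y * cexp h (snd y) \<partial>NN)"
  unfolding cexp_def by (rule tensor_conditional[OF mix])

lemma bdd_cexp_snd: "bdd_meas NN h \<Longrightarrow> bdd_meas NN (\<lambda>y. cexp h (snd y))"
  using bdd_meas_comp[OF cexp_bdd measurable_snd] .

text \<open>The conditional expectation is the weak limit of the product maps
  \<open>W (r n) 0\<close>, and the test \<open>indep_X2\<close> survives this limit. Hence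
  projecting a function of \<open>X1\<close> on the second coordinate yields again a function of
  \<open>X1\<close>.\<close>

lemma cexp_X1:
  assumes g: "bdd_meas M g"
  shows "\<exists>w. bdd_meas M w \<and> (AE y in NN. cexp (\<lambda>y. g (X1 y)) (snd y) = w (X1 y))"
proof (rule indep_X2_bdd[OF bdd_cexp_snd[OF bdd_X1[OF g]]], rule indep_X2I)
  fix f k assume f: "bdd_meas M f" and k: "bdd_meas M k"
  have "(\<integral>y. f (X1 y) * k (X2 y) * g (X1 (W (r n) 0 y)) \<partial>NN)
      = (\<integral>x. k x \<partial>M) * (\<integral>y. f (X1 y) * g (X1 (W (r n) 0 y)) \<partial>NN)" for n
  proof -
    obtain V where V: "V \<in> M \<rightarrow>\<^sub>M M" "AE y in NN. X1 (W (r n) 0 y) = V (X1 y)"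
      using product_map_all[of "r n"] unfolding product_map_def by blast
    show ?thesis
      by (rule indep_X2D[OF function_indep_X2[OF measurable_compose[OF tens_mp(1) X1_mp(1)] V g] f k])
  qed
  moreover have "(\<lambda>n. \<integral>y. f (X1 y) * k (X2 y) * g (X1 (W (r n) 0 y)) \<partial>NN)
      \<longlonglongrightarrow> (\<integral>y. f (X1 y) * k (X2 y) * cexp (\<lambda>y. g (X1 y)) (snd y) \<partial>NN)"
    by (rule cexp_limit[OF bdd_meas_mult[OF bdd_X1[OF f] bdd_X2[OF k]] bdd_X1[OF g]])
  moreover have "(\<lambda>n. (\<integral>x. k x \<partial>M) * (\<integral>y. f (X1 y) * g (X1 (W (r n) 0 y)) \<partial>NN))
      \<longlonglongrightarrow> (\<integral>x. k x \<partial>M) * (\<integral>y. f (X1 y) * cexp (\<lambda>y. g (X1 y)) (snd y) \<partial>NN)"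
    by (intro tendsto_mult_left cexp_limit bdd_X1 f g)
  ultimately show "(\<integral>y. f (X1 y) * k (X2 y) * cexp (\<lambda>y. g (X1 y)) (snd y) \<partial>NN)
      = (\<integral>x. k x \<partial>M) * (\<integral>y. f (X1 y) * cexp (\<lambda>y. g (X1 y)) (snd y) \<partial>NN)"
    by (simp add: LIMSEQ_unique)
qed

text \<open>If \<open>X1\<close> is independent of the second coordinate, then the projection on functions of the second coordinate,
  being a limit of product maps, takes values in functions of \<open>X2\<close>.\<close>

lemma snd_function_of_X2:
  assumes triv: "\<And>A. A \<in> sets M \<Longrightarrow> AE y in NN. cexp (\<lambda>y. indicator A (X1 y)) (snd y) = M.prob A"
  shows "\<exists>\<phi>\<in>M \<rightarrow>\<^sub>M N. AE y in NN. snd y = \<phi> (X2 y)"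
proof -
  have core: "(\<integral>y. f (X2 y) * g (snd y) * indicator A (X1 y) \<partial>NN) = M.prob A * (\<integral>y. f (X2 y) * g (snd y) \<partial>NN)"
    if f: "bdd_meas M f" and g: "bdd_meas N g" and A: "A \<in> sets M" for f g A
  proof -
    define u where "u x = indicator A x - M.prob A" for x
    have ind: "bdd_meas M (indicator A)" using A by auto
    have u: "bdd_meas M u" unfolding u_def by (intro bdd_meas_diff ind bdd_meas_const)
    have u1: "\<bar>u x\<bar> \<le> 1" for x
      using M.prob_le_1[of A] measure_nonneg[of M A] unfolding u_def by (auto simp: indicator_def)
    obtain D where D: "0 < D" "\<And>x. \<bar>f x\<bar> \<le> D" using bdd_meas_bound[OF f] by blast
    have gs: "bdd_meas NN (\<lambda>y. g (snd y))" by (rule bdd_meas_comp[OF g measurable_snd])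
    have cu: "AE y in NN. cexp (\<lambda>y. u (X1 y)) (snd y) = 0"
    proof -
      have "cexp (\<lambda>y. u (X1 y)) z = cexp (\<lambda>y. indicator A (X1 y)) z - M.prob A" for z
      proof -
        have "bdd_meas N (\<lambda>y'. indicator A (X1 (y', z)) :: real)"
          using bdd_meas_comp[OF bdd_X1[OF ind], of "\<lambda>y'. (y', z)" N] spN by simp
        from N.bdd_meas_integrable[OF this] show ?thesis
          unfolding cexp_def u_def by (simp add: N.prob_space)
      qed
      with triv[OF A] show ?thesis by (auto elim: eventually_mono)
    qed
    \<comment> \<open>Read on \<open>MM\<close>, the function \<open>g (snd y)\<close> can be
      approximated by rectangles in \<open>X1\<close> and \<open>X2\<close>, on which the product
      maps factorise.\<close>
    define H where "H x = g (snd (\<Phi> x))" for x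
    have Hb: "bdd_meas MM H" unfolding H_def using bdd_meas_comp[OF gs Phi_mp(1)] .
    define K where "K n y = u (X1 (W (r n) 0 y)) * f (X2 (W (r n) 0 y))" for n y
    have Kb: "bdd_meas NN (K n)" for n
      unfolding K_def by (intro bdd_meas_mult bdd_W[OF bdd_X1[OF u]] bdd_W[OF bdd_X2[OF f]])
    have KD: "\<bar>K n y\<bar> \<le> D" for n y
      unfolding K_def abs_mult using mult_mono[OF u1 D(2)] by simp
    have "(\<lambda>n. \<integral>y. K n y * H (\<Psi> y) \<partial>NN) \<longlonglongrightarrow> 0"
    proof (rule L1_functional_limit[OF MM_prob rectangles_generate(4,1,2,3)[OF spM spM],
          where L="\<lambda>n H. \<integral>y. K n y * H (\<Psi> y) \<partial>NN" and L'="\<lambda>_. 0" and C=D, OF _ _ _ Hb])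
      show "L1_functional MM D (\<lambda>H. \<integral>y. K n y * H (\<Psi> y) \<partial>NN)" for n
        by (rule L1_functional_comp[OF NN_prob bdd_measD[OF Kb] KD Psi_mp])
      show "L1_functional MM D (\<lambda>_. 0)"
        using D(1) by (intro L1_functionalI) (auto intro!: mult_nonneg_nonneg integral_nonneg_AE)
      fix R assume "R \<in> {A \<times> B |A B. A \<in> sets M \<and> B \<in> sets M}"
      then obtain A' B' where R: "R = A' \<times> B'" "A' \<in> sets M" "B' \<in> sets M" by auto
      then have A'b: "bdd_meas M (indicator A')" and B'b: "bdd_meas M (indicator B')" by auto
      \<comment> \<open>On a rectangle the integral becomes \<open>p n * q n\<close>:
        \<open>p\<close> tends to 0 because the projection of \<open>u (X1 y)\<close> vanishes,
        while \<open>q\<close> stays bounded by \<open>D\<close>.\<close>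
      define p where "p n = (\<integral>y. indicator A' (X1 y) * u (X1 (W (r n) 0 y)) \<partial>NN)" for n
      define q where "q n = (\<integral>y. indicator B' (X2 y) * f (X2 (W (r n) 0 y)) \<partial>NN)" for n
      have p: "p \<longlonglongrightarrow> 0"
      proof -
        have "p \<longlonglongrightarrow> (\<integral>y. indicator A' (X1 y) * cexp (\<lambda>y. u (X1 y)) (snd y) \<partial>NN)"
          unfolding p_def by (rule cexp_limit[OF bdd_X1[OF A'b] bdd_X1[OF u]])
        also have "(\<integral>y. indicator A' (X1 y) * cexp (\<lambda>y. u (X1 y)) (snd y) \<partial>NN) = 0"
          by (rule integral_eq_zero_AE) (use cu in \<open>eventually_elim, simp\<close>)
        finally show ?thesis .
      qed
      have q: "\<bar>q n\<bar> \<le> D" for n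
        unfolding q_def by (rule NN.P.abs_integral_le_const) (use D in \<open>auto simp: indicator_def less_imp_le\<close>)
      have "(\<integral>y. K n y * indicator R (\<Psi> y) \<partial>NN) = p n * q n" for n
      proof -
        obtain U V where U: "U \<in> M \<rightarrow>\<^sub>M M" "AE y in NN. X1 (W (r n) 0 y) = U (X1 y)"
          and V: "V \<in> M \<rightarrow>\<^sub>M M" "AE y in NN. X2 (W (r n) 0 y) = V (X2 y)"
          using product_map_all[of "r n"] unfolding product_map_def by blast
        have b1: "bdd_meas M (\<lambda>x. indicator A' x * u (U x))" by (intro bdd_meas_mult A'b bdd_meas_comp[OF u U(1)])
        have b2: "bdd_meas M (\<lambda>x. indicator B' x * f (V x))" by (intro bdd_meas_mult B'b bdd_meas_comp[OF f V(1)])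
        have "(\<integral>y. K n y * indicator R (\<Psi> y) \<partial>NN)
          = (\<integral>y. (\<lambda>x. indicator A' x * u (U x)) (X1 y) * (\<lambda>x. indicator B' x * f (V x)) (X2 y) \<partial>NN)"
        proof (rule integral_cong_AE)
          show "AE y in NN. K n y * indicator R (\<Psi> y)
            = (\<lambda>x. indicator A' x * u (U x)) (X1 y) * (\<lambda>x. indicator B' x * f (V x)) (X2 y)"
            using U(2) V(2)
          proof eventually_elim
            case (elim y)
            have "indicator R (\<Psi> y) = (indicator A' (X1 y) * indicator B' (X2 y) :: real)"
              unfolding R by (cases "\<Psi> y") (simp add: indicator_times)
            with elim show ?case by (simp add: K_def)
          qed
          have "R \<in> sets MM" using R by auto
          then show "(\<lambda>y. K n y * indicator R (\<Psi> y)) \<in> borel_measurable NN"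
            by (intro bdd_measD bdd_meas_mult Kb bdd_meas_comp[OF bdd_meas_indicator Psi_mp(1)])
        qed (intro bdd_measD bdd_meas_mult[OF bdd_X1[OF b1] bdd_X2[OF b2]])
        also have "\<dots> = (\<integral>x. indicator A' x * u (U x) \<partial>M) * (\<integral>x. indicator B' x * f (V x) \<partial>M)"
          by (rule X1_X2_independent[OF b1 b2])
        also have "(\<integral>x. indicator A' x * u (U x) \<partial>M) = p n"
          unfolding p_def integral_X1[OF b1, symmetric]
        proof (rule integral_cong_AE)
          show "AE y in NN. indicator A' (X1 y) * u (U (X1 y)) = indicator A' (X1 y) * u (X1 (W (r n) 0 y))"
            using U(2) by eventually_elim simp
        qed (intro bdd_measD bdd_X1[OF b1] bdd_meas_mult bdd_X1[OF A'b] bdd_W[OF bdd_X1[OF u]])+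
        also have "(\<integral>x. indicator B' x * f (V x) \<partial>M) = q n"
          unfolding q_def integral_X2[OF b2, symmetric]
        proof (rule integral_cong_AE)
          show "AE y in NN. indicator B' (X2 y) * f (V (X2 y)) = indicator B' (X2 y) * f (X2 (W (r n) 0 y))"
            using V(2) by eventually_elim simp
        qed (intro bdd_measD bdd_X2[OF b2] bdd_meas_mult bdd_X2[OF B'b] bdd_W[OF bdd_X2[OF f]])+
        finally show ?thesis .
      qed
      moreover have "(\<lambda>n. p n * q n) \<longlonglongrightarrow> 0"
      proof (rule Lim_null_comparison)
        have "(\<lambda>n. \<bar>p n\<bar> * D) \<longlonglongrightarrow> 0 * D" by (intro tendsto_mult_right tendsto_rabs_zero p)
        then show "(\<lambda>n. \<bar>p n\<bar> * D) \<longlonglongrightarrow> 0" by simp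
        show "\<forall>\<^sub>F n in sequentially. norm (p n * q n) \<le> \<bar>p n\<bar> * D"
          using q by (intro always_eventually allI) (simp add: abs_mult mult_left_mono)
      qed
      ultimately show "(\<lambda>n. \<integral>y. K n y * indicator R (\<Psi> y) \<partial>NN) \<longlonglongrightarrow> 0" by simp
    qed
    \<comment> \<open>The second coordinate is fixed by \<open>W (r n) 0\<close>, so by invariance
      the integral is the same for all \<open>n\<close>; since it tends to 0, it is 0.\<close>
    moreover have "(\<integral>y. K n y * H (\<Psi> y) \<partial>NN) = (\<integral>y. f (X2 y) * g (snd y) * u (X1 y) \<partial>NN)" for n
    proof -
      have "(\<integral>y. K n y * H (\<Psi> y) \<partial>NN) = (\<integral>y. (\<lambda>y. f (X2 y) * g (snd y) * u (X1 y)) (W (r n) 0 y) \<partial>NN)"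
      proof (rule integral_cong_AE)
        show "AE y in NN. K n y * H (\<Psi> y) = (\<lambda>y. f (X2 y) * g (snd y) * u (X1 y)) (W (r n) 0 y)"
          using Phi_Psi by eventually_elim (simp add: K_def H_def tens_def T_0)
        show "(\<lambda>y. (\<lambda>y. f (X2 y) * g (snd y) * u (X1 y)) (W (r n) 0 y)) \<in> borel_measurable NN"
          by (intro bdd_measD bdd_W[OF bdd_meas_mult[OF bdd_meas_mult[OF bdd_X2[OF f] gs] bdd_X1[OF u]]])
      qed (intro bdd_measD bdd_meas_mult Kb bdd_meas_comp[OF Hb Psi_mp(1)])
      also have "\<dots> = (\<integral>y. f (X2 y) * g (snd y) * u (X1 y) \<partial>NN)"
        by (rule NN.P.integral_distr_eq[OF tens_mp]) (intro bdd_measD bdd_meas_mult bdd_X2[OF f] gs bdd_X1[OF u])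
      finally show ?thesis .
    qed
    ultimately have "(\<integral>y. f (X2 y) * g (snd y) * u (X1 y) \<partial>NN) = 0" by (simp add: LIMSEQ_const_iff)
    moreover have "(\<integral>y. f (X2 y) * g (snd y) * u (X1 y) \<partial>NN)
      = (\<integral>y. f (X2 y) * g (snd y) * indicator A (X1 y) \<partial>NN) - (\<integral>y. f (X2 y) * g (snd y) * M.prob A \<partial>NN)"
      unfolding u_def right_diff_distrib
      by (intro Bochner_Integration.integral_diff NN.P.bdd_meas_integrable bdd_meas_mult bdd_X2[OF f] gs bdd_X1[OF ind] bdd_meas_const)
    ultimately show ?thesis by simp
  qed
  have full: "(\<integral>y. f (X2 y) * k (X1 y) * g (snd y) \<partial>NN) = (\<integral>x. k x \<partial>M) * (\<integral>y. f (X2 y) * g (snd y) \<partial>NN)"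
    if f: "bdd_meas M f" and k: "bdd_meas M k" and g: "bdd_meas N g" for f k g
  proof -
    have fg: "bdd_meas NN (\<lambda>y. f (X2 y) * g (snd y))"
      by (intro bdd_meas_mult bdd_X2 f bdd_meas_comp[OF g measurable_snd])
    obtain D where D: "\<And>y. \<bar>f (X2 y) * g (snd y)\<bar> \<le> D" using fg unfolding bdd_meas_def by blast
    define c where "c = (\<integral>y. f (X2 y) * g (snd y) \<partial>NN)"
    have "(\<integral>y. (f (X2 y) * g (snd y)) * k (X1 y) \<partial>NN) = (\<integral>x. c * k x \<partial>M)"
    proof (rule L1_functional_unique[OF M_prob spM, of "sets M",
          where L="\<lambda>k. \<integral>y. (f (X2 y) * g (snd y)) * k (X1 y) \<partial>NN" and L'="\<lambda>k. \<integral>x. c * k x \<partial>M", OF _ _ _ _ _ _ k])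
      show "L1_functional M D (\<lambda>k. \<integral>y. (f (X2 y) * g (snd y)) * k (X1 y) \<partial>NN)"
        by (rule L1_functional_comp[OF NN_prob bdd_measD[OF fg] D X1_mp])
      show "L1_functional M \<bar>c\<bar> (\<lambda>k. \<integral>x. c * k x \<partial>M)"
        by (rule L1_functional_mult[OF M_prob]) auto
      show "sets M = sigma_sets UNIV (sets M)" using sets.sigma_sets_eq[of M] spM by simp
      show "UNIV \<in> sets M" using sets.top[of M] spM by simp
      show "Int_stable (sets M)" by (auto simp: Int_stable_def)
      show "(\<integral>y. (f (X2 y) * g (snd y)) * indicator A (X1 y) \<partial>NN) = (\<integral>x. c * indicator A x \<partial>M)" if "A \<in> sets M" for A
        using core[OF f g that] that by (simp add: c_def M.integral_indicator_prob)
    qed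
    then show ?thesis by (simp add: c_def mult_ac)
  qed
  have "\<exists>\<phi>\<in>M \<rightarrow>\<^sub>M N. AE y in NN. snd y = \<phi> (fst (prod.swap (\<Psi> y)))"
    by (rule tensor_square.indep_X2_function[OF swap_X measurable_snd sN],
        rule tensor_square.indep_X2I[OF swap_X]) (simp add: full)
  then show ?thesis by simp
qed

end

section \<open>Functions uncorrelated with a fixed one\<close>

text \<open>The exponent \<open>2 ^ m\<close> competes with \<open>w ^ m\<close> through
  \<open>(2 * w) ^ m\<close>, which places the jump at 1/2. The point of the formula is that it uses
  only polynomials and a bounded limit, so it stays inside any algebra closed under such limits. At
  the jump it is the classical limit for \<open>exp (- 1)\<close>.\<close>

lemma threshold_limit:
  fixes w :: real
  assumes "0 \<le> w" "w \<le> 1"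
  shows "(\<lambda>m. (1 - w ^ m) ^ (2 ^ m)) \<longlonglongrightarrow> (if w < 1/2 then 1 else if w = 1/2 then exp (- 1) else 0)"
proof -
  have p: "0 \<le> w ^ m" "w ^ m \<le> 1" for m using assms by (auto intro: power_le_one)
  have pw: "2 ^ m * w ^ m = (2 * w) ^ m" for m by (simp add: power_mult_distrib)
  consider "w < 1/2" | "w = 1/2" | "w > 1/2" by linarith
  then show ?thesis
  proof cases
    case 1
    have lower: "1 - (2 * w) ^ m \<le> (1 - w ^ m) ^ (2 ^ m)" for m
    proof -
      have "1 + real (2 ^ m) * (- (w ^ m)) \<le> (1 + - (w ^ m)) ^ (2 ^ m)"
        using p[of m] by (intro Bernoulli_inequality) simp
      moreover have "1 + real (2 ^ m) * (- (w ^ m)) = 1 - (2 * w) ^ m" unfolding pw[symmetric] by simp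
      ultimately show ?thesis by simp
    qed
    have upper: "(1 - w ^ m) ^ (2 ^ m) \<le> 1" for m using p[of m] by (intro power_le_one) auto
    have "(\<lambda>m. 1 - (2 * w) ^ m) \<longlonglongrightarrow> 1 - 0"
      using 1 assms by (intro tendsto_diff tendsto_const LIMSEQ_power_zero) auto
    then have lim: "(\<lambda>m. 1 - (2 * w) ^ m) \<longlonglongrightarrow> 1" by simp
    have "(\<lambda>m. (1 - w ^ m) ^ (2 ^ m)) \<longlonglongrightarrow> 1"
      by (rule tendsto_sandwich[OF _ _ lim tendsto_const]) (intro always_eventually allI lower upper)+
    with 1 show ?thesis by simp
  next
    case 2
    have "filterlim (\<lambda>m::nat. (2::nat) ^ m) at_top sequentially"
      by (rule filterlim_subseq) (auto simp: strict_mono_def)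
    from filterlim_compose[OF tendsto_exp_limit_sequentially[of "-1"] this]
    have "(\<lambda>m. (1 + - 1 / real (2 ^ m)) ^ (2 ^ m)) \<longlonglongrightarrow> exp (- 1 :: real)" .
    moreover have "1 + - 1 / real (2 ^ m) = 1 - w ^ m" for m
      unfolding 2 by (simp add: power_one_over)
    ultimately have "(\<lambda>m. (1 - w ^ m) ^ (2 ^ m)) \<longlonglongrightarrow> exp (- 1)" by (simp only:)
    then show ?thesis unfolding 2 by simp
  next
    case 3
    have upper: "(1 - w ^ m) ^ (2 ^ m) \<le> exp (- ((2 * w) ^ m))" for m
    proof -
      have "(1 - w ^ m) ^ (2 ^ m) \<le> exp (- (w ^ m)) ^ (2 ^ m)"
        using p[of m] exp_ge_add_one_self[of "- (w ^ m)"] by (intro power_mono) auto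
      also have "\<dots> = exp (real (2 ^ m) * (- (w ^ m)))" by (rule exp_of_nat_mult[symmetric])
      also have "real (2 ^ m) * (- (w ^ m)) = - ((2 * w) ^ m)" unfolding pw[symmetric] by simp
      finally show ?thesis .
    qed
    have lim: "(\<lambda>m. exp (- ((2 * w) ^ m))) \<longlonglongrightarrow> 0"
    proof -
      have "filterlim (\<lambda>m. (2 * w) ^ m) at_top sequentially"
        using 3 by (intro filterlim_at_infinity_imp_filterlim_at_top[OF filterlim_realpow_sequentially_gt1]) auto
      then show ?thesis
        by (intro filterlim_compose[OF exp_at_bot] filterlim_compose[OF filterlim_uminus_at_bot_at_top])
    qed
    have lower: "0 \<le> (1 - w ^ m) ^ (2 ^ m)" for m using p[of m] by simp
    have "(\<lambda>m. (1 - w ^ m) ^ (2 ^ m)) \<longlonglongrightarrow> 0"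
      by (rule tendsto_sandwich[OF _ _ tendsto_const lim]) (intro always_eventually allI lower upper)+
    with 3 show ?thesis by simp
  qed
qed

text \<open>Later \<open>F\<close> consists of correlations of one factor and \<open>q\<close> is a
  correlation of the other. \<open>F_mult\<close> is weaker than closure under products, since
  mixing yields a product of correlations only as a bounded limit. It is what upgrades uncorrelated
  to independent.\<close>

locale uncorrelated_family =
  fixes \<nu> :: "real measure" and q :: "real \<Rightarrow> real" and F :: "(real \<Rightarrow> real) set"
  assumes nu: "prob_space \<nu>" "sets \<nu> = sets borel" and q: "bdd_meas \<nu> q"
    and F_bdd: "p \<in> F \<Longrightarrow> bdd_meas \<nu> p" and F_one: "(\<lambda>_. 1) \<in> F"
    and F_uncorrelated: "p \<in> F \<Longrightarrow> (\<integral>x. p x * q x \<partial>\<nu>) = (\<integral>x. p x \<partial>\<nu>) * (\<integral>x. q x \<partial>\<nu>)"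
    and F_mult: "p \<in> F \<Longrightarrow> p' \<in> F \<Longrightarrow>
      \<exists>s::nat \<Rightarrow> real \<Rightarrow> real. (\<forall>n. s n \<in> F) \<and> (\<exists>C. \<forall>n x. \<bar>s n x\<bar> \<le> C) \<and> (\<forall>x. (\<lambda>n. s n x) \<longlonglongrightarrow> p x * p' x)"
begin

sublocale nu: prob_space \<nu> by (rule nu(1))

definition F_module :: "(real \<Rightarrow> real) set" where
  "F_module = {G. bdd_meas \<nu> G \<and>
    (\<forall>p\<in>F. (\<integral>x. G x * p x * q x \<partial>\<nu>) = (\<integral>x. G x * p x \<partial>\<nu>) * (\<integral>x. q x \<partial>\<nu>))}"

text \<open>Products of members of \<open>F\<close> are only limits of members of \<open>F\<close>; passing to the multipliers of \<open>F_module\<close>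
  gives an algebra that contains \<open>F\<close> and is closed under bounded limits.\<close>

definition multipliers :: "(real \<Rightarrow> real) set" where
  "multipliers = {G. bdd_meas \<nu> G \<and> (\<forall>H\<in>F_module. (\<lambda>x. G x * H x) \<in> F_module)}"

lemma F_moduleI:
  assumes "bdd_meas \<nu> G" "\<And>p. p \<in> F \<Longrightarrow> (\<integral>x. G x * p x * q x \<partial>\<nu>) = (\<integral>x. G x * p x \<partial>\<nu>) * (\<integral>x. q x \<partial>\<nu>)"
  shows "G \<in> F_module"
  using assms unfolding F_module_def by blast

lemma F_moduleD:
  assumes "G \<in> F_module"
  shows "bdd_meas \<nu> G" "p \<in> F \<Longrightarrow> (\<integral>x. G x * p x * q x \<partial>\<nu>) = (\<integral>x. G x * p x \<partial>\<nu>) * (\<integral>x. q x \<partial>\<nu>)"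
  using assms unfolding F_module_def by blast+

lemma multipliersI:
  assumes "bdd_meas \<nu> G" "\<And>H. H \<in> F_module \<Longrightarrow> (\<lambda>x. G x * H x) \<in> F_module"
  shows "G \<in> multipliers"
  using assms unfolding multipliers_def by blast

lemma multipliersD:
  assumes "G \<in> multipliers"
  shows "bdd_meas \<nu> G" "H \<in> F_module \<Longrightarrow> (\<lambda>x. G x * H x) \<in> F_module"
  using assms unfolding multipliers_def by blast+

lemma one_in_F_module: "(\<lambda>_. 1) \<in> F_module"
  by (rule F_moduleI) (simp_all add: F_uncorrelated)

lemma integrable_mult3:
  "bdd_meas \<nu> G \<Longrightarrow> p \<in> F \<Longrightarrow> integrable \<nu> (\<lambda>x. G x * p x * q x)"
  "bdd_meas \<nu> G \<Longrightarrow> p \<in> F \<Longrightarrow> integrable \<nu> (\<lambda>x. G x * p x)"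
proof -
  assume G: "bdd_meas \<nu> G" and p: "p \<in> F"
  have Gp: "bdd_meas \<nu> (\<lambda>x. G x * p x)" by (rule bdd_meas_mult[OF G F_bdd[OF p]])
  show "integrable \<nu> (\<lambda>x. G x * p x)" by (rule nu.bdd_meas_integrable[OF Gp])
  show "integrable \<nu> (\<lambda>x. G x * p x * q x)" by (rule nu.bdd_meas_integrable[OF bdd_meas_mult[OF Gp q]])
qed

lemma F_module_limit:
  assumes s: "\<And>n. s n \<in> F_module" and C: "\<And>n x. \<bar>s n x\<bar> \<le> C" and lim: "\<And>x. (\<lambda>n. s n x) \<longlonglongrightarrow> G x"
  shows "G \<in> F_module"
proof (rule F_moduleI)
  have sb: "bdd_meas \<nu> (s n)" for n by (rule F_moduleD(1)[OF s])
  show G: "bdd_meas \<nu> G"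
  proof (rule bdd_measI)
    show "G \<in> borel_measurable \<nu>"
      by (rule borel_measurable_LIMSEQ_real[OF lim]) (rule bdd_measD[OF sb])
    have "(\<lambda>n. \<bar>s n x\<bar>) \<longlonglongrightarrow> \<bar>G x\<bar>" for x by (intro tendsto_rabs lim)
    then show "\<bar>G x\<bar> \<le> C" for x using C by (meson LIMSEQ_le_const2)
  qed
  have conv: "(\<lambda>n. \<integral>x. s n x * h x \<partial>\<nu>) \<longlonglongrightarrow> (\<integral>x. G x * h x \<partial>\<nu>)" if h: "bdd_meas \<nu> h" for h
  proof -
    obtain D where D: "0 < D" "\<And>x. \<bar>h x\<bar> \<le> D" using bdd_meas_bound[OF h] by blast
    show ?thesis
    proof (rule nu.bounded_convergence[where C="C * D"])
      have "0 \<le> C" using C[of 0 0] by linarith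
      then show "\<bar>s n x * h x\<bar> \<le> C * D" for n x
        unfolding abs_mult using C D by (intro mult_mono) auto
      show "AE x in \<nu>. (\<lambda>n. s n x * h x) \<longlonglongrightarrow> G x * h x" by (intro AE_I2 tendsto_mult_right lim)
    qed (intro bdd_measD bdd_meas_mult sb h G)+
  qed
  fix p assume p: "p \<in> F"
  have "(\<lambda>n. \<integral>x. s n x * (p x * q x) \<partial>\<nu>) \<longlonglongrightarrow> (\<integral>x. G x * (p x * q x) \<partial>\<nu>)"
    by (intro conv bdd_meas_mult F_bdd p q)
  moreover have "(\<lambda>n. (\<integral>x. s n x * p x \<partial>\<nu>) * (\<integral>x. q x \<partial>\<nu>)) \<longlonglongrightarrow> (\<integral>x. G x * p x \<partial>\<nu>) * (\<integral>x. q x \<partial>\<nu>)"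
    by (intro tendsto_mult_right conv F_bdd p)
  ultimately show "(\<integral>x. G x * p x * q x \<partial>\<nu>) = (\<integral>x. G x * p x \<partial>\<nu>) * (\<integral>x. q x \<partial>\<nu>)"
    using F_moduleD(2)[OF s p] by (simp add: LIMSEQ_unique mult.assoc)
qed

lemma F_module_add:
  assumes "G \<in> F_module" "H \<in> F_module" shows "(\<lambda>x. G x + H x) \<in> F_module"
proof (rule F_moduleI)
  note b = F_moduleD(1)[OF assms(1)] F_moduleD(1)[OF assms(2)]
  show "bdd_meas \<nu> (\<lambda>x. G x + H x)" by (intro bdd_meas_add b)
  fix p assume p: "p \<in> F"
  show "(\<integral>x. (G x + H x) * p x * q x \<partial>\<nu>) = (\<integral>x. (G x + H x) * p x \<partial>\<nu>) * (\<integral>x. q x \<partial>\<nu>)"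
    using F_moduleD(2)[OF assms(1) p] F_moduleD(2)[OF assms(2) p] integrable_mult3[OF b(1) p] integrable_mult3[OF b(2) p]
    by (simp add: distrib_right)
qed

lemma F_module_scale:
  assumes "G \<in> F_module" shows "(\<lambda>x. c * G x) \<in> F_module"
proof (rule F_moduleI)
  show "bdd_meas \<nu> (\<lambda>x. c * G x)" by (intro bdd_meas_mult bdd_meas_const F_moduleD(1)[OF assms])
qed (simp add: mult.assoc F_moduleD(2)[OF assms, unfolded mult.assoc])

lemma multipliers_uncorrelated:
  assumes "G \<in> multipliers" shows "(\<integral>x. G x * q x \<partial>\<nu>) = (\<integral>x. G x \<partial>\<nu>) * (\<integral>x. q x \<partial>\<nu>)"
  using F_moduleD(2)[OF multipliersD(2)[OF assms one_in_F_module] F_one] by simp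

lemma multipliers_const: "(\<lambda>_. c) \<in> multipliers"
  by (rule multipliersI) (auto intro: F_module_scale)

lemma multipliers_add:
  assumes "G \<in> multipliers" "H \<in> multipliers" shows "(\<lambda>x. G x + H x) \<in> multipliers"
proof (rule multipliersI)
  show "bdd_meas \<nu> (\<lambda>x. G x + H x)" by (intro bdd_meas_add multipliersD(1) assms)
  fix K assume K: "K \<in> F_module"
  show "(\<lambda>x. (G x + H x) * K x) \<in> F_module"
    unfolding distrib_right by (intro F_module_add multipliersD(2) assms K)
qed

lemma multipliers_mult:
  assumes "G \<in> multipliers" "H \<in> multipliers" shows "(\<lambda>x. G x * H x) \<in> multipliers"
proof (rule multipliersI)
  show "bdd_meas \<nu> (\<lambda>x. G x * H x)" by (intro bdd_meas_mult multipliersD(1) assms)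
  fix K assume K: "K \<in> F_module"
  show "(\<lambda>x. G x * H x * K x) \<in> F_module"
    using multipliersD(2)[OF assms(1) multipliersD(2)[OF assms(2) K]] by (simp add: mult.assoc)
qed

lemma multipliers_one_minus: "G \<in> multipliers \<Longrightarrow> (\<lambda>x. 1 - G x) \<in> multipliers"
  using multipliers_add[OF multipliers_const[of 1] multipliers_mult[OF multipliers_const[of "-1"]]] by simp

lemma multipliers_power: "G \<in> multipliers \<Longrightarrow> (\<lambda>x. G x ^ n) \<in> multipliers"
  by (induction n) (auto intro: multipliers_const multipliers_mult)

lemma multipliers_prod: "(\<And>j. G j \<in> multipliers) \<Longrightarrow> (\<lambda>x. \<Prod>j<n::nat. G j x) \<in> multipliers"
  by (induction n) (auto intro: multipliers_const multipliers_mult)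

lemma multipliers_limit:
  assumes s: "\<And>n. s n \<in> multipliers" and C: "\<And>n x. \<bar>s n x\<bar> \<le> C" and lim: "\<And>x. (\<lambda>n. s n x) \<longlonglongrightarrow> G x"
  shows "G \<in> multipliers"
proof (rule multipliersI)
  have step: "(\<lambda>x. G x * H x) \<in> F_module" if H: "H \<in> F_module" for H
  proof -
    obtain D where D: "0 < D" "\<And>x. \<bar>H x\<bar> \<le> D" using bdd_meas_bound[OF F_moduleD(1)[OF H]] by blast
    show ?thesis
    proof (rule F_module_limit[of "\<lambda>n x. s n x * H x" "C * D"])
      have "0 \<le> C" using C[of 0 0] by linarith
      then show "\<bar>s n x * H x\<bar> \<le> C * D" for n x
        unfolding abs_mult using C D by (intro mult_mono) auto
    qed (intro multipliersD(2) s H tendsto_mult_right lim)+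
  qed
  then show "(\<lambda>x. G x * H x) \<in> F_module" if "H \<in> F_module" for H using that .
  show "bdd_meas \<nu> G" using F_moduleD(1)[OF step[OF one_in_F_module]] by simp
qed

text \<open>\<open>p0 * p\<close> is a bounded limit of members of \<open>F\<close>, so testing
  \<open>p0 * H\<close> against \<open>p\<close> reduces to testing \<open>H\<close> against members
  of \<open>F\<close>.\<close>

lemma F_multipliers:
  assumes p0: "p0 \<in> F" shows "p0 \<in> multipliers"
proof (rule multipliersI)
  show "bdd_meas \<nu> p0" by (rule F_bdd[OF p0])
  fix H assume H: "H \<in> F_module"
  note Hb = F_moduleD(1)[OF H]
  show "(\<lambda>x. p0 x * H x) \<in> F_module"
  proof (rule F_moduleI)
    show "bdd_meas \<nu> (\<lambda>x. p0 x * H x)" by (intro bdd_meas_mult F_bdd p0 Hb)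
    fix p assume p: "p \<in> F"
    obtain s :: "nat \<Rightarrow> real \<Rightarrow> real" and C where s: "\<And>n. s n \<in> F" "\<And>n x. \<bar>s n x\<bar> \<le> C"
      "\<And>x. (\<lambda>n. s n x) \<longlonglongrightarrow> p0 x * p x"
      using F_mult[OF p0 p] by blast
    have pp: "bdd_meas \<nu> (\<lambda>x. p0 x * p x)" by (intro bdd_meas_mult F_bdd p0 p)
    have conv: "(\<lambda>n. \<integral>x. h x * s n x \<partial>\<nu>) \<longlonglongrightarrow> (\<integral>x. h x * (p0 x * p x) \<partial>\<nu>)" if h: "bdd_meas \<nu> h" for h
    proof -
      obtain D where D: "0 < D" "\<And>x. \<bar>h x\<bar> \<le> D" using bdd_meas_bound[OF h] by blast
      show ?thesis
      proof (rule nu.bounded_convergence[where C="D * C"])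
        show "\<bar>h x * s n x\<bar> \<le> D * C" for n x
          unfolding abs_mult using s(2) D by (intro mult_mono) (auto intro: less_imp_le)
        show "AE x in \<nu>. (\<lambda>n. h x * s n x) \<longlonglongrightarrow> h x * (p0 x * p x)" by (intro AE_I2 tendsto_mult_left s(3))
      qed (intro bdd_measD bdd_meas_mult h F_bdd s(1) pp p0 p)+
    qed
    have "(\<lambda>n. \<integral>x. H x * q x * s n x \<partial>\<nu>) \<longlonglongrightarrow> (\<integral>x. H x * q x * (p0 x * p x) \<partial>\<nu>)"
      by (intro conv bdd_meas_mult Hb q)
    moreover have "(\<integral>x. H x * q x * s n x \<partial>\<nu>) = (\<integral>x. H x * s n x \<partial>\<nu>) * (\<integral>x. q x \<partial>\<nu>)" for n
      using F_moduleD(2)[OF H s(1)] by (simp add: mult_ac)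
    moreover have "(\<lambda>n. (\<integral>x. H x * s n x \<partial>\<nu>) * (\<integral>x. q x \<partial>\<nu>)) \<longlonglongrightarrow> (\<integral>x. H x * (p0 x * p x) \<partial>\<nu>) * (\<integral>x. q x \<partial>\<nu>)"
      by (intro tendsto_mult_right conv Hb)
    ultimately have "(\<integral>x. H x * q x * (p0 x * p x) \<partial>\<nu>) = (\<integral>x. H x * (p0 x * p x) \<partial>\<nu>) * (\<integral>x. q x \<partial>\<nu>)"
      by (simp add: LIMSEQ_unique)
    then show "(\<integral>x. p0 x * H x * p x * q x \<partial>\<nu>) = (\<integral>x. p0 x * H x * p x \<partial>\<nu>) * (\<integral>x. q x \<partial>\<nu>)"
      by (simp add: mult_ac)
  qed
qed

text \<open>Thresholding the translates of \<open>\<zeta>\<close> by points of a dense subset of \<open>{c..d}\<close> recovers the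
  indicator function of \<open>{c..d}\<close>.\<close>

lemma indicator_multiplier:
  assumes \<zeta>: "\<And>u. (\<lambda>b. \<zeta> (b - u)) \<in> multipliers" and \<zeta>c: "continuous_on UNIV \<zeta>"
    and \<zeta>01: "\<And>x. 0 \<le> \<zeta> x" "\<And>x. \<zeta> x \<le> 1" and \<zeta>1: "\<zeta> 0 = 1" "\<And>x. x \<noteq> 0 \<Longrightarrow> \<zeta> x < 1"
    and cd: "c < d"
  shows "indicator {c..d} \<in> multipliers"
proof -
  define thr :: "real \<Rightarrow> real" where "thr w = (if w < 1/2 then 1 else if w = 1/2 then exp (- 1) else 0)" for w
  have thr01: "0 \<le> thr w" "thr w \<le> 1" for w unfolding thr_def by auto
  obtain q0 where q0: "q0 \<in> \<rat>" "c < q0" "q0 < d" using Rats_dense_in_real[OF cd] by blast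
  define e where "e = from_nat_into (\<rat> \<inter> {c..d})"
  have re: "range e = \<rat> \<inter> {c..d}"
    unfolding e_def using q0 by (intro range_from_nat_into) (auto simp: countable_rat intro: exI[of _ q0])
  have z01: "0 \<le> \<zeta> x ^ l" "\<zeta> x ^ l \<le> 1" for x l using \<zeta>01 by (auto intro: power_le_one)
  have G1: "(\<lambda>b. thr (\<zeta> (b - u) ^ l)) \<in> multipliers" for u l
  proof (rule multipliers_limit[of "\<lambda>m b. (1 - (\<zeta> (b - u) ^ l) ^ m) ^ (2 ^ m)" 1])
    show "(\<lambda>b. (1 - (\<zeta> (b - u) ^ l) ^ m) ^ (2 ^ m)) \<in> multipliers" for m
      by (intro multipliers_power multipliers_one_minus \<zeta>)
    show "\<bar>(1 - (\<zeta> (b - u) ^ l) ^ m) ^ (2 ^ m)\<bar> \<le> 1" for m b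
    proof -
      have "0 \<le> 1 - (\<zeta> (b - u) ^ l) ^ m" "1 - (\<zeta> (b - u) ^ l) ^ m \<le> 1"
        using z01[of "b - u" l] by (auto intro: power_le_one)
      then show ?thesis by (simp add: power_le_one)
    qed
    show "(\<lambda>m. (1 - (\<zeta> (b - u) ^ l) ^ m) ^ (2 ^ m)) \<longlonglongrightarrow> thr (\<zeta> (b - u) ^ l)" for b
      unfolding thr_def by (rule threshold_limit[OF z01])
  qed
  \<comment> \<open>A factor is 0 as soon as \<open>\<zeta> (b - e j) ^ l\<close> exceeds 1/2. For
    large \<open>n\<close> the product thus detects whether some rational point of the interval is
    close to \<open>b\<close>, with closeness measured by \<open>\<zeta>\<close> and sharpened by
    \<open>l\<close>.\<close>
  define G2 where "G2 l n b = (\<Prod>j<n. thr (\<zeta> (b - e j) ^ l))" for l n b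
  have G2: "G2 l n \<in> multipliers" for l n unfolding G2_def by (intro multipliers_prod G1)
  have G2_01: "0 \<le> G2 l n b" "G2 l n b \<le> 1" for l n b
    unfolding G2_def using thr01 by (auto intro: prod_nonneg prod_le_1)
  define G3 where "G3 l b = lim (\<lambda>n. G2 l n b)" for l b
  have G3_lim: "(\<lambda>n. G2 l n b) \<longlonglongrightarrow> G3 l b" for l b
  proof -
    have "decseq (\<lambda>n. G2 l n b)"
      unfolding decseq_Suc_iff using thr01 G2_01[of l _ b] by (auto simp: G2_def intro: mult_left_le)
    from decseq_convergent[OF this, of 0] show ?thesis
      using G2_01(1) unfolding G3_def by (metis limI)
  qed
  have G3: "G3 l \<in> multipliers" for l
  proof (rule multipliers_limit[of "G2 l" 1])
    show "\<bar>G2 l n b\<bar> \<le> 1" for n b using G2_01[of l n b] by simp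
  qed (rule G2 G3_lim)+
  have G3_01: "\<bar>G3 l b\<bar> \<le> 1" for l b
    using LIMSEQ_le_const[OF G3_lim[of l b], of 0] LIMSEQ_le_const2[OF G3_lim[of l b], of 1] G2_01 by auto
  have "(\<lambda>l. G3 l b) \<longlonglongrightarrow> 1 - indicator {c..d} b" for b
  proof (cases "b \<in> {c..d}")
    case True
    have "G3 l b = 0" for l
    proof -
      \<comment> \<open>For each fixed \<open>l\<close> the power stays above 1/2 near 0, and a
        rational of the interval lies that near to \<open>b\<close>; its factor kills the
        product.\<close>
      have "isCont \<zeta> 0" using \<zeta>c by (simp add: continuous_on_eq_continuous_at)
      then have "isCont (\<lambda>x. \<zeta> x ^ l) 0" by (intro continuous_intros)
      then have "((\<lambda>x. \<zeta> x ^ l) \<longlongrightarrow> 1) (at 0)" using \<zeta>1(1) by (simp add: isCont_def)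
      then have "\<forall>\<^sub>F x in at 0. \<zeta> x ^ l > 1/2" by (rule order_tendstoD) simp
      then obtain \<delta> where \<delta>: "\<delta> > 0" "\<And>x. x \<noteq> 0 \<Longrightarrow> \<bar>x\<bar> < \<delta> \<Longrightarrow> \<zeta> x ^ l > 1/2"
        unfolding eventually_at by (auto simp: dist_real_def)
      have "max c (b - \<delta>) < min d (b + \<delta>)" using True cd \<delta>(1) by auto
      from Rats_dense_in_real[OF this] obtain u where u: "u \<in> \<rat>" "max c (b - \<delta>) < u" "u < min d (b + \<delta>)" by blast
      then have "u \<in> range e" unfolding re by auto
      then obtain j where j: "u = e j" by blast
      have "\<zeta> (b - e j) ^ l > 1/2"
      proof (cases "b - u = 0")
        case False
        moreover have "\<bar>b - u\<bar> < \<delta>" using u by auto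
        ultimately show ?thesis using \<delta>(2)[of "b - u"] j by simp
      qed (use j \<zeta>1(1) in simp)
      then have "thr (\<zeta> (b - e j) ^ l) = 0" unfolding thr_def by simp
      then have "G2 l n b = 0" if "n > j" for n
        unfolding G2_def using that by (intro prod_zero) auto
      then have "\<forall>\<^sub>F n in sequentially. G2 l n b = 0"
        by (rule eventually_mono[OF eventually_gt_at_top[of j]])
      then have "(\<lambda>n. G2 l n b) \<longlonglongrightarrow> 0" by (rule tendsto_eventually)
      with G3_lim show ?thesis by (rule LIMSEQ_unique)
    qed
    then show ?thesis using True by simp
  next
    case False
    \<comment> \<open>By compactness \<open>\<zeta> (b - u)\<close> stays below a constant less than
      1 on the interval, so from some \<open>l\<close> on all powers are below 1/2 and every factor
      is 1.\<close>
    have "continuous_on {c..d} (\<lambda>u. \<zeta> (b - u))"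
      by (intro continuous_on_compose2[OF \<zeta>c] continuous_intros) auto
    then obtain u0 where u0: "u0 \<in> {c..d}" "\<And>u. u \<in> {c..d} \<Longrightarrow> \<zeta> (b - u) \<le> \<zeta> (b - u0)"
      using continuous_attains_sup[of "{c..d}" "\<lambda>u. \<zeta> (b - u)"] cd by auto
    have "\<zeta> (b - u0) < 1" using u0(1) False by (intro \<zeta>1(2)) auto
    then have "(\<lambda>l. \<zeta> (b - u0) ^ l) \<longlonglongrightarrow> 0" using \<zeta>01 by (intro LIMSEQ_power_zero) auto
    then have "\<forall>\<^sub>F l in sequentially. \<zeta> (b - u0) ^ l < 1/2" by (rule order_tendstoD) simp
    then have "\<forall>\<^sub>F l in sequentially. G3 l b = 1"
    proof eventually_elim
      case (elim l)
      have "thr (\<zeta> (b - e j) ^ l) = 1" for j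
      proof -
        have "e j \<in> {c..d}" using re by blast
        from u0(2)[OF this] have "\<zeta> (b - e j) ^ l \<le> \<zeta> (b - u0) ^ l" using \<zeta>01 by (intro power_mono)
        with elim show ?thesis unfolding thr_def by simp
      qed
      then have "G2 l n b = 1" for n unfolding G2_def by simp
      then show ?case using G3_lim[of l b] by (simp add: LIMSEQ_const_iff)
    qed
    then show ?thesis using False by (simp add: tendsto_eventually)
  qed
  from multipliers_limit[OF G3 G3_01 this] have "(\<lambda>b. 1 - indicator {c..d} b) \<in> multipliers" .
  from multipliers_one_minus[OF this] show ?thesis by simp
qed

text \<open>Indicators of nondegenerate intervals are multipliers, hence uncorrelated with
  \<open>q\<close>, and points carry no mass. So integrating against \<open>q\<close> and against
  its mean \<open>m\<close> gives the same functional, which is then evaluated at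
  \<open>q - m\<close>.\<close>

lemma AE_constant:
  assumes \<zeta>: "\<And>u. (\<lambda>b. \<zeta> (b - u)) \<in> multipliers" and \<zeta>c: "continuous_on UNIV \<zeta>"
    and \<zeta>01: "\<And>x. 0 \<le> \<zeta> x" "\<And>x. \<zeta> x \<le> 1" and \<zeta>1: "\<zeta> 0 = 1" "\<And>x. x \<noteq> 0 \<Longrightarrow> \<zeta> x < 1"
    and atomless: "\<And>a. emeasure \<nu> {a} = 0"
  shows "AE b in \<nu>. q b = (\<integral>x. q x \<partial>\<nu>)"
proof -
  have spn: "space \<nu> = UNIV" using sets_eq_imp_space_eq[OF nu(2)] by simp
  \<comment> \<open>Intersections of intervals may be single points or empty; these stay in the
    generator and are checked apart below. \<open>UNIV\<close> is added for the uniqueness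
    lemma.\<close>
  define I where "I = insert UNIV (range (\<lambda>(c, d). {c..d::real}))"
  define m where "m = (\<integral>x. q x \<partial>\<nu>)"
  have sI: "sets \<nu> = sigma_sets UNIV I"
  proof -
    have "sets \<nu> = sigma_sets UNIV (range (\<lambda>(c, d). {c..d::real}))"
      using nu(2) by (simp add: borel_eq_atLeastAtMost)
    also have "\<dots> = sigma_sets UNIV I"
      by (rule sigma_sets_eqI) (auto simp: I_def sigma_sets_top intro: sigma_sets.Basic)
    finally show ?thesis .
  qed
  have stable: "Int_stable I"
    unfolding Int_stable_def I_def by (auto simp: image_iff)
  obtain C where C: "0 < C" "\<And>x. \<bar>q x\<bar> \<le> C" using bdd_meas_bound[OF q] by blast
  have fb: "bdd_meas \<nu> (\<lambda>b. q b - m)" by (intro bdd_meas_diff q bdd_meas_const)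
  have "(\<integral>b. q b * (q b - m) \<partial>\<nu>) = (\<integral>b. m * (q b - m) \<partial>\<nu>)"
  proof (rule L1_functional_unique[OF nu(1) spn stable sI, where L="\<lambda>f. \<integral>b. q b * f b \<partial>\<nu>"
        and L'="\<lambda>f. \<integral>b. m * f b \<partial>\<nu>", OF _ _ _ _ fb])
    show "L1_functional \<nu> C (\<lambda>f. \<integral>b. q b * f b \<partial>\<nu>)"
      by (rule L1_functional_mult[OF nu(1) bdd_measD[OF q] C(2)])
    show "L1_functional \<nu> \<bar>m\<bar> (\<lambda>f. \<integral>b. m * f b \<partial>\<nu>)"
      by (rule L1_functional_mult[OF nu(1)]) auto
    show "UNIV \<in> I" unfolding I_def by simp
    fix A assume "A \<in> I"
    then consider "A = UNIV" | c d where "A = {c..d}" "c < d" | c where "A = {c}" | "A = {}"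
      unfolding I_def by (auto simp: image_iff) (metis atLeastatMost_empty_iff antisym_conv1 atLeastAtMost_singleton)
    then show "(\<integral>b. q b * indicator A b \<partial>\<nu>) = (\<integral>b. m * indicator A b \<partial>\<nu>)"
    proof cases
      case 1 then show ?thesis by (simp add: m_def nu.prob_space)
    next
      case 2
      from multipliers_uncorrelated[OF indicator_multiplier[OF \<zeta> \<zeta>c \<zeta>01 \<zeta>1 2(2)]]
      show ?thesis unfolding 2(1) m_def by (simp add: mult.commute)
    next
      case 3
      have "AE b in \<nu>. b \<noteq> c" using atomless[of c] nu(2) by (intro AE_I[of _ _ "{c}"]) auto
      then have "AE b in \<nu>. q b * indicator A b = 0" "AE b in \<nu>. m * indicator A b = 0"
        unfolding 3 by (eventually_elim, simp)+
      from integral_eq_zero_AE[OF this(1)] integral_eq_zero_AE[OF this(2)] show ?thesis by (rule trans[OF _ sym])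
    qed simp
  qed
  then have "(\<integral>b. (q b - m) * (q b - m) \<partial>\<nu>) = 0"
    using bdd_meas_mult[OF q fb, THEN nu.bdd_meas_integrable] nu.bdd_meas_integrable[OF fb]
    by (simp add: left_diff_distrib)
  from nu.AE_eq_0I[OF fb this] show ?thesis by (simp add: m_def)
qed

end

section \<open>Factors of the two coordinates\<close>

lemma (in prob_space) AE_constantI:
  assumes f: "bdd_meas M f" and eq: "(\<integral>x. f x * f x \<partial>M) = (\<integral>x. f x \<partial>M) * (\<integral>x. f x \<partial>M)"
  shows "AE x in M. f x = (\<integral>x. f x \<partial>M)"
proof -
  define m where "m = (\<integral>x. f x \<partial>M)"
  have fm: "bdd_meas M (\<lambda>x. f x - m)" by (intro bdd_meas_diff f bdd_meas_const)
  have "(\<integral>x. (f x - m) * (f x - m) \<partial>M) = (\<integral>x. f x * f x - (2 * m) * f x + m * m \<partial>M)"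
    by (intro Bochner_Integration.integral_cong) (auto simp: algebra_simps)
  also have "\<dots> = (\<integral>x. f x * f x \<partial>M) - (2 * m) * (\<integral>x. f x \<partial>M) + m * m"
    using bdd_meas_integrable[OF bdd_meas_mult[OF f f]] bdd_meas_integrable[OF f] by (simp add: prob_space)
  also have "\<dots> = 0" using eq by (simp add: m_def)
  finally have "(\<integral>x. (f x - m) * (f x - m) \<partial>M) = 0" .
  from AE_eq_0I[OF fm this] show ?thesis by (simp add: m_def)
qed

section \<open>Correlations along the flow\<close>

context tensor_square
begin

lemma bdd_T: "bdd_meas N f \<Longrightarrow> bdd_meas N (\<lambda>y. f (T a y))"
  using bdd_meas_comp T_mp by blast

text \<open>Modulo \<open>d\<close> the mixing times become bounded remainders. Along a convergent
  subsequence the correlations with \<open>f\<close> converge both by mixing and by continuity, so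
  \<open>f \<circ> T l\<close> is uncorrelated with every bounded function.\<close>

lemma periodic_constant:
  assumes f: "bdd_meas N f" and d: "d \<noteq> 0" and per: "AE y in N. f (T d y) = f y"
  shows "AE y in N. f y = (\<integral>y. f y \<partial>N)"
proof (rule N.AE_constantI[OF f])
  have nat: "AE y in N. f (T (real n * d) y) = f y" for n
  proof (induction n)
    case (Suc n)
    have "AE y in N. f (T d (T (real n * d) y)) = f (T (real n * d) y)" by (rule AE_distr_eq[OF T_mp per])
    with Suc show ?case by eventually_elim (simp add: T_add[symmetric] algebra_simps)
  qed (simp add: T_0)
  have int: "AE y in N. f (T (of_int m * d) y) = f y" for m
  proof (cases "m \<ge> 0")
    case True
    then show ?thesis using nat[of "nat m"] by simp
  next
    case False
    from AE_distr_eq[OF T_mp nat[of "nat (- m)"], of "of_int m * d"] False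
    show ?thesis by (auto simp: T_add[symmetric] T_0 elim: eventually_mono)
  qed
  define \<theta> where "\<theta> n = r n - of_int \<lfloor>r n / d\<rfloor> * d" for n
  have \<theta>: "\<bar>\<theta> n\<bar> \<le> \<bar>d\<bar>" for n
  proof -
    have "\<theta> n = (r n / d - of_int \<lfloor>r n / d\<rfloor>) * d" using d by (simp add: \<theta>_def left_diff_distrib)
    moreover have "\<bar>r n / d - of_int \<lfloor>r n / d\<rfloor>\<bar> \<le> 1" by linarith
    ultimately show ?thesis by (simp add: abs_mult mult_left_le_one_le)
  qed
  have eq: "(\<integral>y. k y * f (T (r n) y) \<partial>N) = (\<integral>y. k y * f (T (\<theta> n) y) \<partial>N)" if k: "bdd_meas N k" for k n
  proof (rule integral_cong_AE)
    show "AE y in N. k y * f (T (r n) y) = k y * f (T (\<theta> n) y)"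
      using AE_distr_eq[OF T_mp int[of "\<lfloor>r n / d\<rfloor>"], of "\<theta> n"]
      by eventually_elim (simp add: T_add[symmetric] \<theta>_def)
  qed (intro bdd_measD bdd_meas_mult k bdd_T f)+
  have "bounded (range \<theta>)" using \<theta> by (auto simp: bounded_iff)
  then obtain l \<sigma> where \<sigma>: "strict_mono \<sigma>" "(\<theta> \<circ> \<sigma>) \<longlonglongrightarrow> l"
    using bounded_imp_convergent_subsequence by blast
  have lim: "(\<integral>y. k y * f (T l y) \<partial>N) = (\<integral>y. k y \<partial>N) * (\<integral>y. f y \<partial>N)" if k: "bdd_meas N k" for k
  proof (rule LIMSEQ_unique)
    show "(\<lambda>n. \<integral>y. k y * f (T ((\<theta> \<circ> \<sigma>) n) y) \<partial>N) \<longlonglongrightarrow> (\<integral>y. k y * f (T l y) \<partial>N)"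
      by (rule mp_flow_correlation_continuous[OF T f k \<sigma>(2)])
    have "(\<lambda>n. \<integral>y. k y * f (T (r (\<sigma> n)) y) \<partial>N) \<longlonglongrightarrow> (\<integral>y. k y \<partial>N) * (\<integral>y. f y \<partial>N)"
      using LIMSEQ_subseq_LIMSEQ[OF mix[OF k f] \<sigma>(1)] by (simp add: comp_def)
    then show "(\<lambda>n. \<integral>y. k y * f (T ((\<theta> \<circ> \<sigma>) n) y) \<partial>N) \<longlonglongrightarrow> (\<integral>y. k y \<partial>N) * (\<integral>y. f y \<partial>N)"
      unfolding comp_def eq[OF k] .
  qed
  have inv: "(\<integral>y. g (T l y) \<partial>N) = (\<integral>y. g y \<partial>N)" if "bdd_meas N g" for g
    by (rule N.integral_distr_eq[OF T_mp bdd_measD[OF that]])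
  \<comment> \<open>The test function is \<open>f \<circ> T l\<close> itself; invariance then
    removes \<open>T l\<close> from both integrals.\<close>
  show "(\<integral>y. f y * f y \<partial>N) = (\<integral>y. f y \<partial>N) * (\<integral>y. f y \<partial>N)"
    using lim[OF bdd_T[OF f, of l]] inv[OF f] inv[OF bdd_meas_mult[OF f f]] by simp
qed

definition corr :: "('b \<Rightarrow> real) \<Rightarrow> ('b \<Rightarrow> real) \<Rightarrow> real \<Rightarrow> real" where
  "corr f g a = (\<integral>y. f y * g (T a y) \<partial>N)"

lemma corr_bdd:
  assumes f: "bdd_meas N f" and g: "bdd_meas N g" shows "bdd_meas \<nu> (corr f g)"
proof -
  have m: "(\<lambda>q. T (fst q) (snd q)) \<in> \<nu> \<Otimes>\<^sub>M N \<rightarrow>\<^sub>M N"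
    by (rule mp_flow_measurable[OF T]) (auto simp: nu(2) cong: measurable_cong_sets)
  have b: "bdd_meas (\<nu> \<Otimes>\<^sub>M N) (\<lambda>q. f (snd q) * g (T (fst q) (snd q)))"
    by (intro bdd_meas_mult bdd_meas_comp[OF f measurable_snd] bdd_meas_comp[OF g m])
  obtain C where C: "\<And>y. \<bar>f y\<bar> \<le> C" "0 < C" using bdd_meas_bound[OF f] by blast
  obtain D where D: "\<And>y. \<bar>g y\<bar> \<le> D" "0 < D" using bdd_meas_bound[OF g] by blast
  show ?thesis
    unfolding corr_def
  proof (rule N.bdd_meas_integral)
    show "(\<lambda>(a, y). f y * g (T a y)) \<in> borel_measurable (\<nu> \<Otimes>\<^sub>M N)"
      using bdd_measD[OF b] by (simp add: case_prod_beta')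
    show "\<bar>f y * g (T a y)\<bar> \<le> C * D" for a y
      unfolding abs_mult using C D by (intro mult_mono) (auto intro: less_imp_le)
  qed
qed

lemma corr_continuous:
  assumes f: "bdd_meas N f" and g: "bdd_meas N g" shows "continuous_on UNIV (corr f g)"
  unfolding continuous_on_sequentially corr_def comp_def
  using mp_flow_correlation_continuous[OF T g f] by blast

lemma corr_shift:
  assumes f: "bdd_meas N f" and g: "bdd_meas N g"
  shows "corr (\<lambda>y. f (T u y)) g a = corr f g (a - u)"
proof -
  have "(\<integral>y. (\<lambda>y. f y * g (T (a - u) y)) (T u y) \<partial>N) = corr f g (a - u)"
    unfolding corr_def
    by (rule N.integral_distr_eq[OF T_mp]) (intro bdd_measD bdd_meas_mult f bdd_T g)
  then show ?thesis unfolding corr_def by (simp add: T_add[symmetric])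
qed

lemma corr_distance:
  assumes f: "bdd_meas N f"
  shows "(\<integral>y. (f (T a y) - f y) * (f (T a y) - f y) \<partial>N) = 2 * corr f f 0 - 2 * corr f f a"
proof -
  have i: "integrable N (\<lambda>y. f (T a y) * f (T a y))" "integrable N (\<lambda>y. f y * f (T a y))" "integrable N (\<lambda>y. f y * f y)"
    by (intro N.bdd_meas_integrable bdd_meas_mult bdd_T f)+
  have "(\<integral>y. (\<lambda>y. f y * f y) (T a y) \<partial>N) = (\<integral>y. f y * f y \<partial>N)"
    by (rule N.integral_distr_eq[OF T_mp]) (intro bdd_measD bdd_meas_mult f)
  then have a: "(\<integral>y. f (T a y) * f (T a y) \<partial>N) = (\<integral>y. f y * f y \<partial>N)" by simp
  have "(\<integral>y. (f (T a y) - f y) * (f (T a y) - f y) \<partial>N)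
    = (\<integral>y. f (T a y) * f (T a y) - 2 * (f y * f (T a y)) + f y * f y \<partial>N)"
    by (intro Bochner_Integration.integral_cong) (auto simp: algebra_simps)
  also have "\<dots> = 2 * (\<integral>y. f y * f y \<partial>N) - 2 * (\<integral>y. f y * f (T a y) \<partial>N)"
    using i a by simp
  finally show ?thesis unfolding corr_def T_0 .
qed

lemma corr_le:
  assumes f: "bdd_meas N f" shows "corr f f a \<le> corr f f 0"
proof -
  have "0 \<le> (\<integral>y. (f (T a y) - f y) * (f (T a y) - f y) \<partial>N)" by (rule integral_nonneg_AE) auto
  then show ?thesis by (simp add: corr_distance[OF f])
qed

text \<open>Equality with the value at 0 makes the squared distance of \<open>f\<close> and
  \<open>f \<circ> T a\<close> vanish, so \<open>f\<close> is periodic. In this sense the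
  autocorrelation of a nonconstant function determines the time.\<close>

lemma corr_eq_constant:
  assumes f: "bdd_meas N f" and a: "a \<noteq> 0" "corr f f a = corr f f 0"
  shows "AE y in N. f y = (\<integral>y. f y \<partial>N)"
proof (rule periodic_constant[OF f a(1)])
  have "AE y in N. f (T a y) - f y = 0"
    by (rule N.AE_eq_0I[OF bdd_meas_diff[OF bdd_T[OF f] f]]) (simp add: corr_distance[OF f] a(2))
  then show "AE y in N. f (T a y) = f y" by simp
qed

text \<open>The bounded functions that depend on \<open>y2\<close> alone and on \<open>X1\<close>
  alone: the common part of two algebras, which is the algebra of a factor of \<open>T\<close>.
  \<open>factor2\<close> is its twin for \<open>X2\<close>.\<close>

definition factor1 :: "('b \<Rightarrow> real) set" where
  "factor1 = {f. bdd_meas N f \<and> (\<exists>w. bdd_meas M w \<and> (AE y in NN. f (snd y) = w (X1 y)))}"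

definition factor2 :: "('b \<Rightarrow> real) set" where
  "factor2 = {f. bdd_meas N f \<and> (\<exists>w. bdd_meas M w \<and> (AE y in NN. f (snd y) = w (X2 y)))}"

lemma factor1_bdd: "f \<in> factor1 \<Longrightarrow> bdd_meas N f" and factor2_bdd: "f \<in> factor2 \<Longrightarrow> bdd_meas N f"
  unfolding factor1_def factor2_def by auto

lemma factor1_const: "(\<lambda>_. c) \<in> factor1"
  unfolding factor1_def by (auto intro!: exI[of _ "\<lambda>_. c"])

lemma factor1_add:
  assumes "f \<in> factor1" shows "(\<lambda>y. f y + c) \<in> factor1"
proof -
  obtain w where w: "bdd_meas M w" "AE y in NN. f (snd y) = w (X1 y)" using assms unfolding factor1_def by blast
  have "bdd_meas M (\<lambda>x. w x + c)" by (intro bdd_meas_add w bdd_meas_const)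
  moreover have "AE y in NN. f (snd y) + c = w (X1 y) + c" using w(2) by eventually_elim simp
  moreover have "bdd_meas N (\<lambda>y. f y + c)" by (intro bdd_meas_add factor1_bdd assms bdd_meas_const)
  ultimately show ?thesis unfolding factor1_def by blast
qed

lemma factor1_mult:
  assumes "f \<in> factor1" "g \<in> factor1" shows "(\<lambda>y. f y * g y) \<in> factor1"
proof -
  obtain w where w: "bdd_meas M w" "AE y in NN. f (snd y) = w (X1 y)" using assms(1) unfolding factor1_def by blast
  obtain v where v: "bdd_meas M v" "AE y in NN. g (snd y) = v (X1 y)" using assms(2) unfolding factor1_def by blast
  have "bdd_meas M (\<lambda>x. w x * v x)" by (intro bdd_meas_mult w v)
  moreover have "AE y in NN. f (snd y) * g (snd y) = w (X1 y) * v (X1 y)" using w(2) v(2) by eventually_elim simp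
  moreover have "bdd_meas N (\<lambda>y. f y * g y)" by (intro bdd_meas_mult factor1_bdd assms)
  ultimately show ?thesis unfolding factor1_def by blast
qed

text \<open>The diagonal map \<open>W a a\<close> moves the second coordinate by \<open>T a\<close>
  and \<open>X1\<close> by \<open>S a\<close>, so both descriptions of the function are translated
  at once.\<close>

lemma factor1_T:
  assumes "f \<in> factor1" shows "(\<lambda>y. f (T a y)) \<in> factor1"
proof -
  obtain w where w: "bdd_meas M w" "AE y in NN. f (snd y) = w (X1 y)" using assms unfolding factor1_def by blast
  have "bdd_meas M (\<lambda>x. w (S a x))" by (rule bdd_meas_comp[OF w(1) S_mp(1)])
  moreover have "AE y in NN. f (T a (snd y)) = w (S a (X1 y))"
    using AE_distr_eq[OF tens_mp w(2), of a a] X1_equivariant[of a] by eventually_elim (simp add: tens_def)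
  ultimately show ?thesis unfolding factor1_def using bdd_T[OF factor1_bdd[OF assms]] by blast
qed

lemma factor2_alt: "factor2 = tensor_square.factor1 N M (\<lambda>y. prod.swap (\<Psi> y))"
  unfolding factor2_def tensor_square.factor1_def[OF swap_X] by simp

lemma factor2_mult: "f \<in> factor2 \<Longrightarrow> g \<in> factor2 \<Longrightarrow> (\<lambda>y. f y * g y) \<in> factor2"
  unfolding factor2_alt by (rule tensor_square.factor1_mult[OF swap_X])

lemma factor2_T: "f \<in> factor2 \<Longrightarrow> (\<lambda>y. f (T a y)) \<in> factor2"
  unfolding factor2_alt by (rule tensor_square.factor1_T[OF swap_X])

lemma factor_independent:
  assumes f: "f \<in> factor1" and g: "g \<in> factor2"
  shows "(\<integral>y. f y * g y \<partial>N) = (\<integral>y. f y \<partial>N) * (\<integral>y. g y \<partial>N)"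
proof -
  obtain w where w: "bdd_meas M w" "AE y in NN. f (snd y) = w (X1 y)" using f unfolding factor1_def by blast
  obtain v where v: "bdd_meas M v" "AE y in NN. g (snd y) = v (X2 y)" using g unfolding factor2_def by blast
  note fb = factor1_bdd[OF f] and gb = factor2_bdd[OF g]
  have snd: "(\<integral>y. h (snd y) \<partial>NN) = (\<integral>y. h y \<partial>N)" if "bdd_meas N h" for h
    by (rule NN.P.integral_distr_eq[OF measurable_snd snd_measure_preserving[OF N_prob N_prob] bdd_measD[OF that]])
  have sb: "bdd_meas NN (\<lambda>y. h (snd y))" if "bdd_meas N h" for h by (rule bdd_meas_comp[OF that measurable_snd])
  have "(\<integral>y. f y * g y \<partial>N) = (\<integral>y. f (snd y) * g (snd y) \<partial>NN)" by (rule snd[OF bdd_meas_mult[OF fb gb], symmetric])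
  also have "\<dots> = (\<integral>y. w (X1 y) * v (X2 y) \<partial>NN)"
  proof (rule integral_cong_AE)
    show "AE y in NN. f (snd y) * g (snd y) = w (X1 y) * v (X2 y)" using w(2) v(2) by eventually_elim simp
  qed (intro bdd_measD bdd_meas_mult sb fb gb bdd_X1[OF w(1)] bdd_X2[OF v(1)])+
  also have "\<dots> = (\<integral>y. w (X1 y) \<partial>NN) * (\<integral>y. v (X2 y) \<partial>NN)"
    by (simp add: X1_X2_independent w(1) v(1) integral_X1 integral_X2)
  also have "(\<integral>y. w (X1 y) \<partial>NN) = (\<integral>y. f (snd y) \<partial>NN)"
    by (rule integral_cong_AE) (use w in \<open>auto intro: bdd_measD bdd_X1 sb fb elim: eventually_mono\<close>)
  also have "(\<integral>y. v (X2 y) \<partial>NN) = (\<integral>y. g (snd y) \<partial>NN)"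
    by (rule integral_cong_AE) (use v in \<open>auto intro: bdd_measD bdd_X2 sb gb elim: eventually_mono\<close>)
  finally show ?thesis by (simp add: snd fb gb)
qed

text \<open>Independence of the factors makes the product of the two correlations at any time the
  correlation of \<open>f * g\<close> with \<open>f' * g'\<close>. Along \<open>t i\<close> it then
  has two limits: that of the weak limit for these products, and the product of the separate
  limits.\<close>

lemma corr_uncorrelated:
  assumes f: "f \<in> factor1" "f' \<in> factor1" and g: "g \<in> factor2" "g' \<in> factor2"
  shows "(\<integral>a. corr f f' a * corr g g' a \<partial>\<nu>) = (\<integral>a. corr f f' a \<partial>\<nu>) * (\<integral>a. corr g g' a \<partial>\<nu>)"
proof (rule LIMSEQ_unique)
  note b = f[THEN factor1_bdd] g[THEN factor2_bdd]
  have split: "(\<integral>y. (f y * g y) * (\<lambda>y. f' y * g' y) (T a y) \<partial>N) = corr f f' a * corr g g' a" for a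
    using factor_independent[OF factor1_mult[OF f(1) factor1_T[OF f(2)]] factor2_mult[OF g(1) factor2_T[OF g(2)]], of a a]
    by (simp add: corr_def mult_ac)
  have "(\<lambda>i. \<integral>y. (f y * g y) * (\<lambda>y. f' y * g' y) (T (t i) y) \<partial>N)
    \<longlonglongrightarrow> (\<integral>a. (\<integral>y. (f y * g y) * (\<lambda>y. f' y * g' y) (T a y) \<partial>N) \<partial>\<nu>)"
    by (intro weak_limit bdd_meas_mult b)
  then show "(\<lambda>i. corr f f' (t i) * corr g g' (t i)) \<longlonglongrightarrow> (\<integral>a. corr f f' a * corr g g' a \<partial>\<nu>)"
    unfolding split .
  show "(\<lambda>i. corr f f' (t i) * corr g g' (t i)) \<longlonglongrightarrow> (\<integral>a. corr f f' a \<partial>\<nu>) * (\<integral>a. corr g g' a \<partial>\<nu>)"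
    unfolding corr_def by (intro tendsto_mult weak_limit b)
qed

text \<open>The correlations of functions of \<open>X1\<close> are independent, under \<open>\<nu>\<close>, of those of functions of \<open>X2\<close>, while a single
  nonconstant function already separates all times; so both cannot be nonconstant unless \<open>\<nu>\<close> is a point mass.\<close>

lemma factor_trivial:
  assumes f: "f \<in> factor1" and g: "g \<in> factor2"
  shows "(AE y in N. f y = (\<integral>y. f y \<partial>N)) \<or> (AE y in N. g y = (\<integral>y. g y \<partial>N))"
proof (rule ccontr)
  assume "\<not> ?thesis"
  then have nf: "\<not> (AE y in N. f y = (\<integral>y. f y \<partial>N))" and ng: "\<not> (AE y in N. g y = (\<integral>y. g y \<partial>N))" by auto
  note gb = factor2_bdd[OF g]
  interpret \<nu>: prob_space \<nu> by (rule nu(1))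
  obtain C where C: "0 < C" "\<And>y. \<bar>f y\<bar> \<le> C" using bdd_meas_bound[OF factor1_bdd[OF f]] by blast
  \<comment> \<open>The shift makes \<open>F\<close> at least 1, so its autocorrelation is positive
    and normalises to a \<open>\<zeta>\<close> with values in the unit interval that equals 1 only
    at 0.\<close>
  define F where "F y = f y + (C + 1)" for y
  have F: "F \<in> factor1" unfolding F_def by (rule factor1_add[OF f])
  note Fb = factor1_bdd[OF F]
  have F1: "1 \<le> F y" for y using C(2)[of y] unfolding F_def by linarith
  have nF: "\<not> (AE y in N. F y = (\<integral>y. F y \<partial>N))"
  proof
    assume *: "AE y in N. F y = (\<integral>y. F y \<partial>N)"
    have eq: "(\<integral>y. F y \<partial>N) = (\<integral>y. f y \<partial>N) + (C + 1)"
      unfolding F_def using N.bdd_meas_integrable[OF factor1_bdd[OF f]] by (simp add: N.prob_space)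
    from * have "AE y in N. f y = (\<integral>y. f y \<partial>N)"
      unfolding eq by eventually_elim (simp add: F_def)
    with nf show False by blast
  qed
  define \<zeta> where "\<zeta> a = corr F F a / corr F F 0" for a
  have c1: "1 \<le> corr F F a" for a
  proof -
    have "(\<integral>y. 1 \<partial>N) \<le> (\<integral>y. F y * F (T a y) \<partial>N)"
    proof (rule integral_mono)
      show "integrable N (\<lambda>y. F y * F (T a y))" by (intro N.bdd_meas_integrable bdd_meas_mult Fb bdd_T)
      show "1 \<le> F y * F (T a y)" for y using mult_mono[OF F1[of y] F1[of "T a y"]] F1[of y] by simp
    qed simp
    then show ?thesis by (simp add: corr_def N.prob_space)
  qed
  have pos: "0 < corr F F a" for a using c1[of a] by linarith
  have \<zeta>c: "continuous_on UNIV \<zeta>"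
    unfolding \<zeta>_def using pos[of 0] by (intro continuous_intros corr_continuous Fb) auto
  have \<zeta>01: "0 \<le> \<zeta> a" "\<zeta> a \<le> 1" for a
    unfolding \<zeta>_def using pos[of 0] pos[of a] corr_le[OF Fb, of a] by auto
  have \<zeta>0: "\<zeta> 0 = 1" unfolding \<zeta>_def using pos[of 0] by simp
  have \<zeta>1: "\<zeta> a < 1" if "a \<noteq> 0" for a
  proof -
    have "corr F F a \<noteq> corr F F 0" using corr_eq_constant[OF Fb that] nF by blast
    then have "corr F F a < corr F F 0" using corr_le[OF Fb, of a] by linarith
    then show ?thesis unfolding \<zeta>_def using pos[of 0] by simp
  qed
  define P where "P = {corr f f' | f f'. f \<in> factor1 \<and> f' \<in> factor1}"
  have atomless: "emeasure \<nu> {a} = 0" for a by (rule nu(3))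
  have AEq: "AE b in \<nu>. corr h g b = (\<integral>b. corr h g b \<partial>\<nu>)" if h: "h \<in> factor2" for h
  proof -
    interpret uncorrelated_family \<nu> "corr h g" P
    proof
      show "bdd_meas \<nu> (corr h g)" by (rule corr_bdd[OF factor2_bdd[OF h] gb])
      show "bdd_meas \<nu> p" if "p \<in> P" for p using that corr_bdd factor1_bdd unfolding P_def by blast
      have "corr (\<lambda>_. 1) (\<lambda>_. 1) = (\<lambda>_. 1)" by (auto simp: corr_def N.prob_space fun_eq_iff)
      then show "(\<lambda>_. 1) \<in> P" unfolding P_def using factor1_const[of 1] by (metis (mono_tags, lifting) mem_Collect_eq)
      show "(\<integral>x. p x * corr h g x \<partial>\<nu>) = (\<integral>x. p x \<partial>\<nu>) * (\<integral>x. corr h g x \<partial>\<nu>)" if "p \<in> P" for p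
        using that corr_uncorrelated[OF _ _ h g] unfolding P_def by blast
      fix p p' assume "p \<in> P" "p' \<in> P"
      then obtain k k' l l' where k: "k \<in> factor1" "k' \<in> factor1" "p = corr k k'" and l: "l \<in> factor1" "l' \<in> factor1" "p' = corr l l'"
        unfolding P_def by blast
      note kb = k(1,2)[THEN factor1_bdd] and lb = l(1,2)[THEN factor1_bdd]
      \<comment> \<open>Moving \<open>l\<close> and \<open>l'\<close> by \<open>T (r n)\<close>
        keeps the products in the factor, and mixing decouples them from \<open>k\<close> and
        \<open>k'\<close>: the correlation tends to the product of \<open>p\<close> and
        \<open>p'\<close>.\<close>
      define s where "s n = corr (\<lambda>y. k y * l (T (r n) y)) (\<lambda>y. k' y * l' (T (r n) y))" for n
      have sP: "s n \<in> P" for n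
        unfolding P_def s_def using factor1_mult[OF k(1) factor1_T[OF l(1)]] factor1_mult[OF k(2) factor1_T[OF l(2)]] by blast
      have s_alt: "s n a = (\<integral>y. (k y * k' (T a y)) * (\<lambda>y. l y * l' (T a y)) (T (r n) y) \<partial>N)" for n a
        unfolding s_def corr_def by (simp add: T_add[symmetric] add.commute mult_ac)
      have "\<exists>C. \<forall>n x. \<bar>s n x\<bar> \<le> C"
      proof -
        obtain C1 where C1: "0 < C1" "\<And>y. \<bar>k y\<bar> \<le> C1" using bdd_meas_bound[OF kb(1)] by blast
        obtain C2 where C2: "0 < C2" "\<And>y. \<bar>k' y\<bar> \<le> C2" using bdd_meas_bound[OF kb(2)] by blast
        obtain C3 where C3: "0 < C3" "\<And>y. \<bar>l y\<bar> \<le> C3" using bdd_meas_bound[OF lb(1)] by blast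
        obtain C4 where C4: "0 < C4" "\<And>y. \<bar>l' y\<bar> \<le> C4" using bdd_meas_bound[OF lb(2)] by blast
        have "\<bar>s n x\<bar> \<le> (C1 * C2) * (C3 * C4)" for n x
          unfolding s_alt
          by (rule N.abs_integral_le_const)
            (unfold abs_mult, intro mult_mono mult_nonneg_nonneg abs_ge_zero less_imp_le[OF C1(1)] less_imp_le[OF C2(1)]
              less_imp_le[OF C3(1)] less_imp_le[OF C4(1)] C1(2) C2(2) C3(2) C4(2))
        then show ?thesis by blast
      qed
      moreover have "(\<lambda>n. s n x) \<longlonglongrightarrow> p x * p' x" for x
        unfolding s_alt k(3) l(3) corr_def by (intro mix bdd_meas_mult kb lb bdd_T)
      ultimately show "\<exists>s::nat \<Rightarrow> real \<Rightarrow> real. (\<forall>n. s n \<in> P) \<and> (\<exists>C. \<forall>n x. \<bar>s n x\<bar> \<le> C) \<and> (\<forall>x. (\<lambda>n. s n x) \<longlonglongrightarrow> p x * p' x)"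
        using sP by blast
    qed (rule nu)+
    have "(\<lambda>b. \<zeta> (b - u)) \<in> multipliers" for u
    proof -
      have "corr (\<lambda>y. F (T u y)) F \<in> multipliers"
        using F factor1_T[OF F] by (intro F_multipliers) (auto simp: P_def)
      from multipliers_mult[OF multipliers_const[of "1 / corr F F 0"] this]
      show ?thesis by (simp add: \<zeta>_def corr_shift[OF Fb Fb])
    qed
    from AE_constant[OF this \<zeta>c \<zeta>01 \<zeta>0 \<zeta>1 atomless] show ?thesis .
  qed
  \<comment> \<open>For almost every \<open>b\<close>, all values \<open>corr g g (b - u)\<close>
    with \<open>u\<close> rational are independent of \<open>b\<close>. Atomlessness yields two
    distinct such times \<open>b\<close> and \<open>b'\<close>; letting \<open>u\<close> tend to
    \<open>b\<close> gives \<open>corr g g (b' - b) = corr g g 0\<close>.\<close>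
  have "AE b in \<nu>. corr (\<lambda>y. g (T u y)) g b = (\<integral>b. corr (\<lambda>y. g (T u y)) g b \<partial>\<nu>)" for u
    by (rule AEq[OF factor2_T[OF g]])
  then have ae: "AE b in \<nu>. \<forall>u\<in>\<rat>. corr g g (b - u) = (\<integral>b. corr g g (b - u) \<partial>\<nu>)"
    unfolding AE_ball_countable[OF countable_rat] corr_shift[OF gb gb] by blast
  from \<nu>.AE_ex[OF ae] obtain b where b: "\<forall>u\<in>\<rat>. corr g g (b - u) = (\<integral>b. corr g g (b - u) \<partial>\<nu>)" by blast
  have "AE b' in \<nu>. b' \<noteq> b" using nu by (intro AE_I[of _ _ "{b}"]) auto
  with ae have "AE b' in \<nu>. b' \<noteq> b \<and> (\<forall>u\<in>\<rat>. corr g g (b' - u) = (\<integral>b. corr g g (b - u) \<partial>\<nu>))"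
    by eventually_elim simp
  from \<nu>.AE_ex[OF this] obtain b' where b': "b' \<noteq> b" "\<forall>u\<in>\<rat>. corr g g (b' - u) = (\<integral>b. corr g g (b - u) \<partial>\<nu>)"
    by blast
  obtain u where u: "\<And>n. u n \<in> \<rat>" "u \<longlonglongrightarrow> b"
    using closure_sequential[of b \<rat>] Rats_closure_real by auto
  have gc: "(\<lambda>n. corr g g (x - u n)) \<longlonglongrightarrow> corr g g (x - b)" for x
    by (rule continuous_on_tendsto_compose[OF corr_continuous[OF gb gb]]) (auto intro!: tendsto_diff u)
  have "(\<lambda>n. corr g g (b - u n)) = (\<lambda>n. corr g g (b' - u n))" using b b' u(1) by simp
  with gc[of b] gc[of b'] have "corr g g (b' - b) = corr g g 0" by (simp add: LIMSEQ_unique)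
  with corr_eq_constant[OF gb, of "b' - b"] b' ng show False by simp
qed

text \<open>If both alternatives failed, \<open>snd_function_of_X2\<close> and its twin would give
  sets \<open>A\<close> and \<open>B\<close> whose projections are nonconstant members of
  \<open>factor1\<close> and \<open>factor2\<close>, against \<open>factor_trivial\<close>.\<close>

lemma snd_cases:
  "(\<exists>\<phi>\<in>M \<rightarrow>\<^sub>M N. AE y in NN. snd y = \<phi> (X1 y)) \<or> (\<exists>\<phi>\<in>M \<rightarrow>\<^sub>M N. AE y in NN. snd y = \<phi> (X2 y))"
proof (rule ccontr)
  assume no: "\<not> ?thesis"
  have lift: "AE y in NN. h (snd y) = c" if "AE y in N. h y = c" for h c
    using AE_distr_eq[OF measurable_snd snd_measure_preserving[OF N_prob N_prob] that] .
  have total: "(\<integral>y. cexp h y \<partial>N) = (\<integral>y. h y \<partial>NN)" if "bdd_meas NN h" for h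
    unfolding cexp_def using Fubini_bdd(2)[OF N_prob N_prob that] by simp
  obtain A where A: "A \<in> sets M" "\<not> (AE y in NN. cexp (\<lambda>y. indicator A (X1 y)) (snd y) = M.prob A)"
    using snd_function_of_X2 no by blast
  obtain B where B: "B \<in> sets M" "\<not> (AE y in NN. cexp (\<lambda>y. indicator B (X2 y)) (snd y) = M.prob B)"
    using tensor_square.snd_function_of_X2[OF swap_X] no by (auto simp: tensor_square.cexp_def[OF swap_X] cexp_def)
  have a: "bdd_meas M (indicator A)" and b: "bdd_meas M (indicator B)" using A B by auto
  have f: "cexp (\<lambda>y. indicator A (X1 y)) \<in> factor1"
    unfolding factor1_def using cexp_bdd[OF bdd_X1[OF a]] cexp_X1[OF a] by blast
  have g: "cexp (\<lambda>y. indicator B (X2 y)) \<in> factor2"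
    unfolding factor2_def using cexp_bdd[OF bdd_X2[OF b]] tensor_square.cexp_X1[OF swap_X b]
    by (auto simp: tensor_square.cexp_def[OF swap_X] cexp_def)
  have "(\<integral>y. cexp (\<lambda>y. indicator A (X1 y)) y \<partial>N) = M.prob A"
    using total[OF bdd_X1[OF a]] integral_X1[OF a] A(1) by (simp add: M.integral_indicator_prob)
  moreover have "(\<integral>y. cexp (\<lambda>y. indicator B (X2 y)) y \<partial>N) = M.prob B"
    using total[OF bdd_X2[OF b]] integral_X2[OF b] B(1) by (simp add: M.integral_indicator_prob)
  ultimately show False
    using factor_trivial[OF f g] A(2) B(2) lift[of "cexp (\<lambda>y. indicator A (X1 y))"]
      lift[of "cexp (\<lambda>y. indicator B (X2 y))"] by auto
qed

end

section \<open>The isomorphism\<close>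

lemma AE_fst:
  assumes "prob_space P" "prob_space Q" "AE z in P \<Otimes>\<^sub>M Q. R (fst z)"
  shows "AE x in P. R x"
proof -
  interpret P: prob_space P by fact
  interpret Q: prob_space Q by fact
  interpret PQ: pair_prob_space P Q ..
  from PQ.AE_pair[OF assms(3)] have "AE x in P. AE y in Q. R x" by simp
  then show ?thesis by eventually_elim (use Q.AE_ex in blast)
qed

context tensor_square
begin

lemma AE_X1: assumes "AE y in NN. R (X1 y)" shows "AE x in M. R x"
proof (rule AE_fst[OF M_prob M_prob])
  from AE_distr_eq[OF Phi_mp assms] Psi_Phi show "AE x in MM. R (fst x)" by eventually_elim simp
qed

text \<open>The isomorphism is \<open>\<phi>1\<close>. For its inverse the roles are exchanged: as
  both coordinates split, \<open>X1\<close> together with \<open>fst\<close> is independent of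
  \<open>snd\<close>, so \<open>function_of_fst\<close> on \<open>N\<close> writes \<open>X1\<close>
  as a map of \<open>fst\<close>.\<close>

lemma flow_iso_of_product:
  assumes \<phi>1: "\<phi>1 \<in> M \<rightarrow>\<^sub>M N" "AE y in NN. fst y = \<phi>1 (X1 y)"
    and \<phi>2: "\<phi>2 \<in> M \<rightarrow>\<^sub>M N" "AE y in NN. snd y = \<phi>2 (X2 y)"
  shows "flow_iso M S N T"
proof -
  have fst_mp: "fst \<in> NN \<rightarrow>\<^sub>M N" "distr NN N fst = N" and snd_mp: "snd \<in> NN \<rightarrow>\<^sub>M N" "distr NN N snd = N"
    by (auto intro: fst_measure_preserving snd_measure_preserving N_prob)
  have "\<exists>\<psi>\<in>N \<rightarrow>\<^sub>M M. AE z in NN. X1 z = \<psi> (fst z)"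
  proof (rule function_of_fst[OF N_prob spN X1_mp(1) sM])
    fix f k g assume f: "bdd_meas N f" and k: "bdd_meas N k" and g: "bdd_meas M g"
    have f1: "bdd_meas M (\<lambda>x. f (\<phi>1 x))" by (rule bdd_meas_comp[OF f \<phi>1(1)])
    have fs: "bdd_meas NN (\<lambda>y. f (fst y))" by (rule bdd_meas_comp[OF f measurable_fst])
    have key: "(\<integral>z. f (fst z) * h (snd z) * g (X1 z) \<partial>NN) = (\<integral>x. f (\<phi>1 x) * g x \<partial>M) * (\<integral>y. h y \<partial>N)"
      if h: "bdd_meas N h" for h
    proof -
      have h2: "bdd_meas M (\<lambda>x. h (\<phi>2 x))" by (rule bdd_meas_comp[OF h \<phi>2(1)])
      have hs: "bdd_meas NN (\<lambda>y. h (snd y))" by (rule bdd_meas_comp[OF h measurable_snd])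
      have "(\<integral>z. f (fst z) * h (snd z) * g (X1 z) \<partial>NN) = (\<integral>z. (f (\<phi>1 (X1 z)) * g (X1 z)) * h (\<phi>2 (X2 z)) \<partial>NN)"
      proof (rule integral_cong_AE)
        show "AE z in NN. f (fst z) * h (snd z) * g (X1 z) = (f (\<phi>1 (X1 z)) * g (X1 z)) * h (\<phi>2 (X2 z))"
          using \<phi>1(2) \<phi>2(2) by eventually_elim simp
      qed (intro bdd_measD bdd_meas_mult fs hs bdd_X1[OF g] bdd_X1[OF f1] bdd_X2[OF h2])+
      also have "\<dots> = (\<integral>x. f (\<phi>1 x) * g x \<partial>M) * (\<integral>x. h (\<phi>2 x) \<partial>M)"
        by (rule X1_X2_independent[OF bdd_meas_mult[OF f1 g] h2])
      also have "(\<integral>x. h (\<phi>2 x) \<partial>M) = (\<integral>y. h (snd y) \<partial>NN)"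
        unfolding integral_X2[OF h2, symmetric]
      proof (rule integral_cong_AE)
        show "AE y in NN. h (\<phi>2 (X2 y)) = h (snd y)" using \<phi>2(2) by eventually_elim simp
      qed (intro bdd_measD bdd_X2[OF h2] hs)+
      also have "\<dots> = (\<integral>y. h y \<partial>N)" by (rule NN.P.integral_distr_eq[OF snd_mp bdd_measD[OF h]])
      finally show ?thesis .
    qed
    show "(\<integral>z. f (fst z) * k (snd z) * g (X1 z) \<partial>NN) = (\<integral>y. k y \<partial>N) * (\<integral>z. f (fst z) * g (X1 z) \<partial>NN)"
      using key[OF k] key[OF bdd_meas_const[of N 1]] by (simp add: N.prob_space)
  qed
  then obtain \<psi> where \<psi>: "\<psi> \<in> N \<rightarrow>\<^sub>M M" "AE z in NN. X1 z = \<psi> (fst z)" by blast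
  have "distr M N \<phi>1 = distr (distr NN M (\<lambda>y. X1 y)) N \<phi>1" by (simp add: X1_mp(2))
  also have "\<dots> = distr NN N (\<lambda>y. \<phi>1 (X1 y))"
    by (subst distr_distr[OF \<phi>1(1) X1_mp(1)]) (simp add: comp_def)
  also have "\<dots> = distr NN N fst"
    by (rule distr_cong_AE) (use \<phi>1 measurable_compose[OF X1_mp(1) \<phi>1(1)] in \<open>auto elim: eventually_mono\<close>)
  finally have "distr M N \<phi>1 = N" by (simp add: fst_mp)
  moreover have "AE x in M. \<psi> (\<phi>1 x) = x"
    by (rule AE_X1) (use \<phi>1(2) \<psi>(2) in \<open>eventually_elim, simp\<close>)
  moreover have "AE y in N. \<phi>1 (\<psi> y) = y"
    by (rule AE_fst[OF N_prob N_prob]) (use \<phi>1(2) \<psi>(2) in \<open>eventually_elim, simp\<close>)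
  moreover have "AE x in M. \<phi>1 (S s x) = T s (\<phi>1 x)" for s
  proof (rule AE_X1)
    show "AE y in NN. \<phi>1 (S s (X1 y)) = T s (\<phi>1 (X1 y))"
      using X1_equivariant[of s] AE_distr_eq[OF tens_mp \<phi>1(2), of s s] \<phi>1(2)
      by eventually_elim (simp add: tens_def)
  qed
  ultimately show ?thesis unfolding flow_iso_def using \<phi>1(1) \<psi>(1) by blast
qed

text \<open>If both coordinates depend on \<open>X1\<close> only, then so does \<open>X2\<close>, which is independent of \<open>X1\<close>: all functions on
  \<open>M\<close> are constant.\<close>

lemma degenerate_snd:
  assumes \<phi>1: "\<phi>1 \<in> M \<rightarrow>\<^sub>M N" "AE y in NN. fst y = \<phi>1 (X1 y)"
    and \<phi>2: "\<phi>2 \<in> M \<rightarrow>\<^sub>M N" "AE y in NN. snd y = \<phi>2 (X1 y)"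
  shows "\<exists>\<phi>\<in>M \<rightarrow>\<^sub>M N. AE y in NN. snd y = \<phi> (X2 y)"
proof -
  define \<theta> where "\<theta> x = X2 (\<phi>1 x, \<phi>2 x)" for x
  have \<theta>: "\<theta> \<in> M \<rightarrow>\<^sub>M M"
    unfolding \<theta>_def by (rule measurable_compose[OF measurable_Pair[OF \<phi>1(1) \<phi>2(1)] X2_mp(1)])
  have X2: "AE y in NN. X2 y = \<theta> (X1 y)"
    using \<phi>1(2) \<phi>2(2) by eventually_elim (metis \<theta>_def prod.collapse)
  have const: "AE x in M. k x = (\<integral>x. k x \<partial>M)" if k: "bdd_meas M k" for k
  proof (rule M.AE_constantI[OF k])
    have k\<theta>: "bdd_meas M (\<lambda>x. k (\<theta> x))" by (rule bdd_meas_comp[OF k \<theta>])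
    have "(\<integral>x. k x * k x \<partial>M) = (\<integral>y. k (X2 y) * k (X2 y) \<partial>NN)"
      by (rule integral_X2[OF bdd_meas_mult[OF k k], symmetric])
    also have "\<dots> = (\<integral>y. k (\<theta> (X1 y)) * k (X2 y) \<partial>NN)"
    proof (rule integral_cong_AE)
      show "AE y in NN. k (X2 y) * k (X2 y) = k (\<theta> (X1 y)) * k (X2 y)" using X2 by eventually_elim simp
    qed (intro bdd_measD bdd_meas_mult bdd_X2[OF k] bdd_X1[OF k\<theta>])+
    also have "\<dots> = (\<integral>x. k (\<theta> x) \<partial>M) * (\<integral>x. k x \<partial>M)" by (rule X1_X2_independent[OF k\<theta> k])
    also have "(\<integral>x. k (\<theta> x) \<partial>M) = (\<integral>y. k (X2 y) \<partial>NN)"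
      unfolding integral_X1[OF k\<theta>, symmetric]
    proof (rule integral_cong_AE)
      show "AE y in NN. k (\<theta> (X1 y)) = k (X2 y)" using X2 by eventually_elim simp
    qed (intro bdd_measD bdd_X2[OF k] bdd_X1[OF k\<theta>])+
    finally show "(\<integral>x. k x * k x \<partial>M) = (\<integral>x. k x \<partial>M) * (\<integral>x. k x \<partial>M)" by (simp add: integral_X2[OF k])
  qed
  have "\<exists>\<phi>\<in>M \<rightarrow>\<^sub>M N. AE y in NN. snd y = \<phi> (fst (prod.swap (\<Psi> y)))"
  proof (rule tensor_square.indep_X2_function[OF swap_X measurable_snd sN], rule tensor_square.indep_X2I[OF swap_X])
    fix g f k assume g: "bdd_meas N g" and f: "bdd_meas M f" and k: "bdd_meas M k"
    have gs: "bdd_meas NN (\<lambda>y. g (snd y))" by (rule bdd_meas_comp[OF g measurable_snd])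
    define c where "c = (\<integral>x. k x \<partial>M)"
    have kc: "AE y in NN. k (X1 y) = c"
      using AE_distr_eq[OF X1_mp const[OF k]] by (simp add: c_def)
    have "(\<integral>y. f (X2 y) * k (X1 y) * g (snd y) \<partial>NN) = (\<integral>y. c * (f (X2 y) * g (snd y)) \<partial>NN)"
    proof (rule integral_cong_AE)
      show "AE y in NN. f (X2 y) * k (X1 y) * g (snd y) = c * (f (X2 y) * g (snd y))"
        using kc by eventually_elim simp
    qed (intro bdd_measD bdd_meas_mult bdd_X2[OF f] bdd_X1[OF k] gs bdd_meas_const)+
    then show "(\<integral>y. f (fst (prod.swap (\<Psi> y))) * k (snd (prod.swap (\<Psi> y))) * g (snd y) \<partial>NN)
      = (\<integral>x. k x \<partial>M) * (\<integral>y. f (fst (prod.swap (\<Psi> y))) * g (snd y) \<partial>NN)"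
      by (simp add: c_def)
  qed
  then show ?thesis by simp
qed

lemma fst_cases:
  "(\<exists>\<phi>\<in>M \<rightarrow>\<^sub>M N. AE y in NN. fst y = \<phi> (X1 y)) \<or> (\<exists>\<phi>\<in>M \<rightarrow>\<^sub>M N. AE y in NN. fst y = \<phi> (X2 y))"
proof -
  have sw: "AE y in NN. fst y = F (\<Psi> y)" if "AE y in NN. snd y = F (\<Psi> (prod.swap y))" for F
    using AE_distr_eq[OF swap_measure_preserving[OF N_prob N_prob] that] by simp
  show ?thesis
    using tensor_square.snd_cases[OF swap_Y] sw[of "\<lambda>x. _ (fst x)"] sw[of "\<lambda>x. _ (snd x)"] by blast
qed

text \<open>Of the four combinations of \<open>fst_cases\<close> and \<open>snd_cases\<close>, one
  is a product and one a product after exchanging \<open>X1\<close> and \<open>X2\<close>;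
  \<open>degenerate_snd\<close> turns the other two into these.\<close>

theorem flow_iso_of_tensor_squares: "flow_iso M S N T"
proof -
  have swapped: "flow_iso M S N T"
    if "\<phi>1 \<in> M \<rightarrow>\<^sub>M N" "AE y in NN. fst y = \<phi>1 (X2 y)" "\<phi>2 \<in> M \<rightarrow>\<^sub>M N" "AE y in NN. snd y = \<phi>2 (X1 y)" for \<phi>1 \<phi>2
    using tensor_square.flow_iso_of_product[OF swap_X, of \<phi>1 \<phi>2] that by simp
  from fst_cases show ?thesis
  proof (elim disjE bexE)
    fix \<phi>1 assume 1: "\<phi>1 \<in> M \<rightarrow>\<^sub>M N" "AE y in NN. fst y = \<phi>1 (X1 y)"
    have "\<exists>\<phi>\<in>M \<rightarrow>\<^sub>M N. AE y in NN. snd y = \<phi> (X2 y)"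
      using snd_cases degenerate_snd[OF 1] by blast
    then show ?thesis using flow_iso_of_product[OF 1] by blast
  next
    fix \<phi>1 assume 1: "\<phi>1 \<in> M \<rightarrow>\<^sub>M N" "AE y in NN. fst y = \<phi>1 (X2 y)"
    have "\<exists>\<phi>\<in>M \<rightarrow>\<^sub>M N. AE y in NN. snd y = \<phi> (X1 y)"
      using snd_cases tensor_square.degenerate_snd[OF swap_X, of \<phi>1] 1 by auto
    then show ?thesis using swapped[OF 1] by blast
  qed
qed

end

theorem mainTheorem1:
  fixes M :: "'a::polish_space measure" and S :: "real \<Rightarrow> 'a \<Rightarrow> 'a"
    and N :: "'b::polish_space measure" and T :: "real \<Rightarrow> 'b \<Rightarrow> 'b"
    and t :: "nat \<Rightarrow> real" and \<nu> :: "real measure"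
  assumes "standard_prob_space M" and "standard_prob_space N"
    and "weakly_mixing_flow M S" and "weakly_mixing_flow N T"
    and "flow_iso (M \<Otimes>\<^sub>M M) (prod_flow S) (N \<Otimes>\<^sub>M N) (prod_flow T)"
    and "prob_space \<nu>" and "sets \<nu> = sets borel" and "\<And>a. emeasure \<nu> {a} = 0"
    and "\<And>f g. L2_fun N f \<Longrightarrow> L2_fun N g \<Longrightarrow>
           (\<lambda>i. \<integral>y. f (T (t i) y) * g y \<partial>N)
             \<longlonglongrightarrow> (\<integral>a. (\<integral>y. f (T a y) * g y \<partial>N) \<partial>\<nu>)"
  shows "flow_iso M S N T"
proof -
  have M: "prob_space M" "sets M = sets borel" and N: "prob_space N" "sets N = sets borel"
    using assms(1,2) unfolding standard_prob_space_def by blast+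
  have S: "mp_flow M S" and T: "mp_flow N T" using assms(3,4) unfolding weakly_mixing_flow_def by blast+
  interpret N: prob_space N by fact
  obtain r where r: "\<And>f g. bdd_meas N f \<Longrightarrow> bdd_meas N g \<Longrightarrow>
    (\<lambda>n::nat. \<integral>y. f y * g (T (r n) y) \<partial>N) \<longlonglongrightarrow> (\<integral>y. f y \<partial>N) * (\<integral>y. g y \<partial>N)"
    using weakly_mixing_sequence[OF assms(4) N(2)] by blast
  obtain \<phi> \<psi> where \<phi>: "\<phi> \<in> M \<Otimes>\<^sub>M M \<rightarrow>\<^sub>M N \<Otimes>\<^sub>M N" "distr (M \<Otimes>\<^sub>M M) (N \<Otimes>\<^sub>M N) \<phi> = N \<Otimes>\<^sub>M N"
    and \<psi>: "\<psi> \<in> N \<Otimes>\<^sub>M N \<rightarrow>\<^sub>M M \<Otimes>\<^sub>M M"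
    and inv: "AE x in M \<Otimes>\<^sub>M M. \<psi> (\<phi> x) = x" "AE y in N \<Otimes>\<^sub>M N. \<phi> (\<psi> y) = y"
    and eq: "\<And>s. AE x in M \<Otimes>\<^sub>M M. \<phi> (prod_flow S s x) = prod_flow T s (\<phi> x)"
    using assms(5) unfolding flow_iso_def by blast
  have \<psi>d: "distr (N \<Otimes>\<^sub>M N) (M \<Otimes>\<^sub>M M) \<psi> = M \<Otimes>\<^sub>M M"
  proof -
    have "distr (N \<Otimes>\<^sub>M N) (M \<Otimes>\<^sub>M M) \<psi> = distr (M \<Otimes>\<^sub>M M) (M \<Otimes>\<^sub>M M) (\<psi> \<circ> \<phi>)"
      using distr_distr[OF \<psi> \<phi>(1)] \<phi>(2) by simp
    also have "\<dots> = distr (M \<Otimes>\<^sub>M M) (M \<Otimes>\<^sub>M M) (\<lambda>x. x)"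
      by (rule distr_cong_AE) (use inv(1) measurable_comp[OF \<phi>(1) \<psi>] in auto)
    finally show ?thesis by simp
  qed
  have L2: "L2_fun N f" if f: "bdd_meas N f" for f
    using bdd_measD[OF f] N.bdd_meas_integrable[OF bdd_meas_mult[OF f f]] unfolding L2_fun_def by (simp add: power2_eq_square)
  have "tensor_square N T M S \<phi> \<psi> r t \<nu>"
  proof (intro tensor_square.intro tensor_flow.intro tensor_square_axioms.intro)
    show "space N = UNIV" using sets_eq_imp_space_eq[OF N(2)] by simp
    show "S s \<in> M \<rightarrow>\<^sub>M M" "distr M M (S s) = M" for s using mp_flowD[OF S] by blast+
    show "AE y in N \<Otimes>\<^sub>M N. \<psi> (tens T s s y) = (S s (fst (\<psi> y)), S s (snd (\<psi> y)))" for s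
    proof -
      have S2: "prod_flow S s \<in> M \<Otimes>\<^sub>M M \<rightarrow>\<^sub>M M \<Otimes>\<^sub>M M" "distr (M \<Otimes>\<^sub>M M) (M \<Otimes>\<^sub>M M) (prod_flow S s) = M \<Otimes>\<^sub>M M"
        using map_prod_measure_preserving[OF M(1) M(1) mp_flowD(3,4)[OF S] mp_flowD(3,4)[OF S]]
        unfolding prod_flow_def[abs_def] by auto
      \<comment> \<open>\<open>\<psi>\<close> is applied to the equivariance of
        \<open>\<phi>\<close>. That it inverts \<open>\<phi>\<close> at the moved point
        \<open>prod_flow S s x\<close> holds almost everywhere because \<open>prod_flow S s\<close>
        preserves the measure.\<close>
      have "AE x in M \<Otimes>\<^sub>M M. \<psi> (prod_flow T s (\<phi> x)) = prod_flow S s x"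
        using eq[of s] AE_distr_eq[OF S2 inv(1)] by eventually_elim metis
      from AE_distr_eq[OF \<psi> \<psi>d this] inv(2) show ?thesis
        by eventually_elim (simp add: prod_flow_def tens_def)
    qed
    show "(\<lambda>i. \<integral>y. f y * g (T (t i) y) \<partial>N) \<longlonglongrightarrow> (\<integral>a. (\<integral>y. f y * g (T a y) \<partial>N) \<partial>\<nu>)"
      if "bdd_meas N f" "bdd_meas N g" for f g
      using assms(9)[OF L2[OF that(2)] L2[OF that(1)]] by (simp add: mult.commute)
  qed (fact T M N \<phi> \<psi> \<psi>d inv r assms)+
  then show ?thesis by (rule tensor_square.flow_iso_of_tensor_squares)
qed

end
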